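(* Consider the closed-loop system described in the context under the static event-triggered gain scheduler, where $\lambda$ satisfies the Lipschitz assumption with constant $\varphi>0$. If $$\varphi<\frac{\mu^2R(1-R)}{G^2\ln(G)},$$ then the closed-loop system (with Dirichlet or Neumann actuation) is globally exponentially stable. More specifically, there exists a constant $\sigma>0$ such that, for every initial condition $u_0\in L^2(0,1)$, the closed-loop solution satisfies $$\|u[t]\|\le G\exp(-\sigma t)\|u[0]\|\quad\text{for all }t\ge0.$$
   Context: Plant. Let $\varepsilon>0$ and $q\in(-\infty,+\infty]$. Consider, for $x\in[0,1]$, $t\ge 0$, $$u_t(t,x)=\varepsilon u_{xx}(t,x)+\lambda(t,x)u(t,x),\qquad u_x(t,0)=q\,u(t,0),$$ $$u(t,1)=U(t)\ \text{(Dirichlet actuation)}\quad\text{or}\quad u_x(t,1)=U(t)\ \text{(Neumann actuation)},$$ with $u(0,x)=u_0(x)$. When $q=+\infty$ the condition at $x=0$ is interpreted as the Dirichlet condition $u(t,0)=0$. Here $\lambda\in C^0(\mathbb{R}_+\times[0,1])$, $\lambda(t,\cdot)\in C^1([0,1])$ for each $t$, there is $\bar\lambda>0$ with $|\lambda(t,x)|\le\bar\lambda$ for all $t\ge0$, $x\in[0,1]$, and (Lipschitz assumption) there is a constant $\varphi>0$ with $|\lambda(t,x)-\lambda(s,x)|\le\varphi|t-s|$ for all $x\in[0,1]$, $t,s\ge0$. $u[t]$ denotes the profile $x\mapsto u(t,x)$; $\|\cdot\|$ and $\langle\cdot,\cdot\rangle$ are the $L^2(0,1)$ norm and inner product. Kernels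 and control. Let $\bar q=\max\{0,-q\}$ and fix $c\ge\varepsilon\bar q^2$ (Dirichlet actuation) or $c\ge\varepsilon\bar q^2+\varepsilon/2$ (Neumann actuation). Given an event time $t_j$, put $b_j(x)=\lambda(t_j,x)$, and for $t\ge t_j$ put $e_j(t,x)=\lambda(t,x)-b_j(x)$, $f_j(t,x)=e_j(t,x)u(t,x)$. Let $K_j$ be the $C^2$ solution on $\{0\le y\le x\le1\}$ (known to exist) of $$K_{j,xx}-K_{j,yy}=\tfrac{b_j(y)+c}{\varepsilon}K_j,\quad K_{j,y}(x,0)=qK_j(x,0),\quad K_j(x,x)=-\tfrac1{2\varepsilon}\int_0^x(b_j(s)+c)\,ds$$ (with $K_j(x,0)=0$ when $q=+\infty$), and define $(\mathcal{K}_jh)(x)=h(x)-\int_0^xK_j(x,y)h(y)\,dy$ for $h\in L^2(0,1)$. For $t\in(t_j,t_{j+1})$ the control is $U(t)=\int_0^1K_j(1,y)u(t,y)\,dy$ (Dirichlet actuation) or $U(t)=K_j(1,1)u(t,1)+\int_0^1K_{j,x}(1,y)u(t,y)\,dy$ (Neumann actuation). The closed-loop solution is the unique $u\in C^0(\mathbb{R}_+;L^2(0,1))\cap C^1(I;L^2(0,1))$, $I=\mathbb{R}_+\setminus\{t_j\}$, with $u[t]\in H^2(0,1)$ for $t>0$, satisfying the equations for all $t\in I$ and $u[0]=u_0$. Constants. Let $\mu_1$ be the smallest eigenvalue of $h\mapsto-h''$ on the set of $h\in H^2(0,1)$ with $h'(0)=qh(0)$ ($h(0)=0$ if $q=+\infty$)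 and $h(1)=0$ (Dirichlet actuation) or $h'(1)=0$ (Neumann actuation). Let $\mu=c+\varepsilon\mu_1$ and $$G=1+\sqrt{\frac{\bar\lambda+c}{4\varepsilon}\left(\exp\left(\frac{4(\bar\lambda+c)}{\varepsilon}\right)-1\right)}.$$ Static event-triggered gain scheduler. Let $R\in(0,1)$ be a design parameter. Set $t_0=0$. Given $t_j$, let $S_j=\{t>t_j:\ \langle\mathcal{K}_ju[t],\mathcal{K}_jf_j[t]\rangle>\mu R\|\mathcal{K}_ju[t]\|^2\}$, where $u[t]$ is the solution for $t\ge t_j$ with the control computed from $K_j$. If $S_j=\emptyset$ the set of event times is $\{t_0,\dots,t_j\}$ (so $t_{j+1}=+\infty$); otherwise $t_{j+1}=\inf S_j$. *)

theory Defs
  imports "HOL-Analysis.Analysis"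
begin

section \<open>The function spaces \<open>L\<^sup>2(0,1)\<close> and \<open>H\<^sup>2(0,1)\<close>\<close>

text \<open>Elements of \<open>L\<^sup>2(0,1)\<close> are represented by square-integrable functions; equality in
  \<open>L\<^sup>2(0,1)\<close> is equality almost everywhere on \<open>[0,1]\<close>. Values outside \<open>[0,1]\<close> never matter.\<close>

definition L2 :: "(real \<Rightarrow> real) set" where
  "L2 = {h. h \<in> borel_measurable (lebesgue_on {0..1}) \<and>
            integrable (lebesgue_on {0..1}) (\<lambda>x. (h x)\<^sup>2)}"

definition L2_inner :: "(real \<Rightarrow> real) \<Rightarrow> (real \<Rightarrow> real) \<Rightarrow> real" where
  "L2_inner g h = (LINT x|lebesgue_on {0..1}. g x * h x)"

definition L2_norm :: "(real \<Rightarrow> real) \<Rightarrow> real" where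
  "L2_norm h = sqrt (L2_inner h h)"

definition L2_eq :: "(real \<Rightarrow> real) \<Rightarrow> (real \<Rightarrow> real) \<Rightarrow> bool" where
  "L2_eq g h \<longleftrightarrow> (AE x in lebesgue_on {0..1}. g x = h x)"

text \<open>\<open>h \<in> H\<^sup>2(0,1)\<close> with derivatives \<open>h1\<close>, \<open>h2\<close>: the function \<open>h\<close> is the continuously
  differentiable representative on \<open>[0,1]\<close> (one-sided derivatives at the endpoints), and \<open>h1\<close> is
  absolutely continuous with derivative \<open>h2 \<in> L\<^sup>2(0,1)\<close>. Boundary values of \<open>h\<close> and \<open>h'\<close>
  are the values of \<open>h\<close> and \<open>h1\<close>.\<close>

definition H2_derivs :: "(real \<Rightarrow> real) \<Rightarrow> (real \<Rightarrow> real) \<Rightarrow> (real \<Rightarrow> real) \<Rightarrow> bool" where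
  "H2_derivs h h1 h2 \<longleftrightarrow>
     (\<forall>x\<in>{0..1}. (h has_real_derivative h1 x) (at x within {0..1})) \<and>
     h2 \<in> L2 \<and>
     (\<forall>x\<in>{0..1}. h1 x = h1 0 + (LINT y|lebesgue_on {0..x}. h2 y))"

definition H2 :: "(real \<Rightarrow> real) set" where
  "H2 = {h. \<exists>h1 h2. H2_derivs h h1 h2}"

definition C1_unit :: "(real \<Rightarrow> real) \<Rightarrow> bool" where
  "C1_unit h \<longleftrightarrow> (\<exists>h'. (\<forall>x\<in>{0..1}. (h has_real_derivative h' x) (at x within {0..1})) \<and>
                     continuous_on {0..1} h')"

text \<open>For \<open>u :: real \<Rightarrow> real \<Rightarrow> real\<close>, the profile \<open>u[t]\<close> is \<open>u t\<close>.\<close>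

definition L2_continuous_on :: "real set \<Rightarrow> (real \<Rightarrow> real \<Rightarrow> real) \<Rightarrow> bool" where
  "L2_continuous_on J u \<longleftrightarrow>
     (\<forall>t\<in>J. u t \<in> L2 \<and> ((\<lambda>s. L2_norm (\<lambda>x. u s x - u t x)) \<longlongrightarrow> 0) (at t within J))"

definition L2_C1_on :: "real set \<Rightarrow> (real \<Rightarrow> real \<Rightarrow> real) \<Rightarrow> (real \<Rightarrow> real \<Rightarrow> real) \<Rightarrow> bool" where
  "L2_C1_on J u u_t \<longleftrightarrow>
     (\<forall>t\<in>J. u t \<in> L2 \<and>
        ((\<lambda>s. L2_norm (\<lambda>x. (u s x - u t x) / (s - t) - u_t t x)) \<longlongrightarrow> 0) (at t within J)) \<and>
     L2_continuous_on J u_t"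

section \<open>The plant\<close>

datatype actuation = Dirichlet | Neumann

text \<open>The condition \<open>h'(0) = q h(0)\<close> in terms of \<open>h0 = h(0)\<close> and \<open>h0' = h'(0)\<close>.\<close>

definition left_bc :: "ereal \<Rightarrow> real \<Rightarrow> real \<Rightarrow> bool" where
  "left_bc q h0 h0' \<longleftrightarrow> (if q = \<infinity> then h0 = 0 else h0' = real_of_ereal q * h0)"

definition right_value :: "actuation \<Rightarrow> real \<Rightarrow> real \<Rightarrow> real" where
  "right_value act h1 h1' = (case act of Dirichlet \<Rightarrow> h1 | Neumann \<Rightarrow> h1')"

text \<open>Solution on \<open>[t0,\<infinity>)\<close> with input \<open>U\<close>, where the equations hold at the times in \<open>J\<close>.\<close>

definition plant_solution ::
  "real \<Rightarrow> ereal \<Rightarrow> actuation \<Rightarrow> (real \<Rightarrow> real \<Rightarrow> real) \<Rightarrow> real \<Rightarrow> real set \<Rightarrow>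
   (real \<Rightarrow> real) \<Rightarrow> (real \<Rightarrow> real \<Rightarrow> real) \<Rightarrow> bool" where
  "plant_solution \<epsilon> q act lam t0 J U u \<longleftrightarrow>
     L2_continuous_on {t0..} u \<and>
     (\<forall>t>t0. u t \<in> H2) \<and>
     (\<exists>u_t. L2_C1_on J u u_t \<and>
        (\<forall>t\<in>J. \<exists>u_x u_xx. H2_derivs (u t) u_x u_xx \<and>
           L2_eq (u_t t) (\<lambda>x. \<epsilon> * u_xx x + lam t x * u t x) \<and>
           left_bc q (u t 0) (u_x 0) \<and>
           right_value act (u t 1) (u_x 1) = U t))"

section \<open>Backstepping kernel and control\<close>

definition triangle :: "(real \<times> real) set" where
  "triangle = {(x, y). 0 \<le> y \<and> y \<le> x \<and> x \<le> 1}"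

definition has_partials ::
  "(real \<Rightarrow> real \<Rightarrow> real) \<Rightarrow> (real \<Rightarrow> real \<Rightarrow> real) \<Rightarrow> (real \<Rightarrow> real \<Rightarrow> real) \<Rightarrow> bool" where
  "has_partials F Fx Fy \<longleftrightarrow>
     (\<forall>(x, y)\<in>triangle.
        ((\<lambda>(x', y'). F x' y') has_derivative (\<lambda>(a, b). Fx x y * a + Fy x y * b))
          (at (x, y) within triangle)) \<and>
     continuous_on triangle (\<lambda>(x, y). Fx x y) \<and>
     continuous_on triangle (\<lambda>(x, y). Fy x y)"

text \<open>\<open>Kx\<close> is the partial derivative \<open>K\<^sub>x\<close>; it is determined on the triangle by \<open>K\<close> and is
  a parameter because the Neumann control law uses it.\<close>

definition backstepping_kernel ::
  "real \<Rightarrow> ereal \<Rightarrow> real \<Rightarrow> (real \<Rightarrow> real) \<Rightarrow>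
   (real \<Rightarrow> real \<Rightarrow> real) \<Rightarrow> (real \<Rightarrow> real \<Rightarrow> real) \<Rightarrow> bool" where
  "backstepping_kernel \<epsilon> q c b K Kx \<longleftrightarrow>
     (\<exists>Ky Kxx Kxy Kyy.
        has_partials K Kx Ky \<and> has_partials Kx Kxx Kxy \<and> has_partials Ky Kxy Kyy \<and>
        (\<forall>(x, y)\<in>triangle. Kxx x y - Kyy x y = (b y + c) / \<epsilon> * K x y) \<and>
        (\<forall>x\<in>{0..1}. left_bc q (K x 0) (Ky x 0)) \<and>
        (\<forall>x\<in>{0..1}. K x x = - 1 / (2 * \<epsilon>) * (LINT s|lebesgue_on {0..x}. b s + c)))"

definition backstepping_transform ::
  "(real \<Rightarrow> real \<Rightarrow> real) \<Rightarrow> (real \<Rightarrow> real) \<Rightarrow> real \<Rightarrow> real" where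
  "backstepping_transform K h = (\<lambda>x. h x - (LINT y|lebesgue_on {0..x}. K x y * h y))"

definition control_law ::
  "actuation \<Rightarrow> (real \<Rightarrow> real \<Rightarrow> real) \<Rightarrow> (real \<Rightarrow> real \<Rightarrow> real) \<Rightarrow> (real \<Rightarrow> real) \<Rightarrow> real" where
  "control_law act K Kx h =
     (case act of
        Dirichlet \<Rightarrow> (LINT y|lebesgue_on {0..1}. K 1 y * h y)
      | Neumann \<Rightarrow> K 1 1 * h 1 + (LINT y|lebesgue_on {0..1}. Kx 1 y * h y))"

section \<open>Constants\<close>

definition is_eigenvalue :: "ereal \<Rightarrow> actuation \<Rightarrow> real \<Rightarrow> bool" where
  "is_eigenvalue q act m \<longleftrightarrow>
     (\<exists>h h1 h2. H2_derivs h h1 h2 \<and> left_bc q (h 0) (h1 0) \<and> right_value act (h 1) (h1 1) = 0 \<and>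
        \<not> L2_eq h (\<lambda>x. 0) \<and> L2_eq (\<lambda>x. - h2 x) (\<lambda>x. m * h x))"

definition is_smallest_eigenvalue :: "ereal \<Rightarrow> actuation \<Rightarrow> real \<Rightarrow> bool" where
  "is_smallest_eigenvalue q act m \<longleftrightarrow>
     is_eigenvalue q act m \<and> (\<forall>m'. is_eigenvalue q act m' \<longrightarrow> m \<le> m')"

definition q_bar :: "ereal \<Rightarrow> real" where
  "q_bar q = real_of_ereal (max 0 (- q))"

definition c_min :: "real \<Rightarrow> ereal \<Rightarrow> actuation \<Rightarrow> real" where
  "c_min \<epsilon> q act =
     (case act of Dirichlet \<Rightarrow> \<epsilon> * (q_bar q)\<^sup>2 | Neumann \<Rightarrow> \<epsilon> * (q_bar q)\<^sup>2 + \<epsilon> / 2)"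

definition gain_const :: "real \<Rightarrow> real \<Rightarrow> real \<Rightarrow> real" where
  "gain_const \<epsilon> lam_bar c =
     1 + sqrt ((lam_bar + c) / (4 * \<epsilon>) * (exp (4 * (lam_bar + c) / \<epsilon>) - 1))"

section \<open>Static event-triggered gain scheduling\<close>

text \<open>The set \<open>S\<^sub>j\<close> of times after \<open>tj\<close> at which the solution \<open>v\<close> violates the triggering bound.\<close>

definition trigger_set ::
  "(real \<Rightarrow> real \<Rightarrow> real) \<Rightarrow> real \<Rightarrow> real \<Rightarrow> real \<Rightarrow>
   (real \<Rightarrow> real \<Rightarrow> real) \<Rightarrow> (real \<Rightarrow> real \<Rightarrow> real) \<Rightarrow> real set" where
  "trigger_set lam \<mu> R tj K v =
     {t. t > tj \<and>
         L2_inner (backstepping_transform K (v t))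
                  (backstepping_transform K (\<lambda>x. (lam t x - lam tj x) * v t x))
         > \<mu> * R * (L2_norm (backstepping_transform K (v t)))\<^sup>2}"

text \<open>The event times are \<open>ts :: nat \<Rightarrow> ereal\<close>, with \<open>ts (Suc j) = \<infinity>\<close> if there is no event after
  the \<open>j\<close>-th one (the infimum of the empty set is \<open>\<infinity>\<close>). The trigger set is evaluated along
  \<open>v j\<close>, the solution on \<open>[t\<^sub>j,\<infinity>)\<close> that starts from \<open>u[t\<^sub>j]\<close> and keeps the gain \<open>K j\<close>
  throughout; by uniqueness it coincides with \<open>u\<close> up to the next event. The absence of a finite
  accumulation point of the event times is not assumed.\<close>

definition event_triggered_solution ::
  "real \<Rightarrow> ereal \<Rightarrow> actuation \<Rightarrow> (real \<Rightarrow> real \<Rightarrow> real) \<Rightarrow> real \<Rightarrow> real \<Rightarrow> real \<Rightarrow>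
   (real \<Rightarrow> real) \<Rightarrow> (real \<Rightarrow> real \<Rightarrow> real) \<Rightarrow> bool" where
  "event_triggered_solution \<epsilon> q act lam c \<mu> R u0 u \<longleftrightarrow>
     (\<exists>(ts :: nat \<Rightarrow> ereal) K Kx v U.
        ts 0 = 0 \<and>
        (\<forall>j. ts j = \<infinity> \<longrightarrow> ts (Suc j) = \<infinity>) \<and>
        (\<forall>j tj. ts j = ereal tj \<longrightarrow>
           backstepping_kernel \<epsilon> q c (lam tj) (K j) (Kx j) \<and>
           plant_solution \<epsilon> q act lam tj {tj<..} (\<lambda>t. control_law act (K j) (Kx j) (v j t)) (v j) \<and>
           L2_eq (v j tj) (u tj) \<and>
           ts (Suc j) = Inf (ereal ` trigger_set lam \<mu> R tj (K j) (v j))) \<and>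
        (\<forall>j t. ts j < ereal t \<and> ereal t < ts (Suc j) \<longrightarrow>
           U t = control_law act (K j) (Kx j) (u t)) \<and>
        plant_solution \<epsilon> q act lam 0 {t. t \<ge> 0 \<and> ereal t \<notin> range ts} U u \<and>
        L2_eq (u 0) u0)"

end

theory Submission
  imports Defs
begin

text \<open>Let \<open>w = \<K> u\<close> be the backstepping image of the state between two events. The kernel equations
  turn the closed loop into \<open>w\<^sub>t = \<epsilon> w\<^sub>x\<^sub>x - c w + \<K> f\<close> with homogeneous boundary conditions, so the
  Rayleigh inequality for \<open>\<mu>\<^sub>1\<close> and the triggering rule give the decay rate \<open>\<mu> (1 - R)\<close> for \<open>\<parallel>w\<parallel>\<close>.
  Returning to \<open>u\<close> costs a factor \<open>P \<ge> \<parallel>\<K>\<parallel> \<parallel>\<K>\<^sup>-\<^sup>1\<parallel>\<close> per event. Since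
  \<open>\<parallel>f\<parallel> \<le> \<phi> (t - t\<^sub>j) \<parallel>u\<parallel>\<close>, an event cannot occur before \<open>t\<^sub>j + \<mu> R / (\<phi> P)\<close>, and the bound on \<open>\<phi>\<close> says
  that the decay during this dwell time beats the factor \<open>P\<close>.

  The estimate with the single factor \<open>G\<close> needs \<open>P \<le> G\<close>. With \<open>a = (lam_bar + c) / \<epsilon>\<close> and
  \<open>k = max 0 (-q) \<le> sqrt a\<close>, the function \<open>(a/2) x exp (a (x\<^sup>2 - y\<^sup>2) / 8 + k (x - y))\<close> is a supersolution of
  the kernel equations. It is separable, so Gronwall's inequality bounds the inverse transformation without
  constructing its kernel.\<close>

subsection \<open>Square-integrable functions\<close>

text \<open>The kernel is given only by its equations, so its bound comes from comparison along
  characteristics. The comparison presupposes a bound by a multiple \<open>th\<close> of the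
  majorant and returns a smaller one, hence an iteration. Likewise \<open>\<mu>1\<close> is given
  only as a least eigenvalue: an explicit positive eigenfunction and Picone's inequality replace a
  spectral theorem. At an event time the state is merely in L2 and the equations may fail, so energy
  estimates start just after the event and pass to the limit. The trigger is evaluated along an
  auxiliary solution, and uniqueness carries its decay over to \<open>u\<close>. With the dwell time
  T = \<mu> R / (\<phi> P), the requirement P exp (-\<mu> (1-R) T) < 1 reads \<phi> P ln P < \<mu>^2
  R (1-R); the hypothesis implies it because 1 < P \<le> G \<le> G^2. All completed intervals thus
  cancel their own factor P, and only the current one contributes it to the final estimate.\<close>

lemma L2_mult_integrable:
  assumes "g \<in> L2" "h \<in> L2"
  shows "integrable (lebesgue_on {0..1}) (\<lambda>x. g x * h x)"
proof (rule Bochner_Integration.integrable_bound)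
  show "integrable (lebesgue_on {0..1}) (\<lambda>x. (g x)\<^sup>2 + (h x)\<^sup>2)"
    using assms by (auto simp: L2_def)
  show "(\<lambda>x. g x * h x) \<in> borel_measurable (lebesgue_on {0..1})"
    using assms by (auto simp: L2_def)
  have "\<bar>a * b\<bar> \<le> a\<^sup>2 + b\<^sup>2" for a b :: real
  proof -
    have "2 * \<bar>a * b\<bar> \<le> a\<^sup>2 + b\<^sup>2" using sum_squares_bound[of "\<bar>a\<bar>" "\<bar>b\<bar>"] by (simp add: abs_mult)
    then show ?thesis using abs_ge_zero[of "a * b"] by linarith
  qed
  then show "AE x in lebesgue_on {0..1}. norm (g x * h x) \<le> norm ((g x)\<^sup>2 + (h x)\<^sup>2)"
    by auto
qed

lemma continuous_imp_L2: "continuous_on {0..1} h \<Longrightarrow> h \<in> L2"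
  unfolding L2_def
  by (auto intro!: continuous_imp_measurable_on_sets_lebesgue continuous_imp_integrable_real continuous_intros)

lemma L2_integrable: "h \<in> L2 \<Longrightarrow> integrable (lebesgue_on {0..1}) h"
  using L2_mult_integrable[of "\<lambda>_. 1" h] continuous_imp_L2[of "\<lambda>_. 1"] by auto

lemma L2_measurable: "h \<in> L2 \<Longrightarrow> h \<in> borel_measurable (lebesgue_on {0..1})"
  by (simp add: L2_def)

lemma L2_cmult: "h \<in> L2 \<Longrightarrow> (\<lambda>x. a * h x) \<in> L2"
  by (auto simp: L2_def power_mult_distrib)

lemma L2_add:
  assumes "g \<in> L2" "h \<in> L2"
  shows "(\<lambda>x. g x + h x) \<in> L2"
proof -
  have "integrable (lebesgue_on {0..1}) (\<lambda>x. (g x)\<^sup>2 + (h x)\<^sup>2 + 2 * (g x * h x))"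
    using assms L2_mult_integrable[OF assms] by (intro Bochner_Integration.integrable_add integrable_mult_right) (auto simp: L2_def)
  moreover have "(\<lambda>x. (g x + h x)\<^sup>2) = (\<lambda>x. (g x)\<^sup>2 + (h x)\<^sup>2 + 2 * (g x * h x))"
    by (auto simp: power2_sum algebra_simps)
  ultimately show ?thesis using assms by (auto simp: L2_def)
qed

lemma L2_diff: "g \<in> L2 \<Longrightarrow> h \<in> L2 \<Longrightarrow> (\<lambda>x. g x - h x) \<in> L2"
  using L2_add[of g "\<lambda>x. (-1) * h x"] L2_cmult[of h "-1"] by auto

lemma L2_divide: "h \<in> L2 \<Longrightarrow> (\<lambda>x. h x / a) \<in> L2"
  using L2_cmult[of h "1/a"] by auto

lemma L2_inner_commute: "L2_inner g h = L2_inner h g"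
  by (simp add: L2_inner_def mult.commute)

lemma L2_inner_cong:
  assumes "\<And>x. x \<in> {0..1} \<Longrightarrow> g x = g' x" "\<And>x. x \<in> {0..1} \<Longrightarrow> h x = h' x"
  shows "L2_inner g h = L2_inner g' h'"
  unfolding L2_inner_def using assms by (intro Bochner_Integration.integral_cong) auto

lemma L2_norm_cong: "(\<And>x. x \<in> {0..1} \<Longrightarrow> g x = h x) \<Longrightarrow> L2_norm g = L2_norm h"
  using L2_inner_cong[of g h g h] by (simp add: L2_norm_def)

lemma L2_inner_cong_AE:
  assumes "L2_eq h h'" "g \<in> L2" "h \<in> L2" "h' \<in> L2"
  shows "L2_inner g h = L2_inner g h'"
  unfolding L2_inner_def using assms
  by (intro integral_cong_AE) (auto simp: L2_def L2_eq_def)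

lemma L2_norm_cong_AE:
  assumes "L2_eq g h" "g \<in> L2" "h \<in> L2"
  shows "L2_norm g = L2_norm h"
proof -
  have "L2_inner g g = L2_inner h h"
    unfolding L2_inner_def using assms by (intro integral_cong_AE) (auto simp: L2_def L2_eq_def)
  then show ?thesis by (simp add: L2_norm_def)
qed

lemma L2_inner_add_right:
  "f \<in> L2 \<Longrightarrow> g \<in> L2 \<Longrightarrow> h \<in> L2 \<Longrightarrow> L2_inner f (\<lambda>x. g x + h x) = L2_inner f g + L2_inner f h"
  unfolding L2_inner_def by (simp add: distrib_left L2_mult_integrable)

lemma L2_inner_diff_right:
  "f \<in> L2 \<Longrightarrow> g \<in> L2 \<Longrightarrow> h \<in> L2 \<Longrightarrow> L2_inner f (\<lambda>x. g x - h x) = L2_inner f g - L2_inner f h"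
  unfolding L2_inner_def by (simp add: right_diff_distrib L2_mult_integrable)

lemma L2_inner_cmult_right: "L2_inner f (\<lambda>x. a * h x) = a * L2_inner f h"
  unfolding L2_inner_def by (simp add: mult.left_commute)

lemma L2_inner_self_nonneg: "0 \<le> L2_inner h h"
  unfolding L2_inner_def by (intro integral_nonneg_AE) auto

lemma L2_norm_nonneg [simp]: "0 \<le> L2_norm h"
  by (simp add: L2_norm_def L2_inner_self_nonneg)

lemma L2_norm_power2: "(L2_norm h)\<^sup>2 = L2_inner h h"
  by (simp add: L2_norm_def L2_inner_self_nonneg)

lemma L2_Cauchy_Schwarz:
  assumes "g \<in> L2" "h \<in> L2"
  shows "\<bar>L2_inner g h\<bar> \<le> L2_norm g * L2_norm h"
proof -
  define A B C where "A = L2_inner g g" and "B = L2_inner g h" and "C = L2_inner h h"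
  have nn: "A \<ge> 0" "C \<ge> 0" by (auto simp: A_def C_def L2_inner_self_nonneg)
  have pos: "0 \<le> s\<^sup>2 * A - 2 * s * t * B + t\<^sup>2 * C" for s t
  proof -
    define k where "k = (\<lambda>x. s * g x - t * h x)"
    have L: "(\<lambda>x. s * g x) \<in> L2" "(\<lambda>x. t * h x) \<in> L2" "k \<in> L2"
      using assms by (auto simp: k_def intro!: L2_cmult L2_diff)
    have k: "L2_inner f k = s * L2_inner f g - t * L2_inner f h" if "f \<in> L2" for f
      using L that unfolding k_def by (simp add: L2_inner_diff_right L2_inner_cmult_right)
    have "L2_inner k k = s * L2_inner k g - t * L2_inner k h" using k L by blast
    also have "\<dots> = s * (s * A - t * B) - t * (s * B - t * C)"
      using k[OF assms(1)] k[OF assms(2)]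
      by (simp add: L2_inner_commute[of k] A_def B_def C_def L2_inner_commute[of h g])
    finally show ?thesis using L2_inner_self_nonneg[of k] by (simp add: power2_eq_square algebra_simps)
  qed
  have "B\<^sup>2 \<le> A * C"
  proof (cases "C = 0")
    case True
    have "0 \<le> A - 2 * t * B" for t using pos[of 1 t] True by simp
    \<comment> \<open>For \<open>B \<noteq> 0\<close> this choice of \<open>t\<close> turns the
      right-hand side into -1.\<close>
    from this[of "(A + 1) / (2 * B)"] have "B = 0" by (cases "B = 0") auto
    then show ?thesis by (simp add: True)
  next
    case False
    have "0 \<le> C * (A * C - B\<^sup>2)" using pos[of C B] by (simp add: power2_eq_square algebra_simps)
    then show ?thesis using False nn by (simp add: zero_le_mult_iff)
  qed
  then have "\<bar>B\<bar> \<le> sqrt (A * C)" using real_le_rsqrt by fastforce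
  then show ?thesis by (simp add: L2_norm_def A_def B_def C_def real_sqrt_mult)
qed

lemma L2_inner_le: "g \<in> L2 \<Longrightarrow> h \<in> L2 \<Longrightarrow> L2_inner g h \<le> L2_norm g * L2_norm h"
  using L2_Cauchy_Schwarz by fastforce

lemma L2_norm_triangle:
  assumes "g \<in> L2" "h \<in> L2"
  shows "L2_norm (\<lambda>x. g x + h x) \<le> L2_norm g + L2_norm h"
proof -
  have s: "(\<lambda>x. g x + h x) \<in> L2" by (rule L2_add[OF assms])
  have "(L2_norm (\<lambda>x. g x + h x))\<^sup>2 = L2_inner g g + 2 * L2_inner g h + L2_inner h h"
    using assms s L2_inner_add_right[OF s assms] L2_inner_add_right[OF assms(1) assms]
      L2_inner_add_right[OF assms(2) assms]
    by (simp add: L2_norm_power2 L2_inner_commute[of "\<lambda>x. g x + h x" g] L2_inner_commute[of "\<lambda>x. g x + h x" h] L2_inner_commute[of h g])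
  also have "\<dots> \<le> (L2_norm g + L2_norm h)\<^sup>2"
    using L2_inner_le[OF assms] by (simp add: power2_sum L2_norm_power2)
  finally show ?thesis by (rule power2_le_imp_le) simp
qed

lemma L2_norm_cmult: "L2_norm (\<lambda>x. a * h x) = \<bar>a\<bar> * L2_norm h"
proof -
  have "L2_inner (\<lambda>x. a * h x) (\<lambda>x. a * h x) = a\<^sup>2 * L2_inner h h"
    by (simp add: L2_inner_cmult_right L2_inner_commute[of "\<lambda>x. a * h x" h] power2_eq_square)
  then show ?thesis by (simp add: L2_norm_def real_sqrt_mult)
qed

lemma L2_norm_minus_commute: "L2_norm (\<lambda>x. g x - h x) = L2_norm (\<lambda>x. h x - g x)"
  using L2_norm_cmult[of "-1" "\<lambda>x. h x - g x"] by simp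

lemma L2_norm_triangle_sub:
  assumes "g \<in> L2" "h \<in> L2"
  shows "L2_norm g \<le> L2_norm h + L2_norm (\<lambda>x. g x - h x)"
  using L2_norm_triangle[of h "\<lambda>x. g x - h x"] assms by (simp add: L2_diff)

lemma abs_L2_norm_diff_le:
  assumes "g \<in> L2" "h \<in> L2"
  shows "\<bar>L2_norm g - L2_norm h\<bar> \<le> L2_norm (\<lambda>x. g x - h x)"
  using L2_norm_triangle_sub[OF assms] L2_norm_triangle_sub[OF assms(2,1)] L2_norm_minus_commute[of g h]
  by linarith

lemma L2_norm_mono:
  assumes "g \<in> borel_measurable (lebesgue_on {0..1})" "h \<in> L2"
    and le: "\<And>x. x \<in> {0..1} \<Longrightarrow> \<bar>g x\<bar> \<le> \<bar>h x\<bar>"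
  shows "g \<in> L2" "L2_norm g \<le> L2_norm h"
proof -
  have sq: "(g x)\<^sup>2 \<le> (h x)\<^sup>2" if "x \<in> {0..1}" for x
    using le[OF that] by (simp add: abs_le_square_iff)
  have "integrable (lebesgue_on {0..1}) (\<lambda>x. (g x)\<^sup>2)"
  proof (rule Bochner_Integration.integrable_bound)
    show "integrable (lebesgue_on {0..1}) (\<lambda>x. (h x)\<^sup>2)" using assms(2) by (simp add: L2_def)
    show "(\<lambda>x. (g x)\<^sup>2) \<in> borel_measurable (lebesgue_on {0..1})" using assms(1) by simp
    show "AE x in lebesgue_on {0..1}. norm ((g x)\<^sup>2) \<le> norm ((h x)\<^sup>2)"
      using sq by (intro AE_I2) simp
  qed
  with assms(1) show g: "g \<in> L2" by (simp add: L2_def)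
  have "L2_inner g g \<le> L2_inner h h"
    unfolding L2_inner_def
  proof (rule integral_mono)
    show "g x * g x \<le> h x * h x" if "x \<in> space (lebesgue_on {0..1})" for x
      using sq[of x] that by (simp add: power2_eq_square)
  qed (intro L2_mult_integrable g assms(2))+
  then show "L2_norm g \<le> L2_norm h" by (simp add: L2_norm_def)
qed

subsection \<open>Functions on the triangle\<close>

lemma deriv_within_nonneg_mono:
  fixes f f' :: "real \<Rightarrow> real"
  assumes "\<And>x. x \<in> {a..b} \<Longrightarrow> (f has_real_derivative f' x) (at x within {a..b})"
    and "\<And>x. a < x \<Longrightarrow> x < b \<Longrightarrow> 0 \<le> f' x" and "a \<le> b"
  shows "f a \<le> f b"
proof (rule DERIV_nonneg_imp_increasing_open[OF assms(3)])
  show "\<exists>y. DERIV f x :> y \<and> 0 \<le> y" if "a < x" "x < b" for x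
    using assms(1)[of x] assms(2)[OF that] that at_within_Icc_at[OF that] by auto
  show "continuous_on {a..b} f" using assms(1) by (rule DERIV_continuous_on)
qed

lemma triangle_iff: "(x, y) \<in> triangle \<longleftrightarrow> 0 \<le> y \<and> y \<le> x \<and> x \<le> 1"
  by (simp add: triangle_def)

lemma compact_triangle: "compact triangle"
proof -
  have "triangle = ({0..1} \<times> {0..1}) \<inter> {p. snd p \<le> fst p}"
    by (auto simp: triangle_def)
  moreover have "compact (({0..1} \<times> {0..1}) \<inter> {p :: real \<times> real. snd p \<le> fst p})"
    by (intro compact_Int_closed compact_Times compact_Icc closed_Collect_le continuous_intros)
  ultimately show ?thesis by (simp only:)
qed

lemma triangle_bounded:
  assumes "continuous_on triangle (\<lambda>(x, y). F x y)"
  obtains C :: real where "C > 0" "\<And>x y. (x, y) \<in> triangle \<Longrightarrow> \<bar>F x y\<bar> \<le> C"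
proof -
  have "bounded ((\<lambda>(x, y). F x y) ` triangle)"
    using compact_continuous_image[OF assms compact_triangle] compact_imp_bounded by blast
  then obtain C where C: "C > 0" "\<forall>p\<in>triangle. norm (case p of (x, y) \<Rightarrow> F x y) \<le> C"
    by (fastforce simp: bounded_pos)
  show ?thesis
  proof (rule that[OF C(1)])
    show "\<bar>F x y\<bar> \<le> C" if "(x, y) \<in> triangle" for x y
      using bspec[OF C(2) that] by simp
  qed
qed

lemma has_partialsI:
  assumes "\<And>x y. (x, y) \<in> triangle \<Longrightarrow>
      ((\<lambda>p. F (fst p) (snd p)) has_derivative (\<lambda>p. Fx x y * fst p + Fy x y * snd p)) (at (x, y) within triangle)"
    and "continuous_on triangle (\<lambda>p. Fx (fst p) (snd p))" "continuous_on triangle (\<lambda>p. Fy (fst p) (snd p))"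
  shows "has_partials F Fx Fy"
  using assms unfolding has_partials_def by (auto simp: case_prod_unfold)

lemma has_partialsD:
  assumes "has_partials F Fx Fy"
  shows "(x, y) \<in> triangle \<Longrightarrow>
      ((\<lambda>p. F (fst p) (snd p)) has_derivative (\<lambda>p. Fx x y * fst p + Fy x y * snd p)) (at (x, y) within triangle)"
    and "continuous_on triangle (\<lambda>p. Fx (fst p) (snd p))" "continuous_on triangle (\<lambda>p. Fy (fst p) (snd p))"
  using assms unfolding has_partials_def by (auto simp: case_prod_unfold)

lemma has_partials_continuous:
  assumes "has_partials F Fx Fy"
  shows "continuous_on triangle (\<lambda>p. F (fst p) (snd p))"
  unfolding continuous_on_eq_continuous_within
  using has_partialsD(1)[OF assms] has_derivative_continuous by fastforce

lemma has_partials_add: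
  assumes "has_partials F Fx Fy" "has_partials H Hx Hy"
  shows "has_partials (\<lambda>x y. F x y + H x y) (\<lambda>x y. Fx x y + Hx x y) (\<lambda>x y. Fy x y + Hy x y)"
  by (rule has_partialsI)
     (auto intro!: has_derivative_eq_rhs[OF has_derivative_add[OF has_partialsD(1)[OF assms(1)] has_partialsD(1)[OF assms(2)]]]
        continuous_intros has_partialsD(2,3)[OF assms(1)] has_partialsD(2,3)[OF assms(2)] simp: algebra_simps)

lemma has_partials_cmult:
  assumes "has_partials F Fx Fy"
  shows "has_partials (\<lambda>x y. a * F x y) (\<lambda>x y. a * Fx x y) (\<lambda>x y. a * Fy x y)"
  by (rule has_partialsI)
     (auto intro!: has_derivative_eq_rhs[OF has_derivative_mult_right[OF has_partialsD(1)[OF assms]]]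
        continuous_intros has_partialsD(2,3)[OF assms] simp: algebra_simps)

lemma has_partials_diff:
  assumes "has_partials F Fx Fy" "has_partials H Hx Hy"
  shows "has_partials (\<lambda>x y. F x y - H x y) (\<lambda>x y. Fx x y - Hx x y) (\<lambda>x y. Fy x y - Hy x y)"
  using has_partials_add[OF assms(1) has_partials_cmult[OF assms(2), of "-1"]] by simp

text \<open>Derivatives are taken within the triangle and within \<open>S\<close>, so the curve may
  run along an edge or end in a corner.\<close>

lemma has_partials_chain:
  assumes F: "has_partials F Fx Fy"
    and p: "(p has_real_derivative p') (at s within S)"
    and r: "(r has_real_derivative r') (at s within S)"
    and tri: "\<And>t. t \<in> S \<Longrightarrow> (p t, r t) \<in> triangle" and s: "s \<in> S"
  shows "((\<lambda>t. F (p t) (r t)) has_real_derivative Fx (p s) (r s) * p' + Fy (p s) (r s) * r') (at s within S)"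
proof -
  have 1: "((\<lambda>t. (p t, r t)) has_derivative (\<lambda>h. (p' * h, r' * h))) (at s within S)"
    using p r by (auto intro!: has_derivative_Pair simp: has_field_derivative_def)
  have 2: "((\<lambda>p. F (fst p) (snd p)) has_derivative (\<lambda>h. Fx (p s) (r s) * fst h + Fy (p s) (r s) * snd h))
      (at (p s, r s) within (\<lambda>t. (p t, r t)) ` S)"
    by (rule has_derivative_subset[OF has_partialsD(1)[OF F]]) (use tri s in auto)
  show ?thesis
    using has_derivative_in_compose[OF 1 2]
    by (auto simp: has_field_derivative_def algebra_simps elim!: has_derivative_eq_rhs)
qed

text \<open>\<open>Dx + Dy\<close> is the derivative in direction (1,1), and every point of the
  triangle is reached in this direction from the edge y = 0.\<close>

lemma nonneg_on_triangle:
  assumes D: "has_partials D Dx Dy"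
    and S: "\<And>x y. (x, y) \<in> triangle \<Longrightarrow> 0 \<le> Dx x y + Dy x y"
    and D0: "\<And>x. x \<in> {0..1} \<Longrightarrow> 0 \<le> D x 0"
    and xy: "(x, y) \<in> triangle"
  shows "0 \<le> D x y"
proof -
  have "D (x - y + 0) 0 \<le> D (x - y + y) y"
  proof (rule deriv_within_nonneg_mono[where f = "\<lambda>s. D (x - y + s) s"])
    show "((\<lambda>s. D (x - y + s) s) has_real_derivative Dx (x - y + s) s * 1 + Dy (x - y + s) s * 1)
        (at s within {0..y})" if "s \<in> {0..y}" for s
      using xy that by (intro has_partials_chain[OF D]) (auto intro!: derivative_eq_intros simp: triangle_iff)
  qed (use S xy in \<open>auto simp: triangle_iff\<close>)
  with D0[of "x - y"] xy show ?thesis by (simp add: triangle_iff)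
qed

text \<open>Along the other characteristic, from the diagonal point (m, m) in direction (1,-1), the
  mixed derivatives cancel and \<open>Dxx - Dyy\<close> is the derivative of \<open>Dx + Dy\<close>.
  With \<open>nonneg_on_triangle\<close> this gives a comparison principle for the wave operator
  with data on the diagonal and on y = 0.\<close>

lemma characteristic_derivative_nonneg:
  assumes Dx: "has_partials Dx Dxx Dxy" and Dy: "has_partials Dy Dxy Dyy"
    and box: "\<And>x y. (x, y) \<in> triangle \<Longrightarrow> 0 \<le> Dxx x y - Dyy x y"
    and diag: "\<And>x. x \<in> {0..1} \<Longrightarrow> 0 \<le> Dx x x + Dy x x"
    and xy: "(x, y) \<in> triangle"
  shows "0 \<le> Dx x y + Dy x y"
proof -
  define m d where "m = (x + y) / 2" and "d = (x - y) / 2"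
  have md: "m + d = x" "m - d = y" "0 \<le> d" "m \<in> {0..1}"
    using xy by (auto simp: m_def d_def triangle_iff field_simps)
  have tri: "(m + s, m - s) \<in> triangle" if "s \<in> {0..d}" for s
    using that md xy by (auto simp: triangle_iff)
  have "Dx (m + 0) (m - 0) + Dy (m + 0) (m - 0) \<le> Dx (m + d) (m - d) + Dy (m + d) (m - d)"
  proof (rule deriv_within_nonneg_mono[where f = "\<lambda>s. Dx (m + s) (m - s) + Dy (m + s) (m - s)"])
    show "((\<lambda>s. Dx (m + s) (m - s) + Dy (m + s) (m - s)) has_real_derivative
        (Dxx (m + s) (m - s) * 1 + Dxy (m + s) (m - s) * (-1)) +
        (Dxy (m + s) (m - s) * 1 + Dyy (m + s) (m - s) * (-1))) (at s within {0..d})"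
      if "s \<in> {0..d}" for s
      using that tri by (intro DERIV_add has_partials_chain[OF Dx] has_partials_chain[OF Dy])
        (auto intro!: derivative_eq_intros)
    show "0 \<le> (Dxx (m + s) (m - s) * 1 + Dxy (m + s) (m - s) * (-1)) +
        (Dxy (m + s) (m - s) * 1 + Dyy (m + s) (m - s) * (-1))" if "0 < s" "s < d" for s
      using box[OF tri[of s]] that by simp
  qed (use md in simp)
  with diag[OF md(4)] md show ?thesis by simp
qed

subsection \<open>A bound on the backstepping kernel\<close>

definition kernel_exponent :: "real \<Rightarrow> real \<Rightarrow> real \<Rightarrow> real" where
  "kernel_exponent a k x = a * x\<^sup>2 / 8 + k * x"

text \<open>Each ingredient serves one kernel equation: the factor x gives the slope a/2 on the
  diagonal, the quadratic exponent makes the wave operator at least a times the function, and the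
  linear exponent gives the y-derivative -k times the function at y = 0, which dominates a boundary
  condition with coefficient \<ge> -k.\<close>

definition kernel_majorant :: "real \<Rightarrow> real \<Rightarrow> real \<Rightarrow> real \<Rightarrow> real" where
  "kernel_majorant a k x y = a / 2 * x * exp (kernel_exponent a k x - kernel_exponent a k y)"

lemma kernel_majorant_partials:
  defines "E \<equiv> (\<lambda>a k x y :: real. exp (kernel_exponent a k x - kernel_exponent a k y))"
  shows "has_partials (kernel_majorant a k)
      (\<lambda>x y. a / 2 * (1 + x * (a * x / 4 + k)) * E a k x y)
      (\<lambda>x y. - (a / 2 * x * (a * y / 4 + k)) * E a k x y)" (is ?A)
    and "has_partials (\<lambda>x y. a / 2 * (1 + x * (a * x / 4 + k)) * E a k x y)
      (\<lambda>x y. a / 2 * (2 * (a * x / 4 + k) + x * a / 4 + x * (a * x / 4 + k)\<^sup>2) * E a k x y)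
      (\<lambda>x y. - (a / 2 * (1 + x * (a * x / 4 + k)) * (a * y / 4 + k)) * E a k x y)" (is ?B)
    and "has_partials (\<lambda>x y. - (a / 2 * x * (a * y / 4 + k)) * E a k x y)
      (\<lambda>x y. - (a / 2 * (1 + x * (a * x / 4 + k)) * (a * y / 4 + k)) * E a k x y)
      (\<lambda>x y. a / 2 * x * ((a * y / 4 + k)\<^sup>2 - a / 4) * E a k x y)" (is ?C)
proof -
  have E: "((\<lambda>p. E a k (fst p) (snd p)) has_derivative
      (\<lambda>p. E a k x y * ((a * x / 4 + k) * fst p - (a * y / 4 + k) * snd p))) (at (x, y) within T)" for x y T
    unfolding E_def kernel_exponent_def
    by (auto intro!: derivative_eq_intros ext simp: field_simps)
  have cE: "continuous_on T (\<lambda>p. E a k (fst p) (snd p))" for T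
    unfolding E_def kernel_exponent_def by (intro continuous_intros) auto
  have K: "kernel_majorant a k = (\<lambda>x y. a / 2 * x * E a k x y)"
    by (intro ext) (simp add: kernel_majorant_def E_def)
  show ?A unfolding K
    by (rule has_partialsI) (auto intro!: derivative_eq_intros E ext continuous_intros cE simp: field_simps)
  show ?B
    by (rule has_partialsI) (auto intro!: derivative_eq_intros E ext continuous_intros cE simp: field_simps power2_eq_square)
  show ?C
    by (rule has_partialsI) (auto intro!: derivative_eq_intros E ext continuous_intros cE simp: field_simps power2_eq_square)
qed

lemma kernel_majorant_nonneg: "0 \<le> a \<Longrightarrow> (x, y) \<in> triangle \<Longrightarrow> 0 \<le> kernel_majorant a k x y"
  by (auto simp: kernel_majorant_def triangle_iff)

lemma kernel_exponent_mono:
  "0 \<le> a \<Longrightarrow> 0 \<le> k \<Longrightarrow> 0 \<le> y \<Longrightarrow> y \<le> x \<Longrightarrow> kernel_exponent a k y \<le> kernel_exponent a k x"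
  unfolding kernel_exponent_def
  by (intro add_mono divide_right_mono mult_left_mono power_mono) auto

text \<open>The subtracted linear term is annihilated by the wave operator and lowers the diagonal
  slope of the multiple of the majorant from th a/2 to a/2, which still dominates the slope of
  \<open>K\<close>. The presupposed two-sided bound controls a|K| in the interior and the boundary
  term at y = 0.\<close>

lemma kernel_bound_improve:
  assumes K: "has_partials K Kx Ky" "has_partials Kx Kxx Kxy" "has_partials Ky Kxy Kyy"
    and a: "0 \<le> a" and k: "0 \<le> k" and th: "1 \<le> th"
    and box: "\<And>x y. (x, y) \<in> triangle \<Longrightarrow> \<bar>Kxx x y - Kyy x y\<bar> \<le> a * \<bar>K x y\<bar>"
    and diag: "\<And>x. x \<in> {0..1} \<Longrightarrow> \<bar>Kx x x + Ky x x\<bar> \<le> a / 2"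
    and K00: "K 0 0 = 0"
    and bc: "(\<forall>x\<in>{0..1}. K x 0 = 0) \<or> (\<exists>\<rho>\<ge>-k. \<forall>x\<in>{0..1}. Ky x 0 = \<rho> * K x 0)"
    and bound: "\<And>x y. (x, y) \<in> triangle \<Longrightarrow> \<bar>K x y\<bar> \<le> th * kernel_majorant a k x y"
    and xy: "(x, y) \<in> triangle"
  shows "K x y \<le> th * kernel_majorant a k x y - (th - 1) * (a / 2 * x)"
proof -
  define E where "E = (\<lambda>x y :: real. exp (kernel_exponent a k x - kernel_exponent a k y))"
  note M = kernel_majorant_partials[of a k, folded fun_cong[OF fun_cong[OF E_def]]]
  have lin: "has_partials (\<lambda>x y. x) (\<lambda>x y. 1) (\<lambda>x y. 0)"
    and c1: "has_partials (\<lambda>x y. 1) (\<lambda>x y. 0) (\<lambda>x y. 0)"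
    and c0: "has_partials (\<lambda>x y. 0) (\<lambda>x y. 0) (\<lambda>x y. 0)"
    by (auto intro!: has_partialsI derivative_eq_intros)
  define b where "b = (th - 1) * (a / 2)"
  define \<Psi> where "\<Psi> = (\<lambda>x y. th * kernel_majorant a k x y - b * x)"
  define D where "D = (\<lambda>x y. \<Psi> x y - K x y)"
  define Dx where "Dx = (\<lambda>x y. th * (a / 2 * (1 + x * (a * x / 4 + k)) * E x y) - b * 1 - Kx x y)"
  define Dy where "Dy = (\<lambda>x y. th * (- (a / 2 * x * (a * y / 4 + k)) * E x y) - b * 0 - Ky x y)"
  have D: "has_partials D Dx Dy"
    unfolding D_def Dx_def Dy_def \<Psi>_def
    by (intro has_partials_diff has_partials_cmult M lin K)
  define Dxx where "Dxx = (\<lambda>x y. th * (a / 2 * (2 * (a * x / 4 + k) + x * a / 4 + x * (a * x / 4 + k)\<^sup>2) * E x y) - b * 0 - Kxx x y)"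
  define Dxy where "Dxy = (\<lambda>x y. th * (- (a / 2 * (1 + x * (a * x / 4 + k)) * (a * y / 4 + k)) * E x y) - b * 0 - Kxy x y)"
  define Dyy where "Dyy = (\<lambda>x y. th * (a / 2 * x * ((a * y / 4 + k)\<^sup>2 - a / 4) * E x y) - b * 0 - Kyy x y)"
  have D2: "has_partials Dx Dxx Dxy" "has_partials Dy Dxy Dyy"
    unfolding Dx_def Dy_def Dxx_def Dxy_def Dyy_def
    by (intro has_partials_diff has_partials_cmult M c1 c0 K)+
  have Mdiag: "kernel_majorant a k x y = a / 2 * x * E x y" for x y by (simp add: kernel_majorant_def E_def)
  have Epos: "E x y > 0" for x y by (simp add: E_def)
  have box': "0 \<le> Dxx x y - Dyy x y" if "(x, y) \<in> triangle" for x y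
  proof -
    have xy: "0 \<le> y" "y \<le> x" using that by (auto simp: triangle_iff)
    have sq: "(a * y / 4 + k)\<^sup>2 \<le> (a * x / 4 + k)\<^sup>2"
      using a k xy by (intro power_mono add_mono divide_right_mono mult_left_mono) auto
    have "Dxx x y - Dyy x y = th * (a / 2) * E x y * (a * x + 2 * k + x * ((a * x / 4 + k)\<^sup>2 - (a * y / 4 + k)\<^sup>2))
        - (Kxx x y - Kyy x y)"
      unfolding Dxx_def Dyy_def by (simp add: field_simps)
    moreover have "th * (a / 2) * E x y * (a * x + 2 * k + x * ((a * x / 4 + k)\<^sup>2 - (a * y / 4 + k)\<^sup>2))
        \<ge> th * (a / 2) * E x y * (a * x)"
      using sq xy k a th Epos[of x y] by (intro mult_left_mono) auto
    moreover have "\<bar>Kxx x y - Kyy x y\<bar> \<le> a * (th * (a / 2 * x * E x y))"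
      using box[OF that] mult_left_mono[OF bound[OF that] a] by (simp add: Mdiag)
    moreover have "th * (a / 2) * E x y * (a * x) = a * (th * (a / 2 * x * E x y))" by simp
    ultimately show ?thesis by linarith
  qed
  have diag': "0 \<le> Dx x x + Dy x x" if "x \<in> {0..1}" for x
  proof -
    have "Dx x x + Dy x x = a / 2 - (Kx x x + Ky x x)"
      by (simp add: Dx_def Dy_def E_def b_def field_simps)
    then show ?thesis using diag[OF that] by linarith
  qed
  have S: "0 \<le> Dx x y + Dy x y" if "(x, y) \<in> triangle" for x y
    by (rule characteristic_derivative_nonneg[OF D2 box' diag' that])
  have Psi: "0 \<le> \<Psi> x y" if "(x, y) \<in> triangle" for x y
  proof -
    have "1 \<le> E x y" using kernel_exponent_mono[of a k y x] that a k by (simp add: E_def triangle_iff)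
    then have "a / 2 * x * 1 \<le> a / 2 * x * E x y" using that a by (intro mult_left_mono) (auto simp: triangle_iff)
    then have "th * (a / 2 * x) \<le> th * (a / 2 * x * E x y)" using th by (intro mult_left_mono) auto
    moreover have "0 \<le> a / 2 * x" using a that by (auto simp: triangle_iff)
    ultimately show ?thesis by (simp add: \<Psi>_def Mdiag b_def algebra_simps)
  qed
  have tri0: "(x, 0) \<in> triangle" if "x \<in> {0..1}" for x using that by (simp add: triangle_iff)
  have D0: "0 \<le> D x 0" if x: "x \<in> {0..1}" for x
    using bc
  proof
    assume "\<forall>x\<in>{0..1}. K x 0 = 0"
    then show ?thesis using Psi[OF tri0[OF x]] x by (simp add: D_def)
  next
    assume "\<exists>\<rho>\<ge>-k. \<forall>x\<in>{0..1}. Ky x 0 = \<rho> * K x 0"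
    then obtain \<rho> where r: "\<rho> \<ge> -k" "\<And>x. x \<in> {0..1} \<Longrightarrow> Ky x 0 = \<rho> * K x 0" by auto
    \<comment> \<open>The weight exp (p x) absorbs the boundary term. For \<rho> \<ge> 0 the
      combination \<rho> K + p D is \<rho> \<Psi>, hence nonnegative; for \<rho> < 0 the term with
      \<open>k\<close> from the majorant already dominates \<rho> K.\<close>
    define p where "p = max 0 \<rho>"
    have "exp (p * 0) * D 0 0 \<le> exp (p * x) * D x 0"
    proof (rule deriv_within_nonneg_mono[where f = "\<lambda>s. exp (p * s) * D s 0"])
      fix s assume s: "s \<in> {0..x}"
      have "((\<lambda>s. D s 0) has_real_derivative Dx s 0 * 1 + Dy s 0 * 0) (at s within {0..x})"
        using s x by (intro has_partials_chain[OF D]) (auto intro!: derivative_eq_intros simp: triangle_iff)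
      then show "((\<lambda>s. exp (p * s) * D s 0) has_real_derivative exp (p * s) * (Dx s 0 + p * D s 0)) (at s within {0..x})"
        by (auto intro!: derivative_eq_intros simp: algebra_simps)
    next
      fix s assume "0 < s" "s < x"
      then have s: "s \<in> {0..1}" using x by auto
      have y: "Dy s 0 = - (k * (th * kernel_majorant a k s 0)) - \<rho> * K s 0"
        using r(2)[OF s] by (simp add: Dy_def Mdiag)
      have "0 \<le> k * (th * kernel_majorant a k s 0)"
        using k th kernel_majorant_nonneg[OF a tri0[OF s]] by simp
      moreover have "0 \<le> k * (th * kernel_majorant a k s 0) + \<rho> * K s 0 + p * D s 0"
      proof (cases "\<rho> \<ge> 0")
        case True
        then have "\<rho> * K s 0 + p * D s 0 = \<rho> * \<Psi> s 0" by (simp add: p_def D_def algebra_simps)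
        moreover have "0 \<le> \<rho> * \<Psi> s 0" using True Psi[OF tri0[OF s]] by simp
        ultimately show ?thesis using \<open>0 \<le> k * _\<close> by linarith
      next
        case False
        have "\<bar>\<rho> * K s 0\<bar> \<le> k * (th * kernel_majorant a k s 0)"
          unfolding abs_mult using False r(1) bound[OF tri0[OF s]] k by (intro mult_mono) auto
        then show ?thesis using False by (simp add: p_def)
      qed
      ultimately have "0 \<le> Dx s 0 + p * D s 0"
        using S[OF tri0[OF s]] y by linarith
      then show "0 \<le> exp (p * s) * (Dx s 0 + p * D s 0)" by simp
    qed (use x in simp)
    moreover have "D 0 0 = 0" by (simp add: D_def \<Psi>_def Mdiag K00)
    ultimately show ?thesis by (simp add: zero_le_mult_iff)
  qed
  have "0 \<le> D x y" by (rule nonneg_on_triangle[OF D S D0 xy])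
  then show ?thesis by (simp add: D_def \<Psi>_def b_def)
qed

text \<open>The start of the iteration below. The majorant vanishes at x = 0, so boundedness of
  \<open>K\<close> is too weak; bounded partial derivatives and \<open>K 0 0 = 0\<close> supply the
  factor x.\<close>

lemma kernel_bound_linear:
  assumes K: "has_partials K Kx Ky" and K00: "K 0 0 = 0"
  obtains C where "C > 0" "\<And>x y. (x, y) \<in> triangle \<Longrightarrow> K x y \<le> C * x"
proof -
  obtain B1 where B1: "B1 > 0" "\<And>x y. (x, y) \<in> triangle \<Longrightarrow> \<bar>Kx x y\<bar> \<le> B1"
    by (rule triangle_bounded[of Kx]) (use K in \<open>auto simp: has_partials_def\<close>)
  obtain B2 where B2: "B2 > 0" "\<And>x y. (x, y) \<in> triangle \<Longrightarrow> \<bar>Ky x y\<bar> \<le> B2"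
    by (rule triangle_bounded[of Ky]) (use K in \<open>auto simp: has_partials_def\<close>)
  have lin: "has_partials (\<lambda>x y. x) (\<lambda>x y. 1) (\<lambda>x y. 0)"
    by (auto intro!: has_partialsI derivative_eq_intros)
  note D = has_partials_diff[OF has_partials_cmult[OF lin, of "B1 + B2"] K]
  have "0 \<le> (B1 + B2) * x - K x y" if "(x, y) \<in> triangle" for x y
  proof (rule nonneg_on_triangle[OF D _ _ that])
    show "0 \<le> (B1 + B2) * 1 - Kx x y + ((B1 + B2) * 0 - Ky x y)" if "(x, y) \<in> triangle" for x y
      using B1(2)[OF that] B2(2)[OF that] by simp
    fix x :: real assume x: "x \<in> {0..1}"
    have "(B1 + B2) * 0 - K 0 0 \<le> (B1 + B2) * x - K x 0"
    proof (rule deriv_within_nonneg_mono[where f = "\<lambda>s. (B1 + B2) * s - K s 0"])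
      fix s assume s: "s \<in> {0..x}"
      show "((\<lambda>s. (B1 + B2) * s - K s 0) has_real_derivative
          ((B1 + B2) * 1 - Kx s 0) * 1 + ((B1 + B2) * 0 - Ky s 0) * 0) (at s within {0..x})"
        using s x by (intro has_partials_chain[OF D]) (auto intro!: derivative_eq_intros simp: triangle_iff)
    next
      show "0 \<le> ((B1 + B2) * 1 - Kx s 0) * 1 + ((B1 + B2) * 0 - Ky s 0) * 0" if "0 < s" "s < x" for s
        using B1(2)[of s 0] B2(1) that x by (simp add: triangle_iff)
    qed (use x in simp)
    then show "0 \<le> (B1 + B2) * x - K x 0" by (simp add: K00)
  qed
  then show ?thesis using B1(1) B2(1) by (intro that[of "B1 + B2"]) force+
qed

text \<open>The improvement step contracts the excess of the constant \<open>th\<close> over 1 by a fixed factor.\<close>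

lemma kernel_bound:
  assumes K: "has_partials K Kx Ky" "has_partials Kx Kxx Kxy" "has_partials Ky Kxy Kyy"
    and a: "0 < a" and k: "0 \<le> k"
    and box: "\<And>x y. (x, y) \<in> triangle \<Longrightarrow> \<bar>Kxx x y - Kyy x y\<bar> \<le> a * \<bar>K x y\<bar>"
    and diag: "\<And>x. x \<in> {0..1} \<Longrightarrow> \<bar>Kx x x + Ky x x\<bar> \<le> a / 2"
    and K00: "K 0 0 = 0"
    and bc: "(\<forall>x\<in>{0..1}. K x 0 = 0) \<or> (\<exists>\<rho>\<ge>-k. \<forall>x\<in>{0..1}. Ky x 0 = \<rho> * K x 0)"
    and xy: "(x, y) \<in> triangle"
  shows "\<bar>K x y\<bar> \<le> kernel_majorant a k x y"
proof -
  note mK = has_partials_cmult[of _ _ _ "-1", OF K(1)] has_partials_cmult[of _ _ _ "-1", OF K(2)]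
    has_partials_cmult[of _ _ _ "-1", OF K(3)]
  \<comment> \<open>On the triangle \<open>c\<close> times the majorant is at most a x / 2, so the
    linear term gained in one step is at least the fraction \<open>c\<close> of the excess (th - 1)
    times the majorant.\<close>
  define c where "c = exp (- kernel_exponent a k 1)"
  have c: "0 < c" "c \<le> 1" using a k by (auto simp: c_def kernel_exponent_def)
  have improve: "\<forall>x y. (x, y) \<in> triangle \<longrightarrow> \<bar>K x y\<bar> \<le> (1 + (th - 1) * (1 - c)) * kernel_majorant a k x y"
    if "1 \<le> th" and bound: "\<forall>x y. (x, y) \<in> triangle \<longrightarrow> \<bar>K x y\<bar> \<le> th * kernel_majorant a k x y" for th
  proof (intro allI impI)
    fix x y assume xy: "(x, y) \<in> triangle"
    have 1: "K x y \<le> th * kernel_majorant a k x y - (th - 1) * (a / 2 * x)"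
      by (rule kernel_bound_improve[OF K]) (use a k that box diag K00 bc xy in auto)
    have "-1 * K x y \<le> th * kernel_majorant a k x y - (th - 1) * (a / 2 * x)"
    proof (rule kernel_bound_improve[OF mK _ k \<open>1 \<le> th\<close>])
      show "\<bar>-1 * Kxx x y - -1 * Kyy x y\<bar> \<le> a * \<bar>-1 * K x y\<bar>" if "(x, y) \<in> triangle" for x y
        using box[OF that] by simp
      show "\<bar>-1 * Kx x x + -1 * Ky x x\<bar> \<le> a / 2" if "x \<in> {0..1}" for x
        using diag[OF that] by linarith
      show "(\<forall>x\<in>{0..1}. - 1 * K x 0 = 0) \<or> (\<exists>\<rho>\<ge>-k. \<forall>x\<in>{0..1}. - 1 * Ky x 0 = \<rho> * (- 1 * K x 0))"
        using bc by auto
    qed (use a bound K00 xy in auto)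
    with 1 have 2: "\<bar>K x y\<bar> \<le> th * kernel_majorant a k x y - (th - 1) * (a / 2 * x)" by simp
    have "0 \<le> kernel_exponent a k y" "kernel_exponent a k x \<le> kernel_exponent a k 1"
      using kernel_exponent_mono[of a k 0 y] kernel_exponent_mono[of a k x 1] a k xy
      by (auto simp: triangle_iff kernel_exponent_def)
    then have "c * exp (kernel_exponent a k x - kernel_exponent a k y) \<le> 1"
      unfolding c_def exp_add[symmetric] by simp
    from mult_left_mono[OF this, of "a / 2 * x"] have "c * kernel_majorant a k x y \<le> a / 2 * x"
      using a xy by (simp add: kernel_majorant_def triangle_iff mult_ac)
    then have "(th - 1) * (c * kernel_majorant a k x y) \<le> (th - 1) * (a / 2 * x)"
      using that(1) by (intro mult_left_mono) auto
    moreover have "(1 + (th - 1) * (1 - c)) * kernel_majorant a k x y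
        = th * kernel_majorant a k x y - (th - 1) * (c * kernel_majorant a k x y)"
      by (simp add: algebra_simps)
    ultimately show "\<bar>K x y\<bar> \<le> (1 + (th - 1) * (1 - c)) * kernel_majorant a k x y"
      using 2 by linarith
  qed
  obtain C1 where C1: "C1 > 0" "\<And>x y. (x, y) \<in> triangle \<Longrightarrow> K x y \<le> C1 * x"
    using kernel_bound_linear[OF K(1) K00] by blast
  obtain C2 where C2: "C2 > 0" "\<And>x y. (x, y) \<in> triangle \<Longrightarrow> -1 * K x y \<le> C2 * x"
    using kernel_bound_linear[OF mK(1)] K00 by auto
  \<comment> \<open>Chosen so that d a x / 2 equals (C1 + C2) x, the a priori bound on |K|.\<close>
  define d where "d = 2 * (C1 + C2) / a"
  have d0: "0 \<le> d" using C1 C2 a by (simp add: d_def)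
  have iter: "\<forall>x y. (x, y) \<in> triangle \<longrightarrow> \<bar>K x y\<bar> \<le> (1 + d * (1 - c) ^ n) * kernel_majorant a k x y" for n
  proof (induction n)
    case 0
    show ?case
    proof (intro allI impI)
      fix x y assume xy: "(x, y) \<in> triangle"
      then have x: "0 \<le> x" by (auto simp: triangle_iff)
      have "0 \<le> C1 * x" "0 \<le> C2 * x" using x C1(1) C2(1) by auto
      then have "\<bar>K x y\<bar> \<le> (C1 + C2) * x" using C1(2)[OF xy] C2(2)[OF xy] by (simp add: algebra_simps abs_le_iff)
      also have "\<dots> = d * (a / 2 * x)" using a by (simp add: d_def field_simps)
      also have "\<dots> \<le> (1 + d) * (a / 2 * x)" using x a d0 by (intro mult_right_mono) auto
      also have "\<dots> \<le> (1 + d) * (a / 2 * x * exp (kernel_exponent a k x - kernel_exponent a k y))"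
      proof -
        have "1 \<le> exp (kernel_exponent a k x - kernel_exponent a k y)"
          using kernel_exponent_mono[of a k y x] xy a k by (simp add: triangle_iff)
        from mult_left_mono[OF this, of "a / 2 * x"] show ?thesis
          using x a d0 by (intro mult_left_mono) auto
      qed
      finally show "\<bar>K x y\<bar> \<le> (1 + d * (1 - c) ^ 0) * kernel_majorant a k x y" by (simp add: kernel_majorant_def)
    qed
  next
    case (Suc n)
    have "1 \<le> 1 + d * (1 - c) ^ n" using d0 c by simp
    from improve[OF this Suc] show ?case by (simp add: mult_ac)
  qed
  have "(\<lambda>n. (1 + d * (1 - c) ^ n) * kernel_majorant a k x y) \<longlonglongrightarrow> (1 + d * 0) * kernel_majorant a k x y"
    using c by (intro tendsto_intros LIMSEQ_realpow_zero) auto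
  from LIMSEQ_le_const[OF this, of "\<bar>K x y\<bar>"] iter xy show ?thesis by auto
qed

subsection \<open>Volterra operators\<close>

definition volterra :: "(real \<Rightarrow> real \<Rightarrow> real) \<Rightarrow> (real \<Rightarrow> real) \<Rightarrow> real \<Rightarrow> real" where
  "volterra K h x = (LINT y|lebesgue_on {0..x}. K x y * h y)"

lemma backstepping_transform_eq: "backstepping_transform K h = (\<lambda>x. h x - volterra K h x)"
  by (simp add: backstepping_transform_def volterra_def)

lemma integrable_lebesgue_on_mult:
  fixes g h :: "real \<Rightarrow> real"
  assumes "continuous_on {a..b} g" "integrable (lebesgue_on {a..b}) h"
  shows "integrable (lebesgue_on {a..b}) (\<lambda>y. g y * h y)"
proof -
  have "bounded (g ` {a..b})"
    using compact_continuous_image[OF assms(1)] compact_imp_bounded by blast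
  then obtain C where C: "\<And>y. y \<in> {a..b} \<Longrightarrow> \<bar>g y\<bar> \<le> C"
    unfolding bounded_iff by (metis imageI real_norm_def)
  show ?thesis
  proof (rule Bochner_Integration.integrable_bound)
    show "integrable (lebesgue_on {a..b}) (\<lambda>y. C * h y)" using assms(2) by simp
    show "(\<lambda>y. g y * h y) \<in> borel_measurable (lebesgue_on {a..b})"
      by (intro borel_measurable_times continuous_imp_measurable_on_sets_lebesgue borel_measurable_integrable assms) auto
    show "AE y in lebesgue_on {a..b}. norm (g y * h y) \<le> norm (C * h y)"
      using C by (intro AE_I2) (fastforce simp: abs_mult intro!: mult_right_mono)
  qed
qed

lemma L2_integrable_on:
  assumes "h \<in> L2" "x \<in> {0..1}"
  shows "integrable (lebesgue_on {0..x}) h"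
  by (rule integrable_subinterval[OF L2_integrable[OF assms(1)]]) (use assms in auto)

lemma continuous_on_triangle_slice:
  assumes "continuous_on triangle (\<lambda>p. K (fst p) (snd p))" "x \<in> {0..1}"
  shows "continuous_on {0..x} (\<lambda>y. K x y)"
  using continuous_on_compose2[OF assms(1), of "{0..x}" "\<lambda>y. (x, y)"] assms(2)
  by (force intro!: continuous_intros simp: triangle_iff)

lemma volterra_integrable:
  assumes "continuous_on triangle (\<lambda>p. K (fst p) (snd p))" "h \<in> L2" "x \<in> {0..1}"
  shows "integrable (lebesgue_on {0..x}) (\<lambda>y. K x y * h y)"
  by (intro integrable_lebesgue_on_mult continuous_on_triangle_slice L2_integrable_on assms)

text \<open>Extended by zero to [0,1], the integrand depends continuously on x except at y = x. This
  is a null set, so dominated convergence with bound C |h| applies.\<close>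

lemma volterra_continuous:
  assumes K: "continuous_on triangle (\<lambda>p. K (fst p) (snd p))" and h: "h \<in> L2"
  shows "continuous_on {0..1} (volterra K h)"
proof -
  let ?k = "\<lambda>x y. if y \<in> {0..x} then K x y * h y else 0"
  have eq: "volterra K h x = (LINT y|lebesgue_on {0..1}. ?k x y)" if "x \<in> {0..1}" for x
    unfolding volterra_def by (rule integral_restrict[symmetric]) (use that in auto)
  obtain C where C: "C > 0" "\<And>x y. (x, y) \<in> triangle \<Longrightarrow> \<bar>K x y\<bar> \<le> C"
    by (rule triangle_bounded[of K]) (use K in \<open>auto simp: case_prod_unfold\<close>)
  have meas: "?k x \<in> borel_measurable (lebesgue_on {0..1})" if "x \<in> {0..1}" for x
    using borel_measurable_if_lebesgue_on[of "{0..x}" "{0..1}" "\<lambda>y. K x y * h y"]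
      borel_measurable_integrable[OF volterra_integrable[OF K h that]] that by auto
  have "continuous_on {0..1} (\<lambda>x. LINT y|lebesgue_on {0..1}. ?k x y)"
    unfolding continuous_on_sequentially comp_def
  proof (intro allI ballI impI, elim conjE)
    fix X a assume a: "a \<in> {0..1::real}" and X: "\<forall>n. X n \<in> {0..1}" "X \<longlonglongrightarrow> a"
    show "(\<lambda>n. LINT y|lebesgue_on {0..1}. ?k (X n) y) \<longlonglongrightarrow> (LINT y|lebesgue_on {0..1}. ?k a y)"
    proof (rule integral_dominated_convergence)
      show "integrable (lebesgue_on {0..1}) (\<lambda>y. C * \<bar>h y\<bar>)"
        using L2_integrable[OF h] by simp
      show "?k a \<in> borel_measurable (lebesgue_on {0..1})" "\<And>n. ?k (X n) \<in> borel_measurable (lebesgue_on {0..1})"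
        using meas a X by auto
      show "AE y in lebesgue_on {0..1}. norm (?k (X n) y) \<le> C * \<bar>h y\<bar>" for n
        using C X(1) by (intro AE_I2) (auto simp: abs_mult triangle_iff intro!: mult_right_mono)
      have "AE y in lebesgue_on {0..1}. y \<noteq> a"
        by (subst AE_restrict_space_iff) (auto intro: AE_mp[OF AE_completion[OF AE_lborel_singleton[of a]]])
      then show "AE y in lebesgue_on {0..1}. (\<lambda>n. ?k (X n) y) \<longlonglongrightarrow> ?k a y"
      proof (rule AE_mp, intro AE_I2 impI)
        fix y assume y: "y \<in> space (lebesgue_on {0..1})" "y \<noteq> a"
        show "(\<lambda>n. ?k (X n) y) \<longlonglongrightarrow> ?k a y"
        proof (cases "y < a")
          case True
          have ev: "\<forall>\<^sub>F n in sequentially. y < X n" using order_tendstoD(1)[OF X(2) True] .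
          have "(\<lambda>n. K (fst (X n, y)) (snd (X n, y))) \<longlonglongrightarrow> K (fst (a, y)) (snd (a, y))"
            by (rule continuous_on_tendsto_compose[OF K])
               (use X y True a ev in \<open>auto intro!: tendsto_intros simp: triangle_iff elim!: eventually_mono\<close>)
          then have "(\<lambda>n. K (X n) y * h y) \<longlonglongrightarrow> K a y * h y" by (auto intro: tendsto_intros)
          then have "(\<lambda>n. ?k (X n) y) \<longlonglongrightarrow> K a y * h y"
            by (rule Lim_transform_eventually) (use ev y in \<open>auto elim!: eventually_mono\<close>)
          then show ?thesis using True y by simp
        next
          case False
          then have "a < y" using y by simp
          then have "\<forall>\<^sub>F n in sequentially. X n < y" using order_tendstoD(2)[OF X(2)] by blast
          then have "\<forall>\<^sub>F n in sequentially. ?k (X n) y = 0" by (rule eventually_mono) auto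
          then have "(\<lambda>n. ?k (X n) y) \<longlonglongrightarrow> 0" by (rule tendsto_eventually)
          then show ?thesis using \<open>a < y\<close> by simp
        qed
      qed
    qed
  qed
  then show ?thesis by (rule continuous_on_eq) (use eq in auto)
qed

lemma volterra_L2:
  "continuous_on triangle (\<lambda>p. K (fst p) (snd p)) \<Longrightarrow> h \<in> L2 \<Longrightarrow> volterra K h \<in> L2"
  by (rule continuous_imp_L2[OF volterra_continuous])

lemma backstepping_transform_L2:
  "continuous_on triangle (\<lambda>p. K (fst p) (snd p)) \<Longrightarrow> h \<in> L2 \<Longrightarrow> backstepping_transform K h \<in> L2"
  using L2_diff[of h "volterra K h"] volterra_L2[of K h] unfolding backstepping_transform_eq by simp

lemma backstepping_transform_add:
  assumes "continuous_on triangle (\<lambda>p. K (fst p) (snd p))" "g \<in> L2" "h \<in> L2" "x \<in> {0..1}"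
  shows "backstepping_transform K (\<lambda>x. g x + h x) x
    = backstepping_transform K g x + backstepping_transform K h x"
  using volterra_integrable[OF assms(1,2,4)] volterra_integrable[OF assms(1,3,4)]
  by (simp add: backstepping_transform_def distrib_left)

lemma backstepping_transform_cmult:
  "backstepping_transform K (\<lambda>x. a * h x) x = a * backstepping_transform K h x"
  by (simp add: backstepping_transform_def right_diff_distrib mult.left_commute)

lemma backstepping_transform_diff:
  assumes "continuous_on triangle (\<lambda>p. K (fst p) (snd p))" "g \<in> L2" "h \<in> L2" "x \<in> {0..1}"
  shows "backstepping_transform K (\<lambda>x. g x - h x) x
    = backstepping_transform K g x - backstepping_transform K h x"
  using backstepping_transform_add[OF assms(1,2) L2_cmult[OF assms(3), of "-1"] assms(4)]
    backstepping_transform_cmult[of K "-1" h] by simp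

lemma backstepping_transform_cong_AE:
  assumes "continuous_on triangle (\<lambda>p. K (fst p) (snd p))" "g \<in> L2" "h \<in> L2" "L2_eq g h"
  shows "L2_eq (backstepping_transform K g) (backstepping_transform K h)"
proof -
  have "volterra K g x = volterra K h x" if x: "x \<in> {0..1}" for x
    unfolding volterra_def
  proof (rule integral_cong_AE)
    have "AE y in lebesgue_on {0..x}. g y = h y"
      using assms(4) x unfolding L2_eq_def by (subst (asm) AE_restrict_space_iff, simp, subst AE_restrict_space_iff) auto
    then show "AE y in lebesgue_on {0..x}. K x y * g y = K x y * h y" by auto
  qed (use volterra_integrable[OF assms(1)] assms(2,3) x in auto)
  then have "AE x in lebesgue_on {0..1}. volterra K g x = volterra K h x" by (intro AE_I2) simp
  with assms(4) show ?thesis unfolding L2_eq_def backstepping_transform_eq by auto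
qed

section \<open>Norm estimates for the transformation and its inverse\<close>

lemma integral_abs_le_L2_norm:
  assumes h: "h \<in> L2" and x: "x \<in> {0..1}"
  shows "(LINT y|lebesgue_on {0..x}. \<bar>h y\<bar>) \<le> sqrt x * L2_norm h"
proof -
  let ?i = "\<lambda>y. if y \<in> {0..x} then 1 else 0 :: real"
  have i: "?i \<in> borel_measurable (lebesgue_on {0..1})"
    using borel_measurable_if_lebesgue_on[of "{0..x}" "{0..1}" "\<lambda>y. 1::real"] x by auto
  have ii: "L2_inner ?i ?i = x"
  proof -
    have "L2_inner ?i ?i = (LINT y|lebesgue_on {0..1}. ?i y)"
      unfolding L2_inner_def by (intro Bochner_Integration.integral_cong) auto
    also have "\<dots> = (LINT y|lebesgue_on {0..x}. 1)"
      by (rule integral_restrict) (use x in auto)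
    also have "\<dots> = x" using x by (simp add: measure_restrict_space)
    finally show ?thesis .
  qed
  have "(\<lambda>_. 1) \<in> L2" by (rule continuous_imp_L2) auto
  then have iL: "?i \<in> L2"
    by (rule L2_norm_mono(1)[OF i]) auto
  have aL: "(\<lambda>y. \<bar>h y\<bar>) \<in> L2" using h by (auto simp: L2_def)
  have "(LINT y|lebesgue_on {0..x}. \<bar>h y\<bar>) = (LINT y|lebesgue_on {0..1}. (if y \<in> {0..x} then \<bar>h y\<bar> else 0))"
    by (rule integral_restrict[symmetric]) (use x in auto)
  also have "\<dots> = L2_inner ?i (\<lambda>y. \<bar>h y\<bar>)"
    unfolding L2_inner_def by (intro Bochner_Integration.integral_cong) auto
  also have "\<dots> \<le> L2_norm ?i * L2_norm (\<lambda>y. \<bar>h y\<bar>)" by (rule L2_inner_le[OF iL aL])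
  also have "L2_norm ?i = sqrt x" unfolding L2_norm_def ii ..
  also have "L2_norm (\<lambda>y. \<bar>h y\<bar>) = L2_norm h" by (simp add: L2_norm_def L2_inner_def)
  finally show ?thesis .
qed

text \<open>Keeping both the factor x of the kernel bound and the factor sqrt x of Cauchy-Schwarz
  makes the square a multiple of x^3, with integral 1/4. The resulting factor 1/2 turns the a/2 of
  the majorant into the a/4 of the gains.\<close>

lemma L2_norm_cubic_bound:
  assumes g: "continuous_on {0..1} g" and B: "0 \<le> B" and N: "0 \<le> N"
    and le: "\<And>x. x \<in> {0..1} \<Longrightarrow> \<bar>g x\<bar> \<le> B * x * (sqrt x * N)"
  shows "L2_norm g \<le> B / 2 * N"
proof -
  let ?q = "\<lambda>x. B * x * (sqrt x * N)"
  have qL: "?q \<in> L2" by (intro continuous_imp_L2 continuous_intros)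
  have "L2_norm g \<le> L2_norm ?q"
    by (rule L2_norm_mono(2)[OF L2_measurable[OF continuous_imp_L2[OF g]] qL])
       (use le in \<open>fastforce intro: order_trans[OF _ abs_ge_self]\<close>)
  also have "L2_inner ?q ?q = (LINT x|lebesgue_on {0..1}. (B * N)\<^sup>2 * x ^ 3)"
    unfolding L2_inner_def
    by (intro Bochner_Integration.integral_cong) (auto simp: power2_eq_square power3_eq_cube algebra_simps)
  then have "L2_norm ?q = sqrt ((B * N)\<^sup>2 * (LINT x|lebesgue_on {0..1}. x ^ 3))"
    by (simp add: L2_norm_def)
  also have "(LINT x|lebesgue_on {0..1}. x ^ 3) = (1/4::real)"
  proof -
    have "integrable (lebesgue_on {0..1}) (\<lambda>x::real. x ^ 3)"
      by (intro continuous_imp_integrable_real continuous_intros)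
    then have "(LINT x|lebesgue_on {0..1}. x ^ 3) = integral {0..1} (\<lambda>x::real. x ^ 3)"
      by (intro lebesgue_integral_eq_integral) auto
    also have "\<dots> = 1 ^ 4 / 4 - 0 ^ 4 / 4"
      by (rule integral_unique, rule fundamental_theorem_of_calculus)
         (auto intro!: derivative_eq_intros simp flip: has_real_derivative_iff_has_vector_derivative)
    finally show ?thesis by simp
  qed
  also have "sqrt ((B * N)\<^sup>2 * (1/4)) = B / 2 * N"
    using B N by (simp add: real_sqrt_mult real_sqrt_divide)
  finally show ?thesis .
qed

lemma volterra_norm:
  assumes K: "continuous_on triangle (\<lambda>p. K (fst p) (snd p))" and h: "h \<in> L2" and B: "0 \<le> B"
    and le: "\<And>x y. (x, y) \<in> triangle \<Longrightarrow> \<bar>K x y\<bar> \<le> B * x"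
  shows "L2_norm (volterra K h) \<le> B / 2 * L2_norm h"
proof (rule L2_norm_cubic_bound[OF volterra_continuous[OF K h] B])
  fix x :: real assume x: "x \<in> {0..1}"
  have "\<bar>volterra K h x\<bar> \<le> (LINT y|lebesgue_on {0..x}. \<bar>K x y * h y\<bar>)"
    unfolding volterra_def by (rule integral_abs_bound)
  also have "\<dots> \<le> (LINT y|lebesgue_on {0..x}. B * x * \<bar>h y\<bar>)"
  proof (rule integral_mono)
    show "integrable (lebesgue_on {0..x}) (\<lambda>y. \<bar>K x y * h y\<bar>)"
      using volterra_integrable[OF K h x] by simp
    show "integrable (lebesgue_on {0..x}) (\<lambda>y. B * x * \<bar>h y\<bar>)"
      using L2_integrable_on[OF h x] by simp
    show "\<bar>K x y * h y\<bar> \<le> B * x * \<bar>h y\<bar>" if "y \<in> space (lebesgue_on {0..x})" for y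
      unfolding abs_mult using le[of x y] that x by (intro mult_right_mono) (auto simp: triangle_iff)
  qed
  also have "\<dots> = B * x * (LINT y|lebesgue_on {0..x}. \<bar>h y\<bar>)" by simp
  also have "\<dots> \<le> B * x * (sqrt x * L2_norm h)"
    using integral_abs_le_L2_norm[OF h x] B x by (intro mult_left_mono) auto
  finally show "\<bar>volterra K h x\<bar> \<le> B * x * (sqrt x * L2_norm h)" .
qed simp

text \<open>Only the exponential is replaced by its maximum over the triangle, attained at (1,0);
  the factor x is kept for \<open>volterra_norm\<close>.\<close>

lemma backstepping_transform_norm:
  assumes K: "continuous_on triangle (\<lambda>p. K (fst p) (snd p))" and h: "h \<in> L2"
    and a: "0 \<le> a" and k: "0 \<le> k"
    and le: "\<And>x y. (x, y) \<in> triangle \<Longrightarrow> \<bar>K x y\<bar> \<le> kernel_majorant a k x y"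
  shows "L2_norm (backstepping_transform K h) \<le> (1 + a / 4 * exp (a / 8 + k)) * L2_norm h"
proof -
  have "L2_norm (volterra K h) \<le> (a / 2 * exp (a / 8 + k)) / 2 * L2_norm h"
  proof (rule volterra_norm[OF K h])
    fix x y assume xy: "(x, y) \<in> triangle"
    have "kernel_exponent a k x - kernel_exponent a k y \<le> a / 8 + k"
    proof -
      have "kernel_exponent a k x \<le> kernel_exponent a k 1" "kernel_exponent a k 0 \<le> kernel_exponent a k y"
        using xy a k by (auto simp: triangle_iff intro!: kernel_exponent_mono)
      moreover have "kernel_exponent a k 1 = a / 8 + k" "kernel_exponent a k 0 = 0"
        by (simp_all add: kernel_exponent_def)
      ultimately show ?thesis by linarith
    qed
    then have "kernel_majorant a k x y \<le> a / 2 * x * exp (a / 8 + k)"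
      unfolding kernel_majorant_def using a xy by (intro mult_left_mono) (auto simp: triangle_iff)
    with le[OF xy] show "\<bar>K x y\<bar> \<le> a / 2 * exp (a / 8 + k) * x" by (simp add: mult_ac)
  qed (use a in simp)
  moreover have "L2_norm (backstepping_transform K h) \<le> L2_norm h + L2_norm (\<lambda>x. -1 * volterra K h x)"
    unfolding backstepping_transform_eq
    using L2_norm_triangle[OF h L2_cmult[OF volterra_L2[OF K h], of "-1"]] by simp
  ultimately show ?thesis unfolding L2_norm_cmult by (simp add: algebra_simps)
qed

lemma has_real_derivative_LINT:
  fixes f :: "real \<Rightarrow> real"
  assumes "continuous_on {0..1} f" "x \<in> {0..1}"
  shows "((\<lambda>x. LINT y|lebesgue_on {0..x}. f y) has_real_derivative f x) (at x within {0..1})"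
proof -
  have eq: "(LINT y|lebesgue_on {0..x}. f y) = integral {0..x} f" if "x \<in> {0..1}" for x
    using that by (intro lebesgue_integral_eq_integral continuous_imp_integrable_real continuous_on_subset[OF assms(1)]) auto
  have "((\<lambda>x. integral {0..x} f) has_real_derivative f x) (at x within {0..1})"
    by (rule integral_has_real_derivative[OF assms])
  then show ?thesis
    by (rule has_field_derivative_transform_within[of _ _ _ _ 1]) (use eq assms in auto)
qed

text \<open>The majorant is separable, so the resolvent of the Volterra inequality below is explicit: with
  \<open>m x = \<integral>\<^sub>0\<^sup>x \<bar>u\<bar> exp(-kernel_exponent)\<close> it reads \<open>m' \<le> \<bar>w\<bar> + (a/2) x m\<close>.\<close>

lemma backstepping_transform_inverse_norm:
  assumes K: "continuous_on triangle (\<lambda>p. K (fst p) (snd p))" and u: "continuous_on {0..1} u"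
    and a: "0 \<le> a" and k: "0 \<le> k"
    and le: "\<And>x y. (x, y) \<in> triangle \<Longrightarrow> \<bar>K x y\<bar> \<le> kernel_majorant a k x y"
  shows "L2_norm u \<le> (1 + a / 4 * exp (3 * a / 8 + k)) * L2_norm (backstepping_transform K u)"
proof -
  define w where "w = backstepping_transform K u"
  have uL: "u \<in> L2" by (rule continuous_imp_L2[OF u])
  have cV: "continuous_on {0..1} (volterra K u)" by (rule volterra_continuous[OF K uL])
  have cw: "continuous_on {0..1} w"
    unfolding w_def backstepping_transform_eq by (intro continuous_intros u cV)
  have wL: "w \<in> L2" by (rule continuous_imp_L2[OF cw])
  define g where "g = kernel_exponent a k"
  have cg: "continuous_on S g" for S unfolding g_def kernel_exponent_def by (intro continuous_intros) auto
  define m where "m = (\<lambda>x. LINT y|lebesgue_on {0..x}. \<bar>u y\<bar> * exp (- g y))"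
  define n where "n = (\<lambda>x. LINT y|lebesgue_on {0..x}. \<bar>w y\<bar>)"
  have cm: "continuous_on {0..1} (\<lambda>y. \<bar>u y\<bar> * exp (- g y))"
    by (intro continuous_intros u cg)
  have m': "(m has_real_derivative \<bar>u x\<bar> * exp (- g x)) (at x within {0..1})" if "x \<in> {0..1}" for x
    unfolding m_def by (rule has_real_derivative_LINT[OF cm that])
  have n': "(n has_real_derivative \<bar>w x\<bar>) (at x within {0..1})" if "x \<in> {0..1}" for x
    unfolding n_def by (rule has_real_derivative_LINT[OF _ that]) (intro continuous_intros cw)
  have V: "\<bar>volterra K u x\<bar> \<le> a / 2 * x * exp (g x) * m x" if x: "x \<in> {0..1}" for x
  proof -
    have "\<bar>volterra K u x\<bar> \<le> (LINT y|lebesgue_on {0..x}. \<bar>K x y * u y\<bar>)"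
      unfolding volterra_def by (rule integral_abs_bound)
    also have "\<dots> \<le> (LINT y|lebesgue_on {0..x}. a / 2 * x * exp (g x) * (\<bar>u y\<bar> * exp (- g y)))"
    proof (rule integral_mono)
      show "integrable (lebesgue_on {0..x}) (\<lambda>y. \<bar>K x y * u y\<bar>)"
        using volterra_integrable[OF K uL x] by simp
      have "integrable (lebesgue_on {0..x}) (\<lambda>y. \<bar>u y\<bar> * exp (- g y))"
        using x by (intro continuous_imp_integrable_real continuous_on_subset[OF cm]) auto
      then show "integrable (lebesgue_on {0..x}) (\<lambda>y. a / 2 * x * exp (g x) * (\<bar>u y\<bar> * exp (- g y)))"
        by simp
      show "\<bar>K x y * u y\<bar> \<le> a / 2 * x * exp (g x) * (\<bar>u y\<bar> * exp (- g y))"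
        if "y \<in> space (lebesgue_on {0..x})" for y
      proof -
        have "\<bar>K x y\<bar> \<le> a / 2 * x * (exp (g x) * exp (- g y))"
          using le[of x y] that x by (simp add: kernel_majorant_def triangle_iff g_def exp_diff exp_minus field_simps)
        from mult_right_mono[OF this, of "\<bar>u y\<bar>"] show ?thesis by (simp add: abs_mult mult_ac)
      qed
    qed
    also have "\<dots> = a / 2 * x * exp (g x) * m x" by (simp add: m_def)
    finally show ?thesis .
  qed
  \<comment> \<open>An antiderivative of the coefficient a x / 2 of \<open>m\<close>: exp (-P) is
    the integrating factor.\<close>
  define P where "P = (\<lambda>x::real. a * x\<^sup>2 / 4)"
  have mn: "m x * exp (- P x) \<le> n x" if x: "x \<in> {0..1}" for x
  proof -
    have "n 0 - m 0 * exp (- P 0) \<le> n x - m x * exp (- P x)"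
    proof (rule deriv_within_nonneg_mono[where f = "\<lambda>x. n x - m x * exp (- P x)"])
      fix s assume "s \<in> {0..x}"
      then have s: "s \<in> {0..1}" "{0..x} \<subseteq> {0..1}" using x by auto
      note d = DERIV_subset[OF m'[OF s(1)] s(2)] DERIV_subset[OF n'[OF s(1)] s(2)]
      show "((\<lambda>x. n x - m x * exp (- P x)) has_real_derivative
          \<bar>w s\<bar> - (\<bar>u s\<bar> * exp (- g s) - m s * (a * s / 2)) * exp (- P s)) (at s within {0..x})"
      proof -
        have "((\<lambda>x. exp (- P x)) has_real_derivative exp (- P s) * (- (a * s / 2))) (at s within {0..x})"
          unfolding P_def by (auto intro!: derivative_eq_intros)
        from DERIV_diff[OF d(2) DERIV_mult[OF d(1) this]] show ?thesis
          by (rule DERIV_cong) (simp add: algebra_simps)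
      qed
    next
      fix s assume "0 < s" "s < x"
      then have s: "s \<in> {0..1}" using x by auto
      have "u s = w s + volterra K u s" by (simp add: w_def backstepping_transform_eq)
      then have "\<bar>u s\<bar> \<le> \<bar>w s\<bar> + a / 2 * s * exp (g s) * m s" using V[OF s] by linarith
      from mult_right_mono[OF this exp_ge_zero[of "- g s"]]
      have "\<bar>u s\<bar> * exp (- g s) \<le> (\<bar>w s\<bar> + a / 2 * s * exp (g s) * m s) * exp (- g s)" .
      moreover have "(\<bar>w s\<bar> + a / 2 * s * exp (g s) * m s) * exp (- g s) = \<bar>w s\<bar> * exp (- g s) + m s * (a * s / 2)"
        by (simp add: distrib_right exp_minus field_simps)
      ultimately have "\<bar>u s\<bar> * exp (- g s) - m s * (a * s / 2) \<le> \<bar>w s\<bar> * exp (- g s)"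
        by linarith
      also have "\<dots> \<le> \<bar>w s\<bar> * 1"
      proof -
        have "0 \<le> g s" using a k s by (simp add: g_def kernel_exponent_def)
        then show ?thesis by (intro mult_left_mono) auto
      qed
      finally have 1: "\<bar>u s\<bar> * exp (- g s) - m s * (a * s / 2) \<le> \<bar>w s\<bar>" by simp
      have "(\<bar>u s\<bar> * exp (- g s) - m s * (a * s / 2)) * exp (- P s) \<le> \<bar>w s\<bar> * exp (- P s)"
        using 1 by (intro mult_right_mono) auto
      also have "\<dots> \<le> \<bar>w s\<bar> * 1" using a by (intro mult_left_mono) (auto simp: P_def)
      finally show "0 \<le> \<bar>w s\<bar> - (\<bar>u s\<bar> * exp (- g s) - m s * (a * s / 2)) * exp (- P s)" by simp
    qed (use x in simp)
    moreover have "n 0 = 0" "m 0 = 0" by (simp_all add: n_def m_def integral_eq_zero_null_sets)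
    ultimately show ?thesis by simp
  qed
  \<comment> \<open>The exponent collects a/8 + k from \<open>g\<close> and a/4 from the integrating
    factor.\<close>
  have "L2_norm (volterra K u) \<le> (a / 2 * exp (3 * a / 8 + k)) / 2 * L2_norm w"
  proof (rule L2_norm_cubic_bound[OF cV])
    fix x :: real assume x: "x \<in> {0..1}"
    have "m x = m x * exp (- P x) * exp (P x)" by (simp add: exp_minus)
    also have "\<dots> \<le> n x * exp (P x)" using mn[OF x] by (intro mult_right_mono) auto
    finally have "a / 2 * x * exp (g x) * m x \<le> a / 2 * x * exp (g x) * (n x * exp (P x))"
      using a x by (intro mult_left_mono) auto
    also have "\<dots> = a / 2 * x * exp (g x + P x) * n x" by (simp add: exp_add)
    also have "\<dots> \<le> a / 2 * x * exp (3 * a / 8 + k) * (sqrt x * L2_norm w)"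
    proof (intro mult_mono mult_left_mono)
      have "x\<^sup>2 \<le> 1" using x by (simp add: power_le_one)
      from mult_left_mono[OF this a] have "a * x\<^sup>2 \<le> a" by simp
      moreover have "k * x \<le> k * 1" using k x by (intro mult_left_mono) auto
      ultimately show "exp (g x + P x) \<le> exp (3 * a / 8 + k)"
        by (simp add: g_def P_def kernel_exponent_def)
      show "n x \<le> sqrt x * L2_norm w" unfolding n_def by (rule integral_abs_le_L2_norm[OF wL x])
      show "0 \<le> n x" unfolding n_def by (intro integral_nonneg_AE) auto
    qed (use a x in auto)
    finally show "\<bar>volterra K u x\<bar> \<le> a / 2 * exp (3 * a / 8 + k) * x * (sqrt x * L2_norm w)"
      using V[OF x] by (simp add: mult_ac)
  qed (use a in auto)
  moreover have "L2_norm u \<le> L2_norm w + L2_norm (volterra K u)"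
    using L2_norm_triangle[OF wL volterra_L2[OF K uL]] by (simp add: w_def backstepping_transform_eq)
  ultimately show ?thesis by (simp add: w_def algebra_simps)
qed

subsection \<open>Integration by parts and the Leibniz rule\<close>

text \<open>Fubini on the triangle. Joint measurability is the delicate point, as \<open>h\<close>
  is merely Lebesgue measurable: the kernel extended by zero is Borel on the plane and is pulled
  back to the product of the two Lebesgue spaces, while \<open>h\<close> depends on one
  coordinate.\<close>

lemma LINT_triangle_swap:
  fixes k :: "real \<Rightarrow> real \<Rightarrow> real" and h :: "real \<Rightarrow> real"
  assumes k: "continuous_on triangle (\<lambda>p. k (fst p) (snd p))"
    and h: "integrable (lebesgue_on {0..1}) h" and x: "x \<in> {0..1}"
  shows "(LINT y|lebesgue_on {0..x}. (LINT s|lebesgue_on {y..x}. k s y) * h y)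
    = (LINT s|lebesgue_on {0..x}. LINT y|lebesgue_on {0..s}. k s y * h y)"
proof -
  let ?M = "lebesgue_on {0..x}"
  interpret finite_measure ?M
    by (rule finite_measure_lebesgue_on) auto
  interpret P: pair_sigma_finite ?M ?M ..
  obtain C where C: "C > 0" "\<And>s y. (s, y) \<in> triangle \<Longrightarrow> \<bar>k s y\<bar> \<le> C"
    by (rule triangle_bounded[of k]) (use k in \<open>auto simp: case_prod_unfold\<close>)
  have hx: "integrable ?M h" by (rule integrable_subinterval[OF h]) (use x in auto)
  define f where "f = (\<lambda>s y. (if (s, y) \<in> triangle then k s y else 0) * h y)"
  have id: "(\<lambda>x. x) \<in> borel_measurable ?M" using id_borel_measurable_lebesgue_on[of "{0..x}"] by (simp add: id_def)
  have k': "(\<lambda>p. if p \<in> triangle then k (fst p) (snd p) else 0) \<in> borel_measurable borel"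
  proof -
    have "(\<lambda>p. indicator triangle p *\<^sub>R k (fst p) (snd p)) \<in> borel_measurable borel"
      by (rule borel_measurable_continuous_on_indicator[OF _ k])
         (intro borel_closed compact_imp_closed compact_triangle)
    moreover have "(\<lambda>p. indicator triangle p *\<^sub>R k (fst p) (snd p)) = (\<lambda>p. if p \<in> triangle then k (fst p) (snd p) else 0)"
      by auto
    ultimately show ?thesis by simp
  qed
  have "(\<lambda>p. (fst p, snd p)) \<in> (?M \<Otimes>\<^sub>M ?M) \<rightarrow>\<^sub>M (borel \<Otimes>\<^sub>M borel)"
    by (intro measurable_Pair measurable_compose[OF measurable_fst id] measurable_compose[OF measurable_snd id])
  from measurable_compose[OF this[unfolded borel_prod] k']
  have "(\<lambda>p. if p \<in> triangle then k (fst p) (snd p) else 0) \<in> borel_measurable (?M \<Otimes>\<^sub>M ?M)"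
    by (simp only: fst_conv snd_conv prod.collapse)
  from borel_measurable_times[OF this measurable_compose[OF measurable_snd borel_measurable_integrable[OF hx]]]
  have "(\<lambda>p. (if p \<in> triangle then k (fst p) (snd p) else 0) * h (snd p)) \<in> borel_measurable (?M \<Otimes>\<^sub>M ?M)" .
  moreover have "(\<lambda>p. (if p \<in> triangle then k (fst p) (snd p) else 0) * h (snd p)) = (\<lambda>(s, y). f s y)"
    by (rule ext) (simp add: f_def split_beta)
  ultimately have mf: "(\<lambda>(s, y). f s y) \<in> borel_measurable (?M \<Otimes>\<^sub>M ?M)"
    by (simp only:)
  have "integrable (?M \<Otimes>\<^sub>M ?M) (\<lambda>(s, y). C * \<bar>h y\<bar>)"
    by (rule P.Fubini_integrable) (use hx in auto)
  then have intf: "integrable (?M \<Otimes>\<^sub>M ?M) (\<lambda>(s, y). f s y)"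
  proof (rule Bochner_Integration.integrable_bound[OF _ mf])
    show "AE p in ?M \<Otimes>\<^sub>M ?M. norm (case p of (s, y) \<Rightarrow> f s y) \<le> norm (case p of (s, y) \<Rightarrow> C * \<bar>h y\<bar>)"
      using C by (intro AE_I2) (auto simp: f_def abs_mult intro!: mult_right_mono)
  qed
  have swap: "(LINT y|?M. (LINT s|?M. f s y)) = (LINT s|?M. (LINT y|?M. f s y))"
    by (rule P.Fubini_integral[OF intf])
  have 1: "(LINT s|?M. f s y) = (LINT s|lebesgue_on {y..x}. k s y) * h y" if y: "y \<in> {0..x}" for y
  proof -
    have "(LINT s|?M. f s y) = (LINT s|?M. (if s \<in> {y..x} then k s y * h y else 0))"
      by (rule Bochner_Integration.integral_cong) (use x y in \<open>auto simp: f_def triangle_iff\<close>)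
    also have "\<dots> = (LINT s|lebesgue_on {y..x}. k s y * h y)"
      by (rule integral_restrict) (use y in auto)
    finally show ?thesis by simp
  qed
  have 2: "(LINT y|?M. f s y) = (LINT y|lebesgue_on {0..s}. k s y * h y)" if s: "s \<in> {0..x}" for s
  proof -
    have "(LINT y|?M. f s y) = (LINT y|?M. (if y \<in> {0..s} then k s y * h y else 0))"
      by (rule Bochner_Integration.integral_cong) (use x s in \<open>auto simp: f_def triangle_iff\<close>)
    also have "\<dots> = (LINT y|lebesgue_on {0..s}. k s y * h y)"
      by (rule integral_restrict) (use s in auto)
    finally show ?thesis .
  qed
  have "(LINT y|?M. (LINT s|?M. f s y)) = (LINT y|?M. (LINT s|lebesgue_on {y..x}. k s y) * h y)"
    by (rule Bochner_Integration.integral_cong[OF refl], rule 1) simp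
  moreover have "(LINT s|?M. (LINT y|?M. f s y)) = (LINT s|?M. (LINT y|lebesgue_on {0..s}. k s y * h y))"
    by (rule Bochner_Integration.integral_cong[OF refl], rule 2) simp
  ultimately show ?thesis using swap by simp
qed

lemma LINT_derivative:
  fixes f f' :: "real \<Rightarrow> real"
  assumes f: "\<And>x. x \<in> {a..b} \<Longrightarrow> (f has_real_derivative f' x) (at x within {a..b})"
    and c: "continuous_on {a..b} f'" and le: "a \<le> b"
  shows "(LINT x|lebesgue_on {a..b}. f' x) = f b - f a"
proof -
  have "(LINT x|lebesgue_on {a..b}. f' x) = integral {a..b} f'"
    using continuous_imp_integrable_real[OF c] by (intro lebesgue_integral_eq_integral) auto
  also have "\<dots> = f b - f a"
    by (rule integral_unique, rule fundamental_theorem_of_calculus[OF le])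
       (use f in \<open>simp flip: has_real_derivative_iff_has_vector_derivative\<close>)
  finally show ?thesis .
qed

lemma LINT_by_parts:
  fixes g g' h H :: "real \<Rightarrow> real"
  assumes g: "\<And>y. y \<in> {0..x} \<Longrightarrow> (g has_real_derivative g' y) (at y within {0..x})"
    and g': "continuous_on {0..x} g'"
    and h: "integrable (lebesgue_on {0..1}) h"
    and H: "\<And>y. y \<in> {0..1} \<Longrightarrow> H y = H 0 + (LINT s|lebesgue_on {0..y}. h s)"
    and x: "x \<in> {0..1}"
  shows "(LINT y|lebesgue_on {0..x}. g y * h y) = g x * H x - g 0 * H 0 - (LINT y|lebesgue_on {0..x}. g' y * H y)"
proof -
  have sub: "(g has_real_derivative g' y) (at y within {r..s})" if "y \<in> {r..s}" "0 \<le> r" "s \<le> x" for y r s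
    using that by (intro DERIV_subset[OF g]) auto
  have cg: "continuous_on {0..x} g" by (rule DERIV_continuous_on) (use sub x in auto)
  have cg': "continuous_on {r..s} g'" if "0 \<le> r" "s \<le> x" for r s
    using that by (intro continuous_on_subset[OF g']) auto
  have hx: "integrable (lebesgue_on {0..x}) h" by (rule integrable_subinterval[OF h]) (use x in auto)
  have cH: "continuous_on {0..x} H"
  proof -
    have "continuous_on {0..x} (\<lambda>y. H 0 + (LINT s|lebesgue_on {0..y}. h s))"
      by (intro continuous_intros indefinite_integral_continuous_real hx)
    then show ?thesis by (rule continuous_on_eq) (rule H[symmetric], use x in auto)
  qed
  have igh: "integrable (lebesgue_on {0..x}) (\<lambda>y. g y * h y)"
    by (rule integrable_lebesgue_on_mult[OF cg hx])
  have igH: "integrable (lebesgue_on {0..x}) (\<lambda>y. g' y * H y)"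
    using x by (intro continuous_imp_integrable_real continuous_intros cg' cH) auto
  have ig': "integrable (lebesgue_on {0..x}) g'"
    using x by (intro continuous_imp_integrable_real cg') auto
  \<comment> \<open>The exchange of integrals asks for a kernel on the whole triangle, but
    \<open>g'\<close> is continuous only on [0, x]; the cut-off \<open>min\<close> extends it
    without changing values that enter the integrals.\<close>
  have k: "continuous_on triangle (\<lambda>p. g' (min (fst p) x))"
    by (rule continuous_on_compose2[OF g']) (use x in \<open>auto intro!: continuous_intros simp: triangle_def\<close>)
  have "(LINT y|lebesgue_on {0..x}. (LINT s|lebesgue_on {y..x}. g' (min s x)) * h y)
      = (LINT y|lebesgue_on {0..x}. g x * h y - g y * h y)"
  proof (rule Bochner_Integration.integral_cong)
    fix y assume "y \<in> space (lebesgue_on {0..x})"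
    then have y: "0 \<le> y" "y \<le> x" by auto
    have "(LINT s|lebesgue_on {y..x}. g' (min s x)) = (LINT s|lebesgue_on {y..x}. g' s)"
      by (rule Bochner_Integration.integral_cong) (auto simp: min_absorb1)
    also have "\<dots> = g x - g y"
      by (rule LINT_derivative) (use y x sub cg' in auto)
    finally show "(LINT s|lebesgue_on {y..x}. g' (min s x)) * h y = g x * h y - g y * h y"
      by (simp add: left_diff_distrib)
  qed simp
  also have "\<dots> = g x * (H x - H 0) - (LINT y|lebesgue_on {0..x}. g y * h y)"
    using hx igh H[OF x] by simp
  finally have 1: "(LINT y|lebesgue_on {0..x}. (LINT s|lebesgue_on {y..x}. g' (min s x)) * h y)
      = g x * (H x - H 0) - (LINT y|lebesgue_on {0..x}. g y * h y)" .
  have "(LINT s|lebesgue_on {0..x}. LINT y|lebesgue_on {0..s}. g' (min s x) * h y)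
      = (LINT s|lebesgue_on {0..x}. g' s * H s - g' s * H 0)"
  proof (rule Bochner_Integration.integral_cong)
    fix s assume "s \<in> space (lebesgue_on {0..x})"
    then have "(LINT y|lebesgue_on {0..s}. h y) = H s - H 0" using H[of s] x by simp
    moreover have "min s x = s" using \<open>s \<in> space _\<close> by simp
    ultimately show "(LINT y|lebesgue_on {0..s}. g' (min s x) * h y) = g' s * H s - g' s * H 0"
      by (simp add: right_diff_distrib)
  qed simp
  also have "\<dots> = (LINT s|lebesgue_on {0..x}. g' s * H s) - (g x - g 0) * H 0"
  proof -
    have "(LINT s|lebesgue_on {0..x}. g' s) = g x - g 0"
      by (rule LINT_derivative) (use x sub cg' in auto)
    then show ?thesis using igH ig' by simp
  qed
  finally show ?thesis
    using LINT_triangle_swap[OF k h x] 1 by (simp add: algebra_simps)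
qed

text \<open>The Leibniz rule without differentiation under the integral: F x y is F y y plus the
  integral of \<open>Fx\<close> over [y, x], and exchanging the integrals exhibits the Volterra
  integral as an antiderivative of a continuous function.\<close>

lemma volterra_has_derivative:
  assumes F: "has_partials F Fx Fy" and u: "continuous_on {0..1} u" and x: "x \<in> {0..1}"
  shows "(volterra F u has_real_derivative F x x * u x + volterra Fx u x) (at x within {0..1})"
proof -
  note cF = has_partials_continuous[OF F] and cFx = has_partialsD(2)[OF F]
  have uL: "u \<in> L2" by (rule continuous_imp_L2[OF u])
  have cd: "continuous_on {0..1} (\<lambda>s. F s s * u s)"
    by (intro continuous_intros u continuous_on_compose2[OF cF, of _ "\<lambda>s. (s, s)", simplified])
       (auto simp: triangle_iff)
  have cV: "continuous_on {0..1} (volterra Fx u)" by (rule volterra_continuous[OF cFx uL])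
  have eq: "volterra F u x = (LINT s|lebesgue_on {0..x}. F s s * u s + volterra Fx u s)" if x: "x \<in> {0..1}" for x
  proof -
    have i1: "integrable (lebesgue_on {0..x}) (\<lambda>s. F s s * u s)"
      and i2: "integrable (lebesgue_on {0..x}) (volterra Fx u)"
      using x by (auto intro!: continuous_imp_integrable_real continuous_on_subset[OF cd] continuous_on_subset[OF cV])
    have "(LINT y|lebesgue_on {0..x}. (LINT s|lebesgue_on {y..x}. Fx s y) * u y)
        = (LINT y|lebesgue_on {0..x}. F x y * u y - F y y * u y)"
    proof (rule Bochner_Integration.integral_cong)
      fix y assume "y \<in> space (lebesgue_on {0..x})"
      then have y: "0 \<le> y" "y \<le> x" by auto
      have "(LINT s|lebesgue_on {y..x}. Fx s y) = F x y - F y y"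
      proof (rule LINT_derivative)
        fix s assume s: "s \<in> {y..x}"
        have "((\<lambda>s. F s y) has_real_derivative Fx s y * 1 + Fy s y * 0) (at s within {y..x})"
          using x y s by (intro has_partials_chain[OF F]) (auto intro!: derivative_eq_intros simp: triangle_iff)
        then show "((\<lambda>s. F s y) has_real_derivative Fx s y) (at s within {y..x})" by simp
      next
        show "continuous_on {y..x} (\<lambda>s. Fx s y)"
          by (rule continuous_on_compose2[OF cFx, of _ "\<lambda>s. (s, y)", simplified])
             (use x y in \<open>auto intro!: continuous_intros simp: triangle_iff\<close>)
      qed (use y in simp)
      then show "(LINT s|lebesgue_on {y..x}. Fx s y) * u y = F x y * u y - F y y * u y"
        by (simp add: left_diff_distrib)
    qed simp
    also have "\<dots> = volterra F u x - (LINT s|lebesgue_on {0..x}. F s s * u s)"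
      using volterra_integrable[OF cF uL x] i1 by (simp add: volterra_def)
    finally have "volterra F u x = (LINT s|lebesgue_on {0..x}. F s s * u s)
        + (LINT y|lebesgue_on {0..x}. (LINT s|lebesgue_on {y..x}. Fx s y) * u y)" by simp
    also have "\<dots> = (LINT s|lebesgue_on {0..x}. F s s * u s) + (LINT s|lebesgue_on {0..x}. volterra Fx u s)"
      unfolding LINT_triangle_swap[OF cFx L2_integrable[OF uL] x] by (simp add: volterra_def)
    finally show ?thesis using i1 i2 by simp
  qed
  have "((\<lambda>x. LINT s|lebesgue_on {0..x}. F s s * u s + volterra Fx u s)
      has_real_derivative F x x * u x + volterra Fx u x) (at x within {0..1})"
    by (rule has_real_derivative_LINT[OF _ x]) (intro continuous_intros cd cV)
  then show ?thesis
    by (rule has_field_derivative_transform_within[OF _ zero_less_one x]) (rule eq[symmetric])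
qed

subsection \<open>The transformation of the spatial operator\<close>

lemma H2_derivsD:
  assumes "H2_derivs u u1 u2"
  shows "x \<in> {0..1} \<Longrightarrow> (u has_real_derivative u1 x) (at x within {0..1})"
    and "u2 \<in> L2"
    and "x \<in> {0..1} \<Longrightarrow> u1 x = u1 0 + (LINT y|lebesgue_on {0..x}. u2 y)"
  using assms unfolding H2_derivs_def by blast+

lemma H2_derivs_continuous:
  assumes "H2_derivs u u1 u2"
  shows "continuous_on {0..1} u" "continuous_on {0..1} u1"
proof -
  show "continuous_on {0..1} u" by (rule DERIV_continuous_on[OF H2_derivsD(1)[OF assms]])
  have "continuous_on {0..1} (\<lambda>x. u1 0 + (LINT y|lebesgue_on {0..x}. u2 y))"
    by (intro continuous_intros indefinite_integral_continuous_real L2_integrable H2_derivsD(2)[OF assms])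
  then show "continuous_on {0..1} u1"
    by (rule continuous_on_eq) (rule H2_derivsD(3)[OF assms, symmetric])
qed

lemma H2_derivs_diff_C2:
  assumes u: "H2_derivs u u1 u2"
    and v: "\<And>x. x \<in> {0..1} \<Longrightarrow> (v has_real_derivative v1 x) (at x within {0..1})"
    and v1: "\<And>x. x \<in> {0..1} \<Longrightarrow> (v1 has_real_derivative v2 x) (at x within {0..1})"
    and v2: "continuous_on {0..1} v2"
  shows "H2_derivs (\<lambda>x. u x - v x) (\<lambda>x. u1 x - v1 x) (\<lambda>x. u2 x - v2 x)"
  unfolding H2_derivs_def
proof (intro conjI ballI)
  show "(\<lambda>x. u2 x - v2 x) \<in> L2"
    by (intro L2_diff continuous_imp_L2 H2_derivsD(2)[OF u] v2)
  fix x :: real assume x: "x \<in> {0..1}"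
  show "((\<lambda>x. u x - v x) has_real_derivative u1 x - v1 x) (at x within {0..1})"
    by (intro DERIV_diff H2_derivsD(1)[OF u] v x)
  have "integrable (lebesgue_on {0..x}) u2" by (rule L2_integrable_on[OF H2_derivsD(2)[OF u] x])
  moreover have "integrable (lebesgue_on {0..x}) v2"
    using x by (intro continuous_imp_integrable_real continuous_on_subset[OF v2]) auto
  moreover have "(LINT y|lebesgue_on {0..x}. v2 y) = v1 x - v1 0"
    using x by (intro LINT_derivative DERIV_subset[OF v1] continuous_on_subset[OF v2]) auto
  moreover have "u1 x = u1 0 + (LINT y|lebesgue_on {0..x}. u2 y)" by (rule H2_derivsD(3)[OF u x])
  ultimately show "u1 x - v1 x = u1 0 - v1 0 + (LINT y|lebesgue_on {0..x}. u2 y - v2 y)" by simp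
qed

locale smooth_kernel =
  fixes \<epsilon> :: real and q :: ereal and c :: real and b :: "real \<Rightarrow> real"
    and K Kx Ky Kxx Kxy Kyy :: "real \<Rightarrow> real \<Rightarrow> real"
  assumes eps: "\<epsilon> > 0" and b: "continuous_on {0..1} b"
    and partials: "has_partials K Kx Ky" "has_partials Kx Kxx Kxy" "has_partials Ky Kxy Kyy"
    and pde: "\<And>x y. (x, y) \<in> triangle \<Longrightarrow> Kxx x y - Kyy x y = (b y + c) / \<epsilon> * K x y"
    and left: "\<And>x. x \<in> {0..1} \<Longrightarrow> left_bc q (K x 0) (Ky x 0)"
    and diagonal: "\<And>x. x \<in> {0..1} \<Longrightarrow> K x x = - 1 / (2 * \<epsilon>) * (LINT s|lebesgue_on {0..x}. b s + c)"

lemma backstepping_kernelE: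
  assumes "backstepping_kernel \<epsilon> q c b K Kx" "\<epsilon> > 0" "continuous_on {0..1} b"
  obtains Ky Kxx Kxy Kyy where "smooth_kernel \<epsilon> q c b K Kx Ky Kxx Kxy Kyy"
proof -
  from assms(1) obtain Ky Kxx Kxy Kyy where
    k: "has_partials K Kx Ky" "has_partials Kx Kxx Kxy" "has_partials Ky Kxy Kyy"
      "\<forall>(x, y)\<in>triangle. Kxx x y - Kyy x y = (b y + c) / \<epsilon> * K x y"
      "\<forall>x\<in>{0..1}. left_bc q (K x 0) (Ky x 0)"
      "\<forall>x\<in>{0..1}. K x x = - 1 / (2 * \<epsilon>) * (LINT s|lebesgue_on {0..x}. b s + c)"
    unfolding backstepping_kernel_def by (elim exE conjE) rule
  have "smooth_kernel \<epsilon> q c b K Kx Ky Kxx Kxy Kyy"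
  proof
    show "Kxx x y - Kyy x y = (b y + c) / \<epsilon> * K x y" if "(x, y) \<in> triangle" for x y
      using bspec[OF k(4) that] by simp
  qed (use k assms(2,3) in blast)+
  then show ?thesis by (rule that)
qed

context smooth_kernel
begin

lemma K_continuous: "continuous_on triangle (\<lambda>p. K (fst p) (snd p))"
  by (rule has_partials_continuous[OF partials(1)])

lemma Kxx_continuous: "continuous_on triangle (\<lambda>p. Kxx (fst p) (snd p))"
  by (rule has_partialsD(2)[OF partials(2)])

lemma Kyy_continuous: "continuous_on triangle (\<lambda>p. Kyy (fst p) (snd p))"
  by (rule has_partialsD(3)[OF partials(3)])

lemma K_zero: "K 0 0 = 0"
  using diagonal[of 0] by (simp add: integral_eq_zero_null_sets)

lemma diagonal_derivative:
  assumes F: "has_partials F Fx Fy" and x: "x \<in> {0..1}"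
  shows "((\<lambda>x. F x x) has_real_derivative Fx x x + Fy x x) (at x within {0..1})"
proof -
  have "((\<lambda>x. F x x) has_real_derivative Fx x x * 1 + Fy x x * 1) (at x within {0..1})"
    using x by (intro has_partials_chain[OF F]) (auto intro!: derivative_eq_intros simp: triangle_iff)
  then show ?thesis by simp
qed

lemma Kx_plus_Ky:
  assumes x: "x \<in> {0..1}"
  shows "2 * \<epsilon> * (Kx x x + Ky x x) = - (b x + c)"
proof -
  have "((\<lambda>x. LINT s|lebesgue_on {0..x}. b s + c) has_real_derivative b x + c) (at x within {0..1})"
    by (rule has_real_derivative_LINT[OF _ x]) (intro continuous_intros b)
  then have "((\<lambda>x. - 1 / (2 * \<epsilon>) * (LINT s|lebesgue_on {0..x}. b s + c)) has_real_derivative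
      - 1 / (2 * \<epsilon>) * (b x + c)) (at x within {0..1})" by (rule DERIV_cmult)
  then have "((\<lambda>x. K x x) has_real_derivative - 1 / (2 * \<epsilon>) * (b x + c)) (at x within {0..1})"
    by (rule has_field_derivative_transform_within[of _ _ _ _ 1]) (use diagonal x in auto)
  with diagonal_derivative[OF partials(1) x] have "Kx x x + Ky x x = - 1 / (2 * \<epsilon>) * (b x + c)"
    unfolding has_real_derivative_iff_has_vector_derivative
    by (intro vector_derivative_unique_within_closed_interval[of 0 1 x]) (use x in auto)
  then show ?thesis using eps by (simp add: field_simps)
qed

text \<open>Two integrations by parts. The boundary terms K(x,0) u'(0) and Ky(x,0) u(0) cancel
  because kernel and state obey the same left condition; for q = \<infinity> both vanish.\<close>

lemma volterra_second_derivative: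
  assumes u: "H2_derivs u u1 u2" and bc: "left_bc q (u 0) (u1 0)" and x: "x \<in> {0..1}"
  shows "volterra K u2 x = K x x * u1 x - Ky x x * u x + volterra Kyy u x"
proof -
  note cu = H2_derivs_continuous[OF u]
  have slice: "((\<lambda>y. F x y) has_real_derivative Fy x y) (at y within {0..x})"
    if F: "has_partials F Fx Fy" and y: "y \<in> {0..x}" for F Fx Fy y
  proof -
    have "((\<lambda>y. F x y) has_real_derivative Fx x y * 0 + Fy x y * 1) (at y within {0..x})"
      using x y by (intro has_partials_chain[OF F]) (auto intro!: derivative_eq_intros simp: triangle_iff)
    then show ?thesis by simp
  qed
  have u1L: "integrable (lebesgue_on {0..1}) u1"
    by (intro continuous_imp_integrable_real cu)
  have u_eq: "u y = u 0 + (LINT s|lebesgue_on {0..y}. u1 s)" if "y \<in> {0..1}" for y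
  proof -
    have "(LINT s|lebesgue_on {0..y}. u1 s) = u y - u 0"
      using that by (intro LINT_derivative continuous_on_subset[OF cu(2)] DERIV_subset[OF H2_derivsD(1)[OF u]]) auto
    then show ?thesis by simp
  qed
  have "volterra K u2 x = K x x * u1 x - K x 0 * u1 0 - (LINT y|lebesgue_on {0..x}. Ky x y * u1 y)"
    unfolding volterra_def
    by (rule LINT_by_parts[OF slice[OF partials(1)] _ L2_integrable[OF H2_derivsD(2)[OF u]] H2_derivsD(3)[OF u] x])
       (use x has_partialsD(3)[OF partials(1)] in \<open>auto intro!: continuous_on_triangle_slice\<close>)
  also have "(LINT y|lebesgue_on {0..x}. Ky x y * u1 y) = Ky x x * u x - Ky x 0 * u 0 - volterra Kyy u x"
    unfolding volterra_def
    by (rule LINT_by_parts[OF slice[OF partials(3)] _ u1L u_eq x])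
       (use x Kyy_continuous in \<open>auto intro!: continuous_on_triangle_slice\<close>)
  also have "K x 0 * u1 0 = Ky x 0 * u 0"
    using bc left[OF x] by (auto simp: left_bc_def split: if_splits)
  finally show ?thesis by simp
qed

text \<open>Two cancellations give the target operator: the diagonal condition turns the local terms
  into -(b + c) u, and the kernel equation turns the integral terms into those of (b + c) u. The
  value of \<open>w1\<close> at 1 handles Neumann actuation; for Dirichlet actuation the transform
  at 1 is u(1) minus the control by definition.\<close>

lemma backstepping_transform_H2:
  assumes u: "H2_derivs u u1 u2" and bc: "left_bc q (u 0) (u1 0)"
  obtains w1 w2 where "H2_derivs (backstepping_transform K u) w1 w2"
    and "left_bc q (backstepping_transform K u 0) (w1 0)"
    and "w1 1 = u1 1 - control_law Neumann K Kx u"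
    and "\<And>x. x \<in> {0..1} \<Longrightarrow> backstepping_transform K (\<lambda>x. \<epsilon> * u2 x + b x * u x) x
      = \<epsilon> * w2 x - c * backstepping_transform K u x"
proof
  note cu = H2_derivs_continuous[OF u]
  have uL: "u \<in> L2" by (rule continuous_imp_L2[OF cu(1)])
  have diag_cont: "continuous_on {0..1} (\<lambda>x. F x x)" if "continuous_on triangle (\<lambda>p. F (fst p) (snd p))"
    for F :: "real \<Rightarrow> real \<Rightarrow> real"
    by (rule continuous_on_compose2[OF that, of _ "\<lambda>s. (s, s)", simplified])
       (auto intro!: continuous_intros simp: triangle_iff)
  note cK = K_continuous and cKx = has_partialsD(2)[OF partials(1)] and cKy = has_partialsD(3)[OF partials(1)]
  define v1 where "v1 = (\<lambda>x. K x x * u x + volterra Kx u x)"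
  define v2 where "v2 = (\<lambda>x. (Kx x x + Ky x x) * u x + K x x * u1 x + (Kx x x * u x + volterra Kxx u x))"
  have v1: "(volterra K u has_real_derivative v1 x) (at x within {0..1})" if "x \<in> {0..1}" for x
    unfolding v1_def by (rule volterra_has_derivative[OF partials(1) cu(1) that])
  have v2: "(v1 has_real_derivative v2 x) (at x within {0..1})" if x: "x \<in> {0..1}" for x
  proof -
    have "((\<lambda>x. K x x * u x) has_real_derivative (Kx x x + Ky x x) * u x + u1 x * K x x) (at x within {0..1})"
      by (rule DERIV_mult[OF diagonal_derivative[OF partials(1) x] H2_derivsD(1)[OF u x]])
    from DERIV_add[OF this volterra_has_derivative[OF partials(2) cu(1) x]] show ?thesis
      unfolding v1_def v2_def by (rule DERIV_cong) (simp add: mult.commute)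
  qed
  have cv2: "continuous_on {0..1} v2"
    unfolding v2_def by (intro continuous_intros diag_cont[OF cK] diag_cont[OF cKx] diag_cont[OF cKy] cu
        volterra_continuous[OF Kxx_continuous uL] volterra_continuous[OF cKx uL])
  show "H2_derivs (backstepping_transform K u) (\<lambda>x. u1 x - v1 x) (\<lambda>x. u2 x - v2 x)"
    unfolding backstepping_transform_eq by (rule H2_derivs_diff_C2[OF u v1 v2 cv2])
  have z: "volterra F u 0 = 0" for F by (simp add: volterra_def integral_eq_zero_null_sets)
  show "left_bc q (backstepping_transform K u 0) (u1 0 - v1 0)"
    using bc by (simp add: backstepping_transform_eq v1_def z K_zero)
  show "u1 1 - v1 1 = u1 1 - control_law Neumann K Kx u"
    unfolding v1_def control_law_def volterra_def by simp
  fix x :: real assume x: "x \<in> {0..1}"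
  have cbu: "continuous_on {0..1} (\<lambda>x. b x * u x)" by (intro continuous_intros b cu)
  have i: "integrable (lebesgue_on {0..x}) (\<lambda>y. F x y * h y)"
    if "continuous_on triangle (\<lambda>p. F (fst p) (snd p))" "h \<in> L2" for F h
    by (rule volterra_integrable[OF that x])
  have 1: "volterra K (\<lambda>x. \<epsilon> * u2 x + b x * u x) x = \<epsilon> * volterra K u2 x + volterra K (\<lambda>x. b x * u x) x"
  proof -
    have "volterra K (\<lambda>x. \<epsilon> * u2 x + b x * u x) x
        = (LINT y|lebesgue_on {0..x}. \<epsilon> * (K x y * u2 y) + K x y * (b y * u y))"
      unfolding volterra_def by (rule Bochner_Integration.integral_cong[OF refl]) (simp add: algebra_simps)
    then show ?thesis
      using i[OF cK H2_derivsD(2)[OF u]] i[OF cK continuous_imp_L2[OF cbu]] by (simp add: volterra_def)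
  qed
  have "\<epsilon> * volterra Kxx u x - \<epsilon> * volterra Kyy u x = (LINT y|lebesgue_on {0..x}. \<epsilon> * (Kxx x y * u y) - \<epsilon> * (Kyy x y * u y))"
    using i[OF Kxx_continuous uL] i[OF Kyy_continuous uL] by (simp add: volterra_def)
  also have "\<dots> = (LINT y|lebesgue_on {0..x}. K x y * (b y * u y) + c * (K x y * u y))"
  proof (rule Bochner_Integration.integral_cong[OF refl])
    fix y assume "y \<in> space (lebesgue_on {0..x})"
    then have "Kxx x y - Kyy x y = (b y + c) / \<epsilon> * K x y" using x by (intro pde) (simp add: triangle_iff)
    then have "\<epsilon> * (Kxx x y - Kyy x y) = (b y + c) * K x y" using eps by simp
    then have "\<epsilon> * (Kxx x y - Kyy x y) * u y = (b y + c) * K x y * u y" by (rule arg_cong)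
    moreover have "\<epsilon> * (Kxx x y - Kyy x y) * u y = \<epsilon> * (Kxx x y * u y) - \<epsilon> * (Kyy x y * u y)"
      by (simp add: algebra_simps)
    moreover have "(b y + c) * K x y * u y = K x y * (b y * u y) + c * (K x y * u y)"
      by (simp add: algebra_simps)
    ultimately show "\<epsilon> * (Kxx x y * u y) - \<epsilon> * (Kyy x y * u y) = K x y * (b y * u y) + c * (K x y * u y)"
      by linarith
  qed
  also have "\<dots> = volterra K (\<lambda>x. b x * u x) x + c * volterra K u x"
    using i[OF cK uL] i[OF cK continuous_imp_L2[OF cbu]] by (simp add: volterra_def)
  finally have 2: "\<epsilon> * volterra Kxx u x - \<epsilon> * volterra Kyy u x = volterra K (\<lambda>x. b x * u x) x + c * volterra K u x" .
  have 3: "2 * \<epsilon> * (Kx x x + Ky x x) * u x = - (b x + c) * u x" using Kx_plus_Ky[OF x] by simp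
  show "backstepping_transform K (\<lambda>x. \<epsilon> * u2 x + b x * u x) x
      = \<epsilon> * (u2 x - v2 x) - c * backstepping_transform K u x"
    unfolding backstepping_transform_eq 1 volterra_second_derivative[OF u bc x] v2_def
    using 2 3 by (simp add: algebra_simps)
qed

end

subsection \<open>The smallest eigenvalue\<close>

text \<open>For r' + r^2 \<le> -m the derivative of r h^2 is at most h'^2 - m h^2, since (h' - r
  h)^2 \<ge> 0. It is applied with r = \<phi>'/\<phi> for the Rayleigh inequality and with an
  explicit r for the lower bound on eigenvalues.\<close>

lemma picone_interval:
  fixes h h1 r r1 :: "real \<Rightarrow> real"
  assumes h: "\<And>x. x \<in> {a..b} \<Longrightarrow> (h has_real_derivative h1 x) (at x within {a..b})"
    and r: "\<And>x. x \<in> {a..b} \<Longrightarrow> (r has_real_derivative r1 x) (at x within {a..b})"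
    and c: "continuous_on {a..b} h1" "continuous_on {a..b} r1"
    and le: "\<And>x. x \<in> {a..b} \<Longrightarrow> r1 x + (r x)\<^sup>2 \<le> - m" and ab: "a \<le> b"
  shows "r b * (h b)\<^sup>2 - r a * (h a)\<^sup>2 \<le> (LINT x|lebesgue_on {a..b}. (h1 x)\<^sup>2 - m * (h x)\<^sup>2)"
proof -
  have ch: "continuous_on {a..b} h" "continuous_on {a..b} r"
    by (rule DERIV_continuous_on[OF h] DERIV_continuous_on[OF r], assumption)+
  have d: "((\<lambda>x. r x * (h x)\<^sup>2) has_real_derivative r1 x * (h x)\<^sup>2 + 2 * h x * h1 x * r x) (at x within {a..b})"
    if "x \<in> {a..b}" for x
    using that by (auto intro!: derivative_eq_intros h r)
  have "(LINT x|lebesgue_on {a..b}. r1 x * (h x)\<^sup>2 + 2 * h x * h1 x * r x) = r b * (h b)\<^sup>2 - r a * (h a)\<^sup>2"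
    by (rule LINT_derivative[OF d _ ab]) (auto intro!: continuous_intros c ch)
  moreover have "(LINT x|lebesgue_on {a..b}. r1 x * (h x)\<^sup>2 + 2 * h x * h1 x * r x)
      \<le> (LINT x|lebesgue_on {a..b}. (h1 x)\<^sup>2 - m * (h x)\<^sup>2)"
  proof (rule integral_mono)
    fix x assume "x \<in> space (lebesgue_on {a..b})"
    then have "(r1 x + (r x)\<^sup>2) * (h x)\<^sup>2 \<le> (- m) * (h x)\<^sup>2" using le by (intro mult_right_mono) auto
    moreover have "0 \<le> (h1 x - r x * h x)\<^sup>2" by simp
    ultimately show "r1 x * (h x)\<^sup>2 + 2 * h x * h1 x * r x \<le> (h1 x)\<^sup>2 - m * (h x)\<^sup>2"
      by (simp add: power2_eq_square algebra_simps)
  qed (auto intro!: continuous_imp_integrable_real continuous_intros c ch)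
  ultimately show ?thesis by simp
qed

lemma L2_inner_second_derivative:
  assumes "H2_derivs h h1 h2"
  shows "L2_inner h h2 = h 1 * h1 1 - h 0 * h1 0 - L2_inner h1 h1"
  unfolding L2_inner_def
  by (rule LINT_by_parts[OF H2_derivsD(1)[OF assms] H2_derivs_continuous(2)[OF assms]
        L2_integrable[OF H2_derivsD(2)[OF assms]] H2_derivsD(3)[OF assms]]) auto

lemma L2_inner_energy:
  assumes "H2_derivs h h1 h2"
  shows "(LINT x|lebesgue_on {0..1}. (h1 x)\<^sup>2 - m * (h x)\<^sup>2) = L2_inner h1 h1 - m * L2_inner h h"
proof -
  note c = H2_derivs_continuous[OF assms]
  have "integrable (lebesgue_on {0..1}) (\<lambda>x. (h1 x)\<^sup>2)" "integrable (lebesgue_on {0..1}) (\<lambda>x. (h x)\<^sup>2)"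
    by (auto intro!: continuous_imp_integrable_real continuous_intros c)
  then show ?thesis unfolding L2_inner_def by (simp add: power2_eq_square)
qed

text \<open>The last two conditions make endpoint zeros simple, which is what lets \<phi>'/\<phi>
  times h^2 have a limit there.\<close>

definition positive_eigenfunction ::
  "ereal \<Rightarrow> actuation \<Rightarrow> real \<Rightarrow> (real \<Rightarrow> real) \<Rightarrow> (real \<Rightarrow> real) \<Rightarrow> bool" where
  "positive_eigenfunction q act m \<phi> \<phi>1 \<longleftrightarrow>
     (\<forall>x\<in>{0..1}. (\<phi> has_real_derivative \<phi>1 x) (at x within {0..1}) \<and>
        (\<phi>1 has_real_derivative - m * \<phi> x) (at x within {0..1})) \<and>
     (\<forall>x. 0 < x \<and> x < 1 \<longrightarrow> 0 < \<phi> x) \<and>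
     left_bc q (\<phi> 0) (\<phi>1 0) \<and> right_value act (\<phi> 1) (\<phi>1 1) = 0 \<and>
     (\<phi> 0 = 0 \<longrightarrow> \<phi>1 0 \<noteq> 0) \<and> (\<phi> 1 = 0 \<longrightarrow> \<phi>1 1 \<noteq> 0)"

section \<open>Explicit positive eigenfunctions\<close>

lemma positive_eigenfunctionI:
  assumes "\<And>x. (\<phi> has_real_derivative \<phi>1 x) (at x)" "\<And>x. (\<phi>1 has_real_derivative - m * \<phi> x) (at x)"
    and "\<And>x. 0 < x \<Longrightarrow> x < 1 \<Longrightarrow> 0 < \<phi> x"
    and "left_bc q (\<phi> 0) (\<phi>1 0)" "right_value act (\<phi> 1) (\<phi>1 1) = 0"
    and "\<phi> 0 \<noteq> 0 \<or> \<phi>1 0 \<noteq> 0" "\<phi> 1 \<noteq> 0 \<or> \<phi>1 1 \<noteq> 0"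
  shows "\<exists>m \<phi> \<phi>1. positive_eigenfunction q act m \<phi> \<phi>1"
proof -
  have "positive_eigenfunction q act m \<phi> \<phi>1"
    using assms unfolding positive_eigenfunction_def by (blast intro: has_field_derivative_at_within)
  then show ?thesis by blast
qed

text \<open>For finite \<open>q\<close> the solution of \<open>\<phi>'' = -m \<phi>\<close> is written in terms of \<open>1 - x\<close>, so that the condition at 1 holds
  automatically and the one at 0 is a scalar equation for the frequency.\<close>

lemma positive_eigenfunction_Dirichlet_trig:
  fixes p :: real
  assumes p: "p > -1"
  shows "\<exists>m \<phi> \<phi>1. positive_eigenfunction (ereal p) Dirichlet m \<phi> \<phi>1"
proof -
  define f where "f = (\<lambda>k::real. k * cos k + p * sin k)"
  have "(f has_real_derivative 1 + p) (at 0)"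
    unfolding f_def by (auto intro!: derivative_eq_intros)
  moreover have "0 < 1 + p" using p by simp
  ultimately obtain d where d: "d > 0" "\<And>h. 0 < h \<Longrightarrow> h < d \<Longrightarrow> f 0 < f (0 + h)"
    using DERIV_pos_inc_right[of f] by blast
  \<comment> \<open>\<open>f\<close> vanishes at 0, which would give the zero function. Its positive
    slope there provides a left end \<open>l > 0\<close> with \<open>f l > 0\<close> for the
    intermediate value theorem, against f pi = -pi.\<close>
  define l where "l = min (d / 2) 1"
  have l: "0 < l" "l < d" "l \<le> 1" using d(1) by (auto simp: l_def)
  have fl: "0 < f l" using d(2)[OF l(1,2)] by (simp add: f_def)
  have "\<exists>k\<ge>l. k \<le> pi \<and> f k = 0"
  proof (rule IVT2')
    show "l \<le> pi" using l pi_gt3 by linarith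
    show "continuous_on {l..pi} f" unfolding f_def by (intro continuous_intros)
  qed (use fl in \<open>auto simp: f_def\<close>)
  then obtain k where k: "l \<le> k" "k \<le> pi" "f k = 0" by blast
  have "f pi \<noteq> 0" by (simp add: f_def)
  then have "k \<noteq> pi" using k(3) by metis
  then have k0: "0 < k" "k < pi" using k l by auto
  have k1: "k * cos k + p * sin k = 0" using k(3) by (simp add: f_def)
  show ?thesis
  proof (rule positive_eigenfunctionI)
    show "((\<lambda>x. sin (k * (1 - x))) has_real_derivative - k * cos (k * (1 - x))) (at x)" for x
      by (auto intro!: derivative_eq_intros)
    show "((\<lambda>x. - k * cos (k * (1 - x))) has_real_derivative - (k\<^sup>2) * sin (k * (1 - x))) (at x)" for x
      by (auto intro!: derivative_eq_intros simp: power2_eq_square)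
    show "0 < sin (k * (1 - x))" if "0 < x" "x < 1" for x
    proof (rule sin_gt_zero)
      have "k * (1 - x) < k * 1" using k0 that by (intro mult_strict_left_mono) auto
      then show "k * (1 - x) < pi" using k0 by linarith
    qed (use k0 that in simp)
    show "left_bc (ereal p) (sin (k * (1 - 0))) (- k * cos (k * (1 - 0)))"
      using k1 by (simp add: left_bc_def)
    show "sin (k * (1 - 0)) \<noteq> 0 \<or> - k * cos (k * (1 - 0)) \<noteq> 0"
      using sin_gt_zero[OF k0] by simp
  qed (use k0 in \<open>auto simp: right_value_def\<close>)
qed

text \<open>Beyond the critical slope -1 the positive eigenfunction belongs to a negative eigenvalue
  -k^2, so sine becomes sinh. The root k lies to the right of 0, where \<open>f\<close> starts with
  slope 1 + p < 0, and at most at -p, where cosh \<ge> sinh makes \<open>f\<close>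
  nonnegative.\<close>

lemma positive_eigenfunction_Dirichlet_hyp:
  fixes p :: real
  assumes p: "p < -1"
  shows "\<exists>m \<phi> \<phi>1. positive_eigenfunction (ereal p) Dirichlet m \<phi> \<phi>1"
proof -
  define f where "f = (\<lambda>k::real. k * cosh k + p * sinh k)"
  have "(f has_real_derivative 1 + p) (at 0)"
    unfolding f_def by (auto intro!: derivative_eq_intros)
  moreover have "1 + p < 0" using p by simp
  ultimately obtain d where d: "d > 0" "\<And>h. 0 < h \<Longrightarrow> h < d \<Longrightarrow> f (0 + h) < f 0"
    using DERIV_neg_dec_right[of f] by blast
  define l where "l = min (d / 2) 1"
  have l: "0 < l" "l < d" "l \<le> 1" using d(1) by (auto simp: l_def)
  have fl: "f l < 0" using d(2)[OF l(1,2)] by (simp add: f_def)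
  have "p * cosh (- p) \<le> p * sinh (- p)"
    using p sinh_le_cosh_real[of "- p"] by (intro mult_left_mono_neg) auto
  then have fp: "0 \<le> f (- p)" unfolding f_def by linarith
  have "\<exists>k\<ge>l. k \<le> - p \<and> f k = 0"
  proof (rule IVT')
    show "l \<le> - p" using l p by linarith
    show "continuous_on {l..- p} f" unfolding f_def by (intro continuous_intros)
  qed (use fl fp in auto)
  then obtain k where k: "l \<le> k" "f k = 0" by blast
  then have k0: "0 < k" using l by simp
  have k1: "k * cosh k + p * sinh k = 0" using k(2) by (simp add: f_def)
  show ?thesis
  proof (rule positive_eigenfunctionI)
    show "((\<lambda>x. sinh (k * (1 - x))) has_real_derivative - k * cosh (k * (1 - x))) (at x)" for x
      by (auto intro!: derivative_eq_intros)
    show "((\<lambda>x. - k * cosh (k * (1 - x))) has_real_derivative - (- (k\<^sup>2)) * sinh (k * (1 - x))) (at x)" for x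
      by (auto intro!: derivative_eq_intros simp: power2_eq_square)
    show "left_bc (ereal p) (sinh (k * (1 - 0))) (- k * cosh (k * (1 - 0)))"
      using k1 by (simp add: left_bc_def)
  qed (use k0 in \<open>auto simp: right_value_def\<close>)
qed

text \<open>The root k = 0 is legitimate here: for p = 0 it yields the constant eigenfunction. A
  root below pi/2 keeps the cosine positive.\<close>

lemma positive_eigenfunction_Neumann_trig:
  fixes p :: real
  assumes p: "p \<ge> 0"
  shows "\<exists>m \<phi> \<phi>1. positive_eigenfunction (ereal p) Neumann m \<phi> \<phi>1"
proof -
  define f where "f = (\<lambda>k::real. k * sin k - p * cos k)"
  have "\<exists>k\<ge>0. k \<le> pi / 2 \<and> f k = 0"
  proof (rule IVT')
    show "continuous_on {0..pi / 2} f" unfolding f_def by (intro continuous_intros)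
  qed (use p in \<open>auto simp: f_def\<close>)
  then obtain k where k: "0 \<le> k" "k \<le> pi / 2" "f k = 0" by blast
  have "f (pi / 2) \<noteq> 0" by (simp add: f_def)
  then have "k \<noteq> pi / 2" using k(3) by metis
  then have k0: "k < pi / 2" using k by simp
  have k1: "k * sin k = p * cos k" using k(3) by (simp add: f_def)
  have cos: "0 < cos (k * (1 - x))" if "0 \<le> x" "x < 1" for x
  proof (rule cos_gt_zero_pi)
    have "k * (1 - x) \<le> k * 1" using k that by (intro mult_left_mono) auto
    then show "k * (1 - x) < pi / 2" using k0 by linarith
    have "0 \<le> k * (1 - x)" using k that by simp
    then show "- (pi / 2) < k * (1 - x)" using pi_gt_zero by linarith
  qed
  show ?thesis
  proof (rule positive_eigenfunctionI)
    show "((\<lambda>x. cos (k * (1 - x))) has_real_derivative k * sin (k * (1 - x))) (at x)" for x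
      by (auto intro!: derivative_eq_intros)
    show "((\<lambda>x. k * sin (k * (1 - x))) has_real_derivative - (k\<^sup>2) * cos (k * (1 - x))) (at x)" for x
      by (auto intro!: derivative_eq_intros simp: power2_eq_square)
    show "0 < cos (k * (1 - x))" if "0 < x" "x < 1" for x using cos that by simp
    show "left_bc (ereal p) (cos (k * (1 - 0))) (k * sin (k * (1 - 0)))"
      using k1 by (simp add: left_bc_def)
    show "cos (k * (1 - 0)) \<noteq> 0 \<or> k * sin (k * (1 - 0)) \<noteq> 0" using cos[of 0] by simp
  qed (auto simp: right_value_def)
qed

lemma positive_eigenfunction_Neumann_hyp:
  fixes p :: real
  assumes p: "p < 0"
  shows "\<exists>m \<phi> \<phi>1. positive_eigenfunction (ereal p) Neumann m \<phi> \<phi>1"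
proof -
  define f where "f = (\<lambda>k::real. k * sinh k + p * cosh k)"
  \<comment> \<open>For this \<open>l\<close> the value \<open>f l\<close> becomes (exp l - (2 l -
    1) exp (-l)) / 2, and 1 + 2 l \<le> exp (2 l) makes it nonnegative.\<close>
  define l where "l = 1 - p"
  have fl: "0 \<le> f l"
  proof -
    have "1 + 2 * l \<le> exp (2 * l)" by (rule exp_ge_add_one_self)
    moreover have "exp (2 * l) = exp l * exp l" by (simp flip: exp_add)
    ultimately have "(2 * l - 1) \<le> exp l * exp l" by linarith
    then have "(2 * l - 1) * exp (- l) \<le> exp l * exp l * exp (- l)" by (rule mult_right_mono) simp
    also have "\<dots> = exp l" by (simp add: exp_minus)
    finally have "(2 * l - 1) * exp (- l) \<le> exp l" .
    moreover have "f l = (exp l - (2 * l - 1) * exp (- l)) / 2"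
      unfolding f_def sinh_def cosh_def l_def by (simp add: algebra_simps add_divide_distrib diff_divide_distrib)
    ultimately show ?thesis by simp
  qed
  have "\<exists>k\<ge>0. k \<le> l \<and> f k = 0"
  proof (rule IVT')
    show "continuous_on {0..l} f" unfolding f_def by (intro continuous_intros)
  qed (use p fl in \<open>auto simp: f_def l_def\<close>)
  then obtain k where k: "0 \<le> k" "f k = 0" by blast
  have k1: "k * sinh k + p * cosh k = 0" using k(2) by (simp add: f_def)
  show ?thesis
  proof (rule positive_eigenfunctionI)
    show "((\<lambda>x. cosh (k * (1 - x))) has_real_derivative - k * sinh (k * (1 - x))) (at x)" for x
      by (auto intro!: derivative_eq_intros)
    show "((\<lambda>x. - k * sinh (k * (1 - x))) has_real_derivative - (- (k\<^sup>2)) * cosh (k * (1 - x))) (at x)" for x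
      by (auto intro!: derivative_eq_intros simp: power2_eq_square)
    show "left_bc (ereal p) (cosh (k * (1 - 0))) (- k * sinh (k * (1 - 0)))"
      using k1 by (simp add: left_bc_def)
  qed (auto simp: right_value_def)
qed

lemma positive_eigenfunction_exists:
  assumes q: "q \<noteq> -\<infinity>"
  shows "\<exists>m \<phi> \<phi>1. positive_eigenfunction q act m \<phi> \<phi>1"
proof (cases q)
  case (real p)
  show ?thesis
  proof (cases act)
    case Dirichlet
    \<comment> \<open>The critical slope between the two families: eigenvalue 0 with an affine
      eigenfunction.\<close>
    have "\<exists>m \<phi> \<phi>1. positive_eigenfunction (ereal (-1)) Dirichlet m \<phi> \<phi>1"
      by (rule positive_eigenfunctionI[of "\<lambda>x. 1 - x" "\<lambda>x. -1" 0])
        (auto simp: left_bc_def right_value_def intro!: derivative_eq_intros)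
    then show ?thesis
      using positive_eigenfunction_Dirichlet_trig[of p] positive_eigenfunction_Dirichlet_hyp[of p]
      unfolding real Dirichlet by (cases p "-1 :: real" rule: linorder_cases) auto
  next
    case Neumann
    then show ?thesis
      using positive_eigenfunction_Neumann_trig[of p] positive_eigenfunction_Neumann_hyp[of p]
      unfolding real Neumann by (cases "0 \<le> p") auto
  qed
next
  case PInf
  have bc: "left_bc q 0 x" for x by (simp add: PInf left_bc_def)
  show ?thesis
  proof (cases act)
    case Dirichlet
    show ?thesis
    proof (rule positive_eigenfunctionI)
      show "((\<lambda>x. sin (pi * x)) has_real_derivative pi * cos (pi * x)) (at x)" for x
        by (auto intro!: derivative_eq_intros)
      show "((\<lambda>x. pi * cos (pi * x)) has_real_derivative - (pi\<^sup>2) * sin (pi * x)) (at x)" for x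
        by (auto intro!: derivative_eq_intros simp: power2_eq_square)
    qed (use bc in \<open>auto simp: Dirichlet right_value_def intro!: sin_gt_zero\<close>)
  next
    case Neumann
    show ?thesis
    proof (rule positive_eigenfunctionI)
      show "((\<lambda>x. sin (pi / 2 * x)) has_real_derivative pi / 2 * cos (pi / 2 * x)) (at x)" for x
        by (auto intro!: derivative_eq_intros)
      show "((\<lambda>x. pi / 2 * cos (pi / 2 * x)) has_real_derivative - ((pi / 2)\<^sup>2) * sin (pi / 2 * x)) (at x)" for x
        by (auto intro!: derivative_eq_intros simp: power2_eq_square)
      show "0 < sin (pi / 2 * x)" if "0 < x" "x < 1" for x
      proof (rule sin_gt_zero)
        have "pi / 2 * x < pi * 1" using that by (intro mult_strict_mono) auto
        then show "pi / 2 * x < pi" by simp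
      qed (use that in simp)
    qed (use bc in \<open>auto simp: Neumann right_value_def\<close>)
  qed
qed (use q in simp)

lemma L2_inner_self_pos:
  assumes "continuous_on {0..1} h" "x \<in> {0..1}" "h x \<noteq> 0"
  shows "0 < L2_inner h h"
proof -
  have "(LINT x|lebesgue_on {0..1}. h x * h x) \<noteq> 0"
    using assms by (subst integralL_eq_0_iff) (auto intro!: continuous_intros)
  with L2_inner_self_nonneg[of h] show ?thesis unfolding L2_inner_def by linarith
qed

section \<open>From a positive eigenfunction to the Rayleigh inequality\<close>

lemma positive_eigenfunction_is_eigenvalue:
  assumes "positive_eigenfunction q act m \<phi> \<phi>1"
  shows "is_eigenvalue q act m"
proof -
  note p = assms[unfolded positive_eigenfunction_def]
  have d: "(\<phi> has_real_derivative \<phi>1 x) (at x within {0..1})" "(\<phi>1 has_real_derivative - m * \<phi> x) (at x within {0..1})"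
    if "x \<in> {0..1}" for x using p that by auto
  have c: "continuous_on {0..1} \<phi>" by (rule DERIV_continuous_on[OF d(1)])
  have L: "\<phi> \<in> L2" by (rule continuous_imp_L2[OF c])
  have "H2_derivs \<phi> \<phi>1 (\<lambda>x. - m * \<phi> x)"
    unfolding H2_derivs_def
  proof (intro conjI ballI d(1))
    show "(\<lambda>x. - m * \<phi> x) \<in> L2" by (rule L2_cmult[OF L])
    fix x :: real assume x: "x \<in> {0..1}"
    have "(LINT y|lebesgue_on {0..x}. - m * \<phi> y) = \<phi>1 x - \<phi>1 0"
      using x by (intro LINT_derivative DERIV_subset[OF d(2)] continuous_intros continuous_on_subset[OF c]) auto
    then show "\<phi>1 x = \<phi>1 0 + (LINT y|lebesgue_on {0..x}. - m * \<phi> y)" by simp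
  qed
  moreover have "\<not> L2_eq \<phi> (\<lambda>x. 0)"
  proof
    assume "L2_eq \<phi> (\<lambda>x. 0)"
    then have "L2_norm \<phi> = L2_norm (\<lambda>x. 0)"
      by (rule L2_norm_cong_AE[OF _ L]) (rule continuous_imp_L2, simp)
    then have "L2_inner \<phi> \<phi> = 0" by (simp add: L2_norm_def L2_inner_def)
    moreover have "\<phi> (1/2) > 0" using p by simp
    ultimately show False using L2_inner_self_pos[OF c, of "1/2"] by simp
  qed
  moreover have "L2_eq (\<lambda>x. - (- m * \<phi> x)) (\<lambda>x. m * \<phi> x)" by (simp add: L2_eq_def)
  ultimately show ?thesis unfolding is_eigenvalue_def using p by blast
qed

text \<open>At a common zero the expression is \<phi>' h times a ratio of difference quotients of h
  and \<phi>; the ratio converges because the zero of \<phi> is simple, and h tends to 0. The stated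
  limit is then also 0, as division by zero yields 0.\<close>

lemma picone_endpoint:
  fixes h \<phi> \<phi>1 :: "real \<Rightarrow> real" and h1 :: real
  assumes h: "(h has_real_derivative h1) (at e within S)" and \<phi>: "(\<phi> has_real_derivative \<phi>1 e) (at e within S)"
    and c: "continuous (at e within S) \<phi>1"
    and nd: "\<phi> e = 0 \<Longrightarrow> h e = 0 \<and> \<phi>1 e \<noteq> 0"
  shows "((\<lambda>x. \<phi>1 x / \<phi> x * (h x)\<^sup>2) \<longlongrightarrow> \<phi>1 e / \<phi> e * (h e)\<^sup>2) (at e within S)"
proof -
  have lim: "(h \<longlongrightarrow> h e) (at e within S)" "(\<phi> \<longlongrightarrow> \<phi> e) (at e within S)" "(\<phi>1 \<longlongrightarrow> \<phi>1 e) (at e within S)"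
    using h \<phi> c by (auto simp: continuous_within dest: DERIV_continuous)
  show ?thesis
  proof (cases "\<phi> e = 0")
    case False
    then show ?thesis by (intro tendsto_intros lim)
  next
    case True
    have "((\<lambda>x. \<phi>1 x * h x * (((h x - h e) / (x - e)) / ((\<phi> x - \<phi> e) / (x - e)))) \<longlongrightarrow> \<phi>1 e * h e * (h1 / \<phi>1 e))
        (at e within S)"
      using h \<phi> nd True by (intro tendsto_intros lim) (auto simp: has_field_derivative_iff)
    then have "((\<lambda>x. \<phi>1 x / \<phi> x * (h x)\<^sup>2) \<longlongrightarrow> \<phi>1 e * h e * (h1 / \<phi>1 e)) (at e within S)"
      by (rule Lim_transform_eventually)
         (use nd[OF True] True in \<open>auto simp: eventually_at_filter power2_eq_square\<close>)
    then show ?thesis using nd[OF True] True by simp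
  qed
qed

text \<open>\<phi>'/\<phi> may be singular at 0 and 1, so Picone's inequality is applied on compact
  subintervals. It says that \<open>F - Q\<close> is increasing on (0,1), and this survives in the
  limits at both endpoints.\<close>

lemma positive_eigenfunction_rayleigh:
  assumes p: "positive_eigenfunction q act m \<phi> \<phi>1" and h: "H2_derivs h h1 h2"
    and bc: "left_bc q (h 0) (h1 0)" "right_value act (h 1) (h1 1) = 0"
  shows "L2_inner h h2 \<le> - m * L2_inner h h"
proof -
  note p = p[unfolded positive_eigenfunction_def]
  have d: "(\<phi> has_real_derivative \<phi>1 x) (at x within {0..1})" "(\<phi>1 has_real_derivative - m * \<phi> x) (at x within {0..1})"
    if "x \<in> {0..1}" for x using p that by auto
  have pos: "0 < \<phi> x" if "0 < x" "x < 1" for x using p that by auto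
  note ch = H2_derivs_continuous[OF h] and dh = H2_derivsD(1)[OF h]
  have cp: "continuous_on {0..1} \<phi>" "continuous_on {0..1} \<phi>1"
    by (rule DERIV_continuous_on[OF d(1)] DERIV_continuous_on[OF d(2)], assumption)+
  define Q where "Q = (\<lambda>x. \<phi>1 x / \<phi> x * (h x)\<^sup>2)"
  define F where "F = (\<lambda>x. LINT y|lebesgue_on {0..x}. (h1 y)\<^sup>2 - m * (h y)\<^sup>2)"
  have ce: "continuous_on {0..1} (\<lambda>y. (h1 y)\<^sup>2 - m * (h y)\<^sup>2)" by (intro continuous_intros ch)
  have nd0: "\<phi> 0 = 0 \<Longrightarrow> h 0 = 0 \<and> \<phi>1 0 \<noteq> 0" using p bc(1) by (auto simp: left_bc_def split: if_splits)
  have nd1: "\<phi> 1 = 0 \<Longrightarrow> h 1 = 0 \<and> \<phi>1 1 \<noteq> 0" using p bc(2) by (auto simp: right_value_def split: actuation.splits)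
  have mono: "F a - Q a \<le> F b - Q b" if ab: "0 < a" "a < b" "b < 1" for a b
  proof -
    have pos': "0 < \<phi> x" if "x \<in> {a..b}" for x using pos[of x] that ab by auto
    have sub: "{a..b} \<subseteq> {0..1}" using ab by auto
    have "\<phi>1 b / \<phi> b * (h b)\<^sup>2 - \<phi>1 a / \<phi> a * (h a)\<^sup>2 \<le> (LINT x|lebesgue_on {a..b}. (h1 x)\<^sup>2 - m * (h x)\<^sup>2)"
    proof (rule picone_interval[where ?r1.0 = "\<lambda>x. - m - (\<phi>1 x / \<phi> x)\<^sup>2"])
      fix x assume x: "x \<in> {a..b}"
      then have x01: "x \<in> {0..1}" using sub by auto
      show "(h has_real_derivative h1 x) (at x within {a..b})" by (rule DERIV_subset[OF dh[OF x01] sub])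
      have "((\<lambda>x. \<phi>1 x / \<phi> x) has_real_derivative (- m * \<phi> x * \<phi> x - \<phi>1 x * \<phi>1 x) / (\<phi> x * \<phi> x)) (at x within {a..b})"
        using pos'[OF x] by (intro DERIV_divide DERIV_subset[OF d(1)[OF x01] sub] DERIV_subset[OF d(2)[OF x01] sub]) auto
      then show "((\<lambda>x. \<phi>1 x / \<phi> x) has_real_derivative - m - (\<phi>1 x / \<phi> x)\<^sup>2) (at x within {a..b})"
        by (rule DERIV_cong) (use pos'[OF x] in \<open>simp add: field_simps power2_eq_square\<close>)
    qed (use ab pos' in \<open>auto intro!: continuous_intros continuous_on_subset[OF ch(2) sub]
        continuous_on_subset[OF cp(1) sub] continuous_on_subset[OF cp(2) sub] dest!: pos'\<close>)
    moreover have "F b = F a + (LINT x|lebesgue_on {a..b}. (h1 x)\<^sup>2 - m * (h x)\<^sup>2)"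
      unfolding F_def using ab
      by (intro integral_combine continuous_imp_integrable_real continuous_on_subset[OF ce]) auto
    ultimately show ?thesis by (simp add: Q_def)
  qed
  have Fc: "continuous_on {0..1} F"
    unfolding F_def by (intro indefinite_integral_continuous_real continuous_imp_integrable_real ce)
  have lim: "((\<lambda>x. F x - Q x) \<longlongrightarrow> F e - \<phi>1 e / \<phi> e * (h e)\<^sup>2) (at e within {0..1})"
    if "e \<in> {0..1}" "\<phi> e = 0 \<Longrightarrow> h e = 0 \<and> \<phi>1 e \<noteq> 0" for e
    unfolding Q_def
    by (intro tendsto_diff picone_endpoint[OF dh d(1)])
       (use that Fc cp in \<open>auto simp: continuous_on_def continuous_within\<close>)
  have F0: "F 0 = 0" by (simp add: F_def integral_eq_zero_null_sets)
  have l0: "((\<lambda>x. F x - Q x) \<longlongrightarrow> - (\<phi>1 0 / \<phi> 0 * (h 0)\<^sup>2)) (at_right 0)"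
    using lim[of 0] nd0 by (simp add: at_within_Icc_at_right F0)
  have l1: "((\<lambda>x. F x - Q x) \<longlongrightarrow> F 1 - \<phi>1 1 / \<phi> 1 * (h 1)\<^sup>2) (at_left 1)"
    using lim[of 1] nd1 by (simp add: at_within_Icc_at_left)
  have "- (\<phi>1 0 / \<phi> 0 * (h 0)\<^sup>2) \<le> F b - Q b" if "0 < b" "b < 1" for b
  proof (rule tendsto_upperbound[OF l0])
    show "\<forall>\<^sub>F x in at_right 0. F x - Q x \<le> F b - Q b"
      unfolding eventually_at_right_field using mono that by blast
  qed simp
  then have "- (\<phi>1 0 / \<phi> 0 * (h 0)\<^sup>2) \<le> F 1 - \<phi>1 1 / \<phi> 1 * (h 1)\<^sup>2"
    by (intro tendsto_lowerbound[OF l1]) (auto simp: eventually_at_left_field intro!: exI[of _ 0])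
  \<comment> \<open>Since \<open>h\<close> and \<phi> share the boundary conditions, the Picone
    boundary terms equal those from integrating h h'' by parts.\<close>
  moreover have "\<phi>1 1 / \<phi> 1 * (h 1)\<^sup>2 = 0" "h 1 * h1 1 = 0"
    using p bc(2) by (auto simp: right_value_def split: actuation.splits)
  moreover have "\<phi>1 0 / \<phi> 0 * (h 0)\<^sup>2 = h 0 * h1 0"
    using p bc(1) by (auto simp: left_bc_def power2_eq_square split: if_splits)
  moreover have "F 1 = L2_inner h1 h1 - m * L2_inner h h"
    unfolding F_def by (rule L2_inner_energy[OF h])
  ultimately show ?thesis using L2_inner_second_derivative[OF h] by linarith
qed

text \<open>Minimality gives \<mu>1 \<le> m for the eigenvalue m of a positive eigenfunction, and
  the inequality with m implies the one with \<mu>1.\<close>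

lemma smallest_eigenvalue_rayleigh:
  assumes "is_smallest_eigenvalue q act \<mu>1" "q \<noteq> -\<infinity>" and h: "H2_derivs h h1 h2"
    and bc: "left_bc q (h 0) (h1 0)" "right_value act (h 1) (h1 1) = 0"
  shows "L2_inner h h2 \<le> - \<mu>1 * L2_inner h h"
proof -
  obtain m \<phi> \<phi>1 where p: "positive_eigenfunction q act m \<phi> \<phi>1"
    using positive_eigenfunction_exists[OF assms(2)] by blast
  have "\<mu>1 \<le> m"
    using assms(1) positive_eigenfunction_is_eigenvalue[OF p] by (auto simp: is_smallest_eigenvalue_def)
  then have "\<mu>1 * L2_inner h h \<le> m * L2_inner h h"
    by (intro mult_right_mono L2_inner_self_nonneg)
  with positive_eigenfunction_rayleigh[OF p h bc] show ?thesis by simp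
qed

section \<open>Nonnegativity of \<mu> from the lower bound on c\<close>

lemma sinh_ge_self:
  assumes "0 \<le> (x::real)" shows "x \<le> sinh x"
proof -
  have "sinh 0 - 0 \<le> sinh x - x"
    by (rule deriv_within_nonneg_mono[where f = "\<lambda>s. sinh s - s" and f' = "\<lambda>s. cosh s - 1"])
       (use assms cosh_real_ge_1 in \<open>auto intro!: derivative_eq_intros\<close>)
  then show ?thesis by simp
qed

text \<open>Here the extra \<epsilon>/2 for Neumann actuation pays off. One has k^2 tanh^2 k = k^2 -
  k^2 / cosh^2 k, and the last fraction is at most 1/2 because cosh k \<ge> 1 + k^2/2 and (1 +
  k^2/2)^2 \<ge> 2 k^2.\<close>

lemma tanh_lower_bound:
  fixes k qb :: real
  assumes k: "0 < k" and qb: "0 \<le> qb" "k\<^sup>2 = qb\<^sup>2 + 1 / 2"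
  shows "qb \<le> k * tanh k"
proof -
  have "(k / 2)\<^sup>2 \<le> (sinh (k / 2))\<^sup>2" using k sinh_ge_self[of "k / 2"] by (intro power_mono) auto
  moreover have "cosh k = (cosh (k / 2))\<^sup>2 + (sinh (k / 2))\<^sup>2"
    using cosh_add[of "k / 2" "k / 2"] by (simp add: power2_eq_square)
  ultimately have c: "1 + k\<^sup>2 / 2 \<le> cosh k" by (simp add: cosh_square_eq power_divide)
  have "2 * k\<^sup>2 \<le> (1 + k\<^sup>2 / 2)\<^sup>2"
    using zero_le_power2[of "1 - k\<^sup>2 / 2"] by (simp add: power2_eq_square algebra_simps)
  also have "\<dots> \<le> (cosh k)\<^sup>2" using c by (intro power_mono) auto
  finally have "k\<^sup>2 / (cosh k)\<^sup>2 \<le> 1 / 2" by (simp add: field_simps)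
  moreover have "(tanh k)\<^sup>2 = 1 - 1 / (cosh k)\<^sup>2"
    by (simp add: tanh_def power_divide sinh_square_eq field_simps)
  ultimately have "qb\<^sup>2 \<le> (k * tanh k)\<^sup>2" using qb(2) by (simp add: power_mult_distrib right_diff_distrib)
  then show ?thesis by (rule power2_le_imp_le) (use k in simp)
qed

lemma q_bar_nonneg: "q \<noteq> -\<infinity> \<Longrightarrow> 0 \<le> q_bar q"
  by (cases q) (auto simp: q_bar_def max_def zero_ereal_def)

lemma q_bar_ge: "- real_of_ereal q \<le> q_bar q" if "q \<noteq> -\<infinity>"
  using that by (cases q) (auto simp: q_bar_def max_def zero_ereal_def)

text \<open>Picone's inequality with a solution of r' + r^2 = M whose boundary values dominate those
  of \<open>h\<close> yields m \<ge> -M, and c_min is \<epsilon> M.\<close>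

lemma eigenvalue_lower_bound:
  assumes ev: "is_eigenvalue q act m" and q: "q \<noteq> -\<infinity>" and eps: "0 < \<epsilon>" and c: "c_min \<epsilon> q act \<le> c"
  shows "0 \<le> c + \<epsilon> * m"
proof -
  obtain h h1 h2 where h: "H2_derivs h h1 h2" and bc: "left_bc q (h 0) (h1 0)" "right_value act (h 1) (h1 1) = 0"
    and nz: "\<not> L2_eq h (\<lambda>x. 0)" and ev: "L2_eq (\<lambda>x. - h2 x) (\<lambda>x. m * h x)"
    using ev unfolding is_eigenvalue_def by blast
  note ch = H2_derivs_continuous[OF h] and dh = H2_derivsD(1)[OF h]
  have hL: "h \<in> L2" by (rule continuous_imp_L2[OF ch(1)])
  have "L2_inner h (\<lambda>x. -1 * h2 x) = L2_inner h (\<lambda>x. m * h x)"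
    using ev by (intro L2_inner_cong_AE hL L2_cmult H2_derivsD(2)[OF h]) simp
  then have e: "L2_inner h h2 = - m * L2_inner h h" unfolding L2_inner_cmult_right by simp
  have pos: "0 < L2_inner h h"
  proof (rule ccontr)
    assume "\<not> ?thesis"
    then have "h x = 0" if "x \<in> {0..1}" for x using L2_inner_self_pos[OF ch(1) that] by auto
    then have "L2_eq h (\<lambda>x. 0)" unfolding L2_eq_def by (intro AE_I2) simp
    with nz show False ..
  qed
  define M where "M = (case act of Dirichlet \<Rightarrow> (q_bar q)\<^sup>2 | Neumann \<Rightarrow> (q_bar q)\<^sup>2 + 1 / 2)"
  \<comment> \<open>For Dirichlet actuation h(1) = 0, so the constant -q_bar suffices. For Neumann
    actuation r(1) = 0 is required, which leads to -k tanh (k (1 - x)); its value at 0 is at most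
    -q_bar by \<open>tanh_lower_bound\<close>.\<close>
  have "\<exists>r r1. (\<forall>x\<in>{0..1}. (r has_real_derivative r1 x) (at x within {0..1})) \<and> continuous_on {0..1} r1 \<and>
      (\<forall>x\<in>{0..1}. r1 x + (r x)\<^sup>2 \<le> M) \<and> r 0 \<le> - q_bar q \<and> r 1 * (h 1)\<^sup>2 = 0"
  proof (cases act)
    case Dirichlet
    then show ?thesis using bc(2)
      by (intro exI[of _ "\<lambda>x. - q_bar q"] exI[of _ "\<lambda>x. 0"]) (auto simp: M_def right_value_def)
  next
    case Neumann
    define k where "k = sqrt M"
    have M: "M = (q_bar q)\<^sup>2 + 1 / 2" using Neumann by (simp add: M_def)
    then have "0 < M" using zero_le_power2[of "q_bar q"] by linarith
    then have k: "0 < k" "k\<^sup>2 = M" by (auto simp: k_def)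
    have "q_bar q \<le> k * tanh k" by (rule tanh_lower_bound) (use k M q_bar_nonneg[OF q] in auto)
    moreover have cosh: "cosh y \<noteq> 0" for y :: real by simp
    ultimately show ?thesis
      by (intro exI[of _ "\<lambda>x. - k * tanh (k * (1 - x))"] exI[of _ "\<lambda>x. k\<^sup>2 * (1 - (tanh (k * (1 - x)))\<^sup>2)"])
         (auto intro!: derivative_eq_intros continuous_intros simp: k(2)[symmetric] power2_eq_square algebra_simps)
  qed
  then obtain r r1 where r: "\<forall>x\<in>{0..1}. (r has_real_derivative r1 x) (at x within {0..1})"
    "continuous_on {0..1} r1" "\<forall>x\<in>{0..1}. r1 x + (r x)\<^sup>2 \<le> M" "r 0 \<le> - q_bar q" "r 1 * (h 1)\<^sup>2 = 0"
    by blast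
  have "r 1 * (h 1)\<^sup>2 - r 0 * (h 0)\<^sup>2 \<le> (LINT x|lebesgue_on {0..1}. (h1 x)\<^sup>2 - (- M) * (h x)\<^sup>2)"
    by (rule picone_interval[OF dh bspec[OF r(1)] ch(2) r(2)]) (use r(3) in auto)
  then have "- (r 0 * (h 0)\<^sup>2) \<le> L2_inner h1 h1 + M * L2_inner h h"
    using L2_inner_energy[OF h, of "- M"] r(5) by simp
  moreover have "r 0 * (h 0)\<^sup>2 \<le> - q_bar q * (h 0)\<^sup>2" using r(4) by (intro mult_right_mono) auto
  moreover have "- (h 0 * h1 0) \<le> q_bar q * (h 0)\<^sup>2"
  proof (cases "q = \<infinity>")
    case True
    then show ?thesis using bc(1) by (simp add: left_bc_def)
  next
    case False
    then have "- (h 0 * h1 0) = - real_of_ereal q * (h 0)\<^sup>2" using bc(1) by (simp add: left_bc_def power2_eq_square)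
    also have "\<dots> \<le> q_bar q * (h 0)\<^sup>2" using q_bar_ge[OF q] by (intro mult_right_mono) auto
    finally show ?thesis .
  qed
  moreover have "h 1 * h1 1 = 0" using bc(2) by (auto simp: right_value_def split: actuation.splits)
  ultimately have "0 \<le> (m + M) * L2_inner h h"
    using e L2_inner_second_derivative[OF h] unfolding distrib_right by linarith
  then have "0 \<le> m + M" using pos by (simp add: zero_le_mult_iff)
  then have "0 \<le> \<epsilon> * (m + M)" using eps by simp
  moreover have "c_min \<epsilon> q act = \<epsilon> * M" by (cases act) (auto simp: c_min_def M_def algebra_simps)
  ultimately show ?thesis using c by (simp add: algebra_simps)
qed

subsection \<open>The energy of the transformed state\<close>

text \<open>With the difference quotient \<open>Q s\<close> one has A s = A t + (s - t) Q s;
  expanding the square leaves a quotient whose quadratic remainder has the vanishing factor s -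
  t.\<close>

lemma L2_norm_power2_derivative:
  assumes A: "\<forall>\<^sub>F s in at t. A s \<in> L2" "A t \<in> L2" and r: "r \<in> L2"
    and lim: "((\<lambda>s. L2_norm (\<lambda>x. (A s x - A t x) / (s - t) - r x)) \<longlongrightarrow> 0) (at t)"
  shows "((\<lambda>s. (L2_norm (A s))\<^sup>2) has_real_derivative 2 * L2_inner (A t) r) (at t)"
proof -
  define Q where "Q = (\<lambda>s x. (A s x - A t x) / (s - t))"
  have QL: "\<forall>\<^sub>F s in at t. Q s \<in> L2"
    using A(1) by eventually_elim (use A(2) in \<open>auto simp: Q_def intro!: L2_divide L2_diff\<close>)
  have lim': "((\<lambda>s. L2_norm (\<lambda>x. Q s x - r x)) \<longlongrightarrow> 0) (at t)" using lim by (simp add: Q_def)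
  have 1: "((\<lambda>s. L2_inner (A t) (Q s)) \<longlongrightarrow> L2_inner (A t) r) (at t)"
  proof (rule Lim_null[THEN iffD2], rule tendsto_0_le[OF lim'])
    show "\<forall>\<^sub>F s in at t. norm (L2_inner (A t) (Q s) - L2_inner (A t) r) \<le> norm (L2_norm (\<lambda>x. Q s x - r x)) * L2_norm (A t)"
      using QL
    proof eventually_elim
      case (elim s)
      then show ?case
        using L2_Cauchy_Schwarz[OF A(2) L2_diff[OF elim r]] L2_inner_diff_right[OF A(2) elim r]
        by (simp add: mult.commute)
    qed
  qed
  have 2: "((\<lambda>s. L2_norm (Q s)) \<longlongrightarrow> L2_norm r) (at t)"
  proof (rule Lim_null[THEN iffD2], rule tendsto_0_le[OF lim'])
    show "\<forall>\<^sub>F s in at t. norm (L2_norm (Q s) - L2_norm r) \<le> norm (L2_norm (\<lambda>x. Q s x - r x)) * 1"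
      using QL by eventually_elim (use abs_L2_norm_diff_le[OF _ r] in simp)
  qed
  have "((\<lambda>s. 2 * L2_inner (A t) (Q s) + (s - t) * (L2_norm (Q s))\<^sup>2) \<longlongrightarrow>
      2 * L2_inner (A t) r + (t - t) * (L2_norm r)\<^sup>2) (at t)"
    by (intro tendsto_intros 1 2)
  then have "((\<lambda>s. ((L2_norm (A s))\<^sup>2 - (L2_norm (A t))\<^sup>2) / (s - t)) \<longlongrightarrow> 2 * L2_inner (A t) r) (at t)"
  proof (rule Lim_transform_eventually[OF tendsto_eq_rhs])
    have "\<forall>\<^sub>F s in at t. s \<noteq> t" by (simp add: eventually_at_filter)
    with A(1) QL show "\<forall>\<^sub>F s in at t. 2 * L2_inner (A t) (Q s) + (s - t) * (L2_norm (Q s))\<^sup>2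
        = ((L2_norm (A s))\<^sup>2 - (L2_norm (A t))\<^sup>2) / (s - t)"
    proof eventually_elim
      case (elim s)
      have S: "(\<lambda>x. (s - t) * Q s x) \<in> L2" by (rule L2_cmult[OF elim(2)])
      have e: "A s = (\<lambda>x. A t x + (s - t) * Q s x)" using elim by (auto simp: Q_def)
      have r: "L2_inner f (A s) = L2_inner f (A t) + (s - t) * L2_inner f (Q s)" if "f \<in> L2" for f
        unfolding e L2_inner_add_right[OF that A(2) S] L2_inner_cmult_right ..
      have "L2_inner (A s) (A s) = L2_inner (A t) (A t) + 2 * (s - t) * L2_inner (A t) (Q s) + (s - t)\<^sup>2 * L2_inner (Q s) (Q s)"
        using r[OF elim(1)] r[OF A(2)] r[OF elim(2)]
        by (simp add: L2_inner_commute[of "A s" "A t"] L2_inner_commute[of "A s" "Q s"]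
            L2_inner_commute[of "Q s" "A t"] power2_eq_square algebra_simps)
      then show ?case using elim(3) unfolding L2_norm_power2 by (simp add: field_simps power2_eq_square)
    qed
  qed simp
  then show ?thesis by (simp add: has_field_derivative_iff)
qed

text \<open>The closed loop at a single instant, with a two-sided time derivative and a fixed gain.
  The condition is linear in \<open>z\<close>, so the energy estimate also serves the difference of
  two solutions.\<close>

definition closed_loop_at ::
  "real \<Rightarrow> ereal \<Rightarrow> actuation \<Rightarrow> (real \<Rightarrow> real \<Rightarrow> real) \<Rightarrow> (real \<Rightarrow> real \<Rightarrow> real) \<Rightarrow>
   (real \<Rightarrow> real \<Rightarrow> real) \<Rightarrow> (real \<Rightarrow> real \<Rightarrow> real) \<Rightarrow> real \<Rightarrow> bool" where
  "closed_loop_at \<epsilon> q act lam K Kx z t \<longleftrightarrow>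
     (\<exists>zt z1 z2. (\<forall>\<^sub>F s in at t. z s \<in> L2) \<and> zt \<in> L2 \<and>
        ((\<lambda>s. L2_norm (\<lambda>x. (z s x - z t x) / (s - t) - zt x)) \<longlongrightarrow> 0) (at t) \<and>
        H2_derivs (z t) z1 z2 \<and> L2_eq zt (\<lambda>x. \<epsilon> * z2 x + lam t x * z t x) \<and>
        left_bc q (z t 0) (z1 0) \<and> right_value act (z t 1) (z1 1) = control_law act K Kx (z t))"

lemma plant_solution_closed_loop_at:
  assumes sol: "plant_solution \<epsilon> q act lam t0 J U z" and I: "open I" "I \<subseteq> J" "t \<in> I"
    and U: "U t = control_law act K Kx (z t)"
  shows "closed_loop_at \<epsilon> q act lam K Kx z t"
proof -
  obtain zt where C1: "L2_C1_on J z zt" and eqs: "\<forall>t\<in>J. \<exists>z1 z2. H2_derivs (z t) z1 z2 \<and>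
      L2_eq (zt t) (\<lambda>x. \<epsilon> * z2 x + lam t x * z t x) \<and> left_bc q (z t 0) (z1 0) \<and>
      right_value act (z t 1) (z1 1) = U t"
    using sol unfolding plant_solution_def by blast
  have t: "t \<in> J" using I by auto
  obtain z1 z2 where z: "H2_derivs (z t) z1 z2" "L2_eq (zt t) (\<lambda>x. \<epsilon> * z2 x + lam t x * z t x)"
    "left_bc q (z t 0) (z1 0)" "right_value act (z t 1) (z1 1) = U t"
    using eqs t by blast
  have "((\<lambda>s. L2_norm (\<lambda>x. (z s x - z t x) / (s - t) - zt t x)) \<longlongrightarrow> 0) (at t within I)"
    using C1 t I(2) unfolding L2_C1_on_def by (blast intro: tendsto_within_subset)
  then have "((\<lambda>s. L2_norm (\<lambda>x. (z s x - z t x) / (s - t) - zt t x)) \<longlongrightarrow> 0) (at t)"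
    by (simp add: at_within_open[OF I(3,1)])
  moreover have "zt t \<in> L2" using C1 t unfolding L2_C1_on_def L2_continuous_on_def by blast
  moreover have "\<forall>\<^sub>F s in at t. z s \<in> L2"
    using eventually_at_in_open'[OF I(1,3)]
    by eventually_elim (use C1 I in \<open>auto simp: L2_C1_on_def\<close>)
  moreover have "right_value act (z t 1) (z1 1) = control_law act K Kx (z t)" using z(4) U by simp
  ultimately show ?thesis unfolding closed_loop_at_def using z(1-3) by blast
qed

context smooth_kernel
begin

lemma control_law_diff:
  assumes "continuous_on {0..1} u" "continuous_on {0..1} v"
  shows "control_law act K Kx (\<lambda>x. u x - v x) = control_law act K Kx u - control_law act K Kx v"
proof -
  have "integrable (lebesgue_on {0..1}) (\<lambda>y. F 1 y * h y)"
    if "continuous_on triangle (\<lambda>p. F (fst p) (snd p))" "continuous_on {0..1} h"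
    for F :: "real \<Rightarrow> real \<Rightarrow> real" and h :: "real \<Rightarrow> real"
    by (rule volterra_integrable[OF that(1) continuous_imp_L2[OF that(2)]]) simp
  from this[OF K_continuous] this[OF has_partialsD(2)[OF partials(1)]] show ?thesis
    using assms by (auto simp: control_law_def right_diff_distrib split: actuation.splits)
qed

lemma closed_loop_at_diff:
  assumes u: "closed_loop_at \<epsilon> q act lam K Kx u t" and v: "closed_loop_at \<epsilon> q act lam K Kx v t"
  shows "closed_loop_at \<epsilon> q act lam K Kx (\<lambda>s x. u s x - v s x) t"
proof -
  obtain ut u1 u2 where u: "\<forall>\<^sub>F s in at t. u s \<in> L2" "ut \<in> L2"
      "((\<lambda>s. L2_norm (\<lambda>x. (u s x - u t x) / (s - t) - ut x)) \<longlongrightarrow> 0) (at t)"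
      "H2_derivs (u t) u1 u2" "L2_eq ut (\<lambda>x. \<epsilon> * u2 x + lam t x * u t x)"
      "left_bc q (u t 0) (u1 0)" "right_value act (u t 1) (u1 1) = control_law act K Kx (u t)"
    using u unfolding closed_loop_at_def by blast
  obtain vt v1 v2 where v: "\<forall>\<^sub>F s in at t. v s \<in> L2" "vt \<in> L2"
      "((\<lambda>s. L2_norm (\<lambda>x. (v s x - v t x) / (s - t) - vt x)) \<longlongrightarrow> 0) (at t)"
      "H2_derivs (v t) v1 v2" "L2_eq vt (\<lambda>x. \<epsilon> * v2 x + lam t x * v t x)"
      "left_bc q (v t 0) (v1 0)" "right_value act (v t 1) (v1 1) = control_law act K Kx (v t)"
    using v unfolding closed_loop_at_def by blast
  note cu = H2_derivs_continuous[OF u(4)] and cv = H2_derivs_continuous[OF v(4)]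
  have uL: "u t \<in> L2" "v t \<in> L2" using cu(1) cv(1) by (auto intro: continuous_imp_L2)
  have H: "H2_derivs (\<lambda>x. u t x - v t x) (\<lambda>x. u1 x - v1 x) (\<lambda>x. u2 x - v2 x)"
    unfolding H2_derivs_def
  proof (intro conjI ballI)
    show "(\<lambda>x. u2 x - v2 x) \<in> L2" by (intro L2_diff H2_derivsD(2)[OF u(4)] H2_derivsD(2)[OF v(4)])
    fix x :: real assume x: "x \<in> {0..1}"
    show "((\<lambda>x. u t x - v t x) has_real_derivative u1 x - v1 x) (at x within {0..1})"
      by (intro DERIV_diff H2_derivsD(1)[OF u(4)] H2_derivsD(1)[OF v(4)] x)
    show "u1 x - v1 x = u1 0 - v1 0 + (LINT y|lebesgue_on {0..x}. u2 y - v2 y)"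
      using H2_derivsD(3)[OF u(4) x] H2_derivsD(3)[OF v(4) x]
        L2_integrable_on[OF H2_derivsD(2)[OF u(4)] x] L2_integrable_on[OF H2_derivsD(2)[OF v(4)] x] by simp
  qed
  have lim: "((\<lambda>s. L2_norm (\<lambda>x. ((u s x - v s x) - (u t x - v t x)) / (s - t) - (ut x - vt x))) \<longlongrightarrow> 0) (at t)"
  proof (rule tendsto_0_le[OF tendsto_add_zero[OF u(3) v(3)]])
    show "\<forall>\<^sub>F s in at t. norm (L2_norm (\<lambda>x. ((u s x - v s x) - (u t x - v t x)) / (s - t) - (ut x - vt x)))
        \<le> norm (L2_norm (\<lambda>x. (u s x - u t x) / (s - t) - ut x) + L2_norm (\<lambda>x. (v s x - v t x) / (s - t) - vt x)) * 1"
      using u(1) v(1)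
    proof eventually_elim
      case (elim s)
      have L: "(\<lambda>x. (u s x - u t x) / (s - t) - ut x) \<in> L2" "(\<lambda>x. (v s x - v t x) / (s - t) - vt x) \<in> L2"
        using elim uL u(2) v(2) by (auto intro!: L2_diff L2_divide)
      have "L2_norm (\<lambda>x. ((u s x - u t x) / (s - t) - ut x) + -1 * ((v s x - v t x) / (s - t) - vt x))
          \<le> L2_norm (\<lambda>x. (u s x - u t x) / (s - t) - ut x) + L2_norm (\<lambda>x. -1 * ((v s x - v t x) / (s - t) - vt x))"
        by (rule L2_norm_triangle[OF L(1) L2_cmult[OF L(2)]])
      moreover have "(\<lambda>x. ((u s x - u t x) / (s - t) - ut x) + -1 * ((v s x - v t x) / (s - t) - vt x))
          = (\<lambda>x. ((u s x - v s x) - (u t x - v t x)) / (s - t) - (ut x - vt x))"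
        by (rule ext) (simp add: diff_divide_distrib)
      ultimately show ?case unfolding L2_norm_cmult by simp
    qed
  qed
  show ?thesis unfolding closed_loop_at_def
  proof (intro exI conjI)
    show "\<forall>\<^sub>F s in at t. (\<lambda>x. u s x - v s x) \<in> L2"
      using u(1) v(1) by eventually_elim (rule L2_diff)
    show "(\<lambda>x. ut x - vt x) \<in> L2" by (rule L2_diff[OF u(2) v(2)])
    show "L2_eq (\<lambda>x. ut x - vt x) (\<lambda>x. \<epsilon> * (u2 x - v2 x) + lam t x * (u t x - v t x))"
      using u(5) v(5) unfolding L2_eq_def by eventually_elim (simp add: algebra_simps)
    show "left_bc q (u t 0 - v t 0) (u1 0 - v1 0)"
      using u(6) v(6) by (auto simp: left_bc_def right_diff_distrib)
    show "right_value act (u t 1 - v t 1) (u1 1 - v1 1) = control_law act K Kx (\<lambda>x. u t x - v t x)"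
      unfolding control_law_diff[OF cu(1) cv(1)] using u(7) v(7)
      by (cases act) (simp_all add: right_value_def)
  qed (use H lim in auto)
qed

lemma energy_derivative:
  assumes z: "closed_loop_at \<epsilon> q act lam K Kx z t" and lam: "continuous_on {0..1} (lam t)"
    and \<mu>1: "is_smallest_eigenvalue q act \<mu>1" and q: "q \<noteq> -\<infinity>"
  defines "w \<equiv> backstepping_transform K (z t)"
  obtains D where "((\<lambda>s. (L2_norm (backstepping_transform K (z s)))\<^sup>2) has_real_derivative D) (at t)"
    and "D \<le> - 2 * (c + \<epsilon> * \<mu>1) * (L2_norm w)\<^sup>2
      + 2 * L2_inner w (backstepping_transform K (\<lambda>x. (lam t x - b x) * z t x))"
proof -
  obtain zt z1 z2 where z: "\<forall>\<^sub>F s in at t. z s \<in> L2" "zt \<in> L2"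
      "((\<lambda>s. L2_norm (\<lambda>x. (z s x - z t x) / (s - t) - zt x)) \<longlongrightarrow> 0) (at t)"
      "H2_derivs (z t) z1 z2" "L2_eq zt (\<lambda>x. \<epsilon> * z2 x + lam t x * z t x)"
      "left_bc q (z t 0) (z1 0)" "right_value act (z t 1) (z1 1) = control_law act K Kx (z t)"
    using z unfolding closed_loop_at_def by blast
  note cz = H2_derivs_continuous[OF z(4)] and cK = K_continuous
  have zL: "z t \<in> L2" by (rule continuous_imp_L2[OF cz(1)])
  obtain w1 w2 where w: "H2_derivs w w1 w2" "left_bc q (w 0) (w1 0)" "w1 1 = z1 1 - control_law Neumann K Kx (z t)"
    and op: "\<And>x. x \<in> {0..1} \<Longrightarrow> backstepping_transform K (\<lambda>x. \<epsilon> * z2 x + b x * z t x) x = \<epsilon> * w2 x - c * w x"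
    using backstepping_transform_H2[OF z(4,6)] unfolding w_def by blast
  have wL: "w \<in> L2" "w2 \<in> L2"
    using continuous_imp_L2[OF H2_derivs_continuous(1)[OF w(1)]] H2_derivsD(2)[OF w(1)] by auto
  let ?T = "backstepping_transform K"
  define f where "f = (\<lambda>x. (lam t x - b x) * z t x)"
  have fL: "f \<in> L2" unfolding f_def by (intro continuous_imp_L2 continuous_intros lam b cz)
  have gL: "(\<lambda>x. \<epsilon> * z2 x + b x * z t x) \<in> L2"
    by (intro L2_add L2_cmult H2_derivsD(2)[OF z(4)] continuous_imp_L2 continuous_intros b cz)
  have rw: "right_value act (w 1) (w1 1) = 0"
    using z(7) w(3) by (cases act) (simp_all add: right_value_def w_def backstepping_transform_def control_law_def)
  have TzL: "?T h \<in> L2" if "h \<in> L2" for h by (rule backstepping_transform_L2[OF cK that])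
  have "((\<lambda>s. L2_norm (\<lambda>x. (?T (z s) x - ?T (z t) x) / (s - t) - ?T zt x)) \<longlongrightarrow> 0) (at t)"
  proof -
    \<comment> \<open>Boundedness of the transformation on L2 is what carries the L2 time derivative
      of \<open>z\<close> over to its image.\<close>
    obtain C where C: "C > 0" "\<And>x y. (x, y) \<in> triangle \<Longrightarrow> \<bar>K x y\<bar> \<le> C * x"
    proof -
      obtain C1 where "C1 > 0" "\<And>x y. (x, y) \<in> triangle \<Longrightarrow> K x y \<le> C1 * x"
        using kernel_bound_linear[OF partials(1) K_zero] by blast
      moreover obtain C2 where "C2 > 0" "\<And>x y. (x, y) \<in> triangle \<Longrightarrow> -1 * K x y \<le> C2 * x"
        using kernel_bound_linear[OF has_partials_cmult[OF partials(1), of "-1"]] K_zero by auto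
      ultimately show ?thesis
      proof (intro that[of "C1 + C2"])
        fix x y assume C: "C1 > 0" "\<And>x y. (x, y) \<in> triangle \<Longrightarrow> K x y \<le> C1 * x"
          "C2 > 0" "\<And>x y. (x, y) \<in> triangle \<Longrightarrow> -1 * K x y \<le> C2 * x" and xy: "(x, y) \<in> triangle"
        have "0 \<le> C1 * x" "0 \<le> C2 * x" using C(1,3) xy by (auto simp: triangle_iff)
        then show "\<bar>K x y\<bar> \<le> (C1 + C2) * x"
          using C(2)[OF xy] C(4)[OF xy] by (simp add: distrib_right abs_le_iff)
      qed simp
    qed
    show ?thesis
    proof (rule tendsto_0_le[OF z(3)])
      show "\<forall>\<^sub>F s in at t. norm (L2_norm (\<lambda>x. (?T (z s) x - ?T (z t) x) / (s - t) - ?T zt x))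
          \<le> norm (L2_norm (\<lambda>x. (z s x - z t x) / (s - t) - zt x)) * (1 + C / 2)"
        using z(1)
      proof eventually_elim
        case (elim s)
        define h where "h = (\<lambda>x. (z s x - z t x) / (s - t) - zt x)"
        have h: "h = (\<lambda>x. 1 / (s - t) * (z s x - z t x) - zt x)" by (simp add: h_def)
        have L: "(\<lambda>x. z s x - z t x) \<in> L2" by (rule L2_diff[OF elim zL])
        have hL: "h \<in> L2" unfolding h by (rule L2_diff[OF L2_cmult[OF L] z(2)])
        have "L2_norm (\<lambda>x. (?T (z s) x - ?T (z t) x) / (s - t) - ?T zt x) = L2_norm (?T h)"
        proof (rule L2_norm_cong)
          fix x :: real assume x: "x \<in> {0..1}"
          show "(?T (z s) x - ?T (z t) x) / (s - t) - ?T zt x = ?T h x"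
            unfolding h backstepping_transform_diff[OF cK L2_cmult[OF L] z(2) x] backstepping_transform_cmult
              backstepping_transform_diff[OF cK elim zL x] by simp
        qed
        also have "\<dots> = L2_norm (\<lambda>x. h x + -1 * volterra K h x)"
          by (simp add: backstepping_transform_eq)
        also have "\<dots> \<le> L2_norm h + L2_norm (\<lambda>x. -1 * volterra K h x)"
          by (rule L2_norm_triangle[OF hL L2_cmult[OF volterra_L2[OF cK hL]]])
        also have "\<dots> \<le> L2_norm h + C / 2 * L2_norm h"
          unfolding L2_norm_cmult using volterra_norm[OF cK hL _ C(2)] C(1) by simp
        finally show ?case by (simp add: h_def algebra_simps)
      qed
    qed
  qed
  then have D: "((\<lambda>s. (L2_norm (?T (z s)))\<^sup>2) has_real_derivative 2 * L2_inner w (?T zt)) (at t)"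
    unfolding w_def
    by (intro L2_norm_power2_derivative TzL zL z(2) eventually_mono[OF z(1)])
  \<comment> \<open>The coefficient is split into its frozen value \<open>b\<close>, which the
    kernel removes, and the deviation from it, which becomes the perturbation
    \<open>f\<close>.\<close>
  have "L2_inner w (?T zt) = L2_inner w (?T (\<lambda>x. (\<epsilon> * z2 x + b x * z t x) + f x))"
  proof -
    have "L2_eq zt (\<lambda>x. (\<epsilon> * z2 x + b x * z t x) + f x)"
      using z(5) unfolding L2_eq_def by eventually_elim (simp add: f_def algebra_simps)
    then show ?thesis
      by (intro L2_inner_cong_AE backstepping_transform_cong_AE[OF cK] TzL wL z(2) L2_add gL fL)
  qed
  also have "\<dots> = L2_inner w (\<lambda>x. (\<epsilon> * w2 x - c * w x) + ?T f x)"
    by (rule L2_inner_cong) (use op backstepping_transform_add[OF cK gL fL] in auto)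
  also have "\<dots> = \<epsilon> * L2_inner w w2 - c * L2_inner w w + L2_inner w (?T f)"
    using wL by (simp add: L2_inner_add_right L2_inner_diff_right L2_inner_cmult_right L2_diff L2_cmult TzL[OF fL])
  finally have e: "L2_inner w (?T zt) = \<epsilon> * L2_inner w w2 - c * L2_inner w w + L2_inner w (?T f)" .
  have "L2_inner w w2 \<le> - \<mu>1 * L2_inner w w"
    by (rule smallest_eigenvalue_rayleigh[OF \<mu>1 q w(1,2) rw])
  then have "\<epsilon> * L2_inner w w2 \<le> \<epsilon> * (- \<mu>1 * L2_inner w w)" using eps by (intro mult_left_mono) auto
  with e have "2 * L2_inner w (?T zt) \<le> - 2 * (c + \<epsilon> * \<mu>1) * (L2_norm w)\<^sup>2 + 2 * L2_inner w (?T f)"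
    unfolding L2_norm_power2 by (simp add: algebra_simps)
  with D show ?thesis unfolding f_def by (rule that)
qed

end

lemma exponential_comparison:
  fixes W D :: "real \<Rightarrow> real"
  assumes W: "\<And>x. x \<in> {s..t} \<Longrightarrow> (W has_real_derivative D x) (at x)"
    and le: "\<And>x. x \<in> {s..t} \<Longrightarrow> D x \<le> k * W x" and st: "s \<le> t"
  shows "W t \<le> exp (k * (t - s)) * W s"
proof -
  have "- (W s * exp (- (k * s))) \<le> - (W t * exp (- (k * t)))"
  proof (rule deriv_within_nonneg_mono[where f = "\<lambda>x. - (W x * exp (- (k * x)))"])
    show "((\<lambda>x. - (W x * exp (- (k * x)))) has_real_derivative (k * W x - D x) * exp (- (k * x))) (at x within {s..t})"
      if "x \<in> {s..t}" for x
    proof -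
      have "((\<lambda>x. exp (- (k * x))) has_real_derivative - k * exp (- (k * x))) (at x within {s..t})"
        by (auto intro!: derivative_eq_intros)
      from DERIV_minus[OF DERIV_mult[OF has_field_derivative_at_within[OF W[OF that]] this]] show ?thesis
        by (rule DERIV_cong) (simp add: algebra_simps)
    qed
    show "0 \<le> (k * W x - D x) * exp (- (k * x))" if "s < x" "x < t" for x
      using le[of x] that by simp
  qed (use st in simp)
  then have le: "W t * exp (- (k * t)) \<le> W s * exp (- (k * s))" by simp
  have "W t = W t * exp (- (k * t)) * exp (k * t)" by (simp add: exp_minus)
  also have "\<dots> \<le> W s * exp (- (k * s)) * exp (k * t)" using le by (rule mult_right_mono) simp
  also have "\<dots> = exp (k * (t - s)) * W s" by (simp add: right_diff_distrib exp_diff exp_minus field_simps)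
  finally show ?thesis .
qed

subsection \<open>The gain constant\<close>

text \<open>The difference of the two sides is d times a polynomial with positive coefficients. The
  rational constants are those arising in \<open>gain_product_le\<close>.\<close>

lemma gain_polynomial:
  fixes d :: real
  assumes d: "0 \<le> d"
  shows "1 + 16 * d * (33 / 40 * (1 + d) ^ 4 + 681 / 1000 * d * (1 + d) ^ 6)\<^sup>2 \<le> (1 + d) ^ 16"
proof -
  let ?p = "(319375 + d * (931350 + d * (4242239 + d * (19505618 + d * (59910024 + d * (124391080 + d *
        (183221005 + d * (195664788 + d * (150966211 + d * (82637038 + d * (32201805 + d * (10598930 +
        d * (4391774 + d * (1934868 + d * (536239 + d * 62500)))))))))))))))"
  have "(1 + d) ^ 16 - (1 + 16 * d * (33 / 40 * (1 + d) ^ 4 + 681 / 1000 * d * (1 + d) ^ 6)\<^sup>2)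
      = d * ?p / 62500"
    by (simp add: power2_eq_square power_numeral_reduce field_simps)
  moreover have "0 \<le> d * ?p / 62500"
    using d by (intro divide_nonneg_nonneg mult_nonneg_nonneg add_nonneg_nonneg) auto
  ultimately show ?thesis by linarith
qed

definition transform_gain :: "real \<Rightarrow> real \<Rightarrow> real" where
  "transform_gain a k = 1 + a / 4 * exp (a / 8 + k)"

text \<open>The exponent exceeds that of \<open>transform_gain\<close> by a/4, the price of
  Gronwall's inequality.\<close>

definition inverse_gain :: "real \<Rightarrow> real \<Rightarrow> real" where
  "inverse_gain a k = 1 + a / 4 * exp (3 * a / 8 + k)"

text \<open>With \<open>E = exp (a/4) = 1 + d\<close> one has \<open>a \<le> 4 d\<close>, and \<open>k \<le> (1 + a)/2\<close> removes the square root
  hidden in \<open>k\<^sup>2 \<le> a\<close>; what remains is a polynomial inequality in \<open>d\<close>.\<close>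

lemma gain_product_le:
  assumes a: "0 < a" and k: "k\<^sup>2 \<le> a"
  shows "transform_gain a k * inverse_gain a k \<le> 1 + sqrt (a / 4 * (exp (4 * a) - 1))"
proof -
  define E where "E = exp (a / 4)"
  define d where "d = E - 1"
  have E1: "1 \<le> E" using a by (simp add: E_def)
  have "1 + a / 4 \<le> E" unfolding E_def by (rule exp_ge_add_one_self)
  then have d: "0 \<le> d" "a \<le> 4 * d" using E1 by (auto simp: d_def)
  have "0 \<le> (k - 1)\<^sup>2" by simp
  then have k': "k \<le> a / 2 + 1 / 2" using k by (simp add: power2_diff)
  have powE: "exp (n * (a / 4)) = E ^ m" if "n = real m" for n m
    unfolding E_def that exp_of_nat_mult ..
  have eh: "exp (1 / 2 :: real) \<le> 33 / 20"
  proof (rule power2_le_imp_le)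
    have "(exp (1 / 2 :: real))\<^sup>2 = exp 1" by (simp flip: exp_double)
    also have "\<dots> < 272 / 100" by (rule e_less_272)
    finally show "(exp (1 / 2 :: real))\<^sup>2 \<le> (33 / 20)\<^sup>2" by (simp add: power2_eq_square)
  qed simp
  have X: "exp (r + k) \<le> 33 / 20 * E ^ 4" if "r \<le> a / 2" for r
  proof -
    have "exp (r + k) \<le> exp (1 / 2 + 4 * (a / 4))" using that k' by simp
    also have "\<dots> = exp (1 / 2) * E ^ 4" unfolding exp_add using powE[of 4 4] by simp
    also have "\<dots> \<le> 33 / 20 * E ^ 4" using eh E1 by (intro mult_right_mono) auto
    finally show ?thesis .
  qed
  have "exp (a / 8 + k) * exp (3 * a / 8 + k) = exp (a / 2 + 2 * k)"
    unfolding exp_add[symmetric] by (simp add: algebra_simps)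
  also have "\<dots> \<le> exp (1 / 2 + 1 / 2 + 6 * (a / 4))" using k' by simp
  also have "\<dots> = exp (1 / 2) * exp (1 / 2) * E ^ 6" unfolding exp_add using powE[of 6 6] by simp
  also have "\<dots> \<le> 33 / 20 * (33 / 20) * E ^ 6" using eh E1 by (intro mult_right_mono mult_mono) auto
  finally have Y: "exp (a / 8 + k) * exp (3 * a / 8 + k) \<le> 1089 / 400 * E ^ 6" by simp
  \<comment> \<open>33/40 is a quarter of 33/20 + 33/20, and 681/1000 rounds up 4 * 1089/6400, where
    the 4 comes from a \<le> 4 d.\<close>
  define B where "B = 33 / 40 * (1 + d) ^ 4 + 681 / 1000 * d * (1 + d) ^ 6"
  have "transform_gain a k * inverse_gain a k
      = 1 + a / 4 * (exp (a / 8 + k) + exp (3 * a / 8 + k)) + (a * a) / 16 * (exp (a / 8 + k) * exp (3 * a / 8 + k))"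
    by (simp add: transform_gain_def inverse_gain_def algebra_simps)
  also have "\<dots> \<le> 1 + a / 4 * (33 / 20 * E ^ 4 + 33 / 20 * E ^ 4) + (a * a) / 16 * (1089 / 400 * E ^ 6)"
    using a X[of "a / 8"] X[of "3 * a / 8"] Y by (intro add_mono mult_left_mono) auto
  also have "\<dots> = 1 + a * (33 / 40 * E ^ 4 + 1089 / 6400 * a * E ^ 6)" by (simp add: algebra_simps)
  also have "\<dots> \<le> 1 + a * B"
  proof -
    have "1089 / 6400 * a \<le> 681 / 1000 * d" using d by simp
    then have "1089 / 6400 * a * E ^ 6 \<le> 681 / 1000 * d * E ^ 6" using E1 by (intro mult_right_mono) auto
    then show ?thesis using a by (simp add: B_def d_def)
  qed
  also have "a * B \<le> sqrt (a / 4 * (exp (4 * a) - 1))"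
  proof (rule real_le_rsqrt)
    \<comment> \<open>Squaring a B and cancelling a/4 leaves 4 a B^2 \<le> exp (4 a) - 1, where exp
      (4 a) is the 16th power of 1 + d.\<close>
    have "4 * a * B\<^sup>2 \<le> 16 * d * B\<^sup>2" using d by (intro mult_right_mono) auto
    also have "\<dots> \<le> exp (4 * a) - 1"
      using gain_polynomial[OF d(1), folded B_def] powE[of 16 16] by (simp add: d_def)
    finally have "a / 4 * (4 * a * B\<^sup>2) \<le> a / 4 * (exp (4 * a) - 1)" using a by (intro mult_left_mono) auto
    then show "(a * B)\<^sup>2 \<le> a / 4 * (exp (4 * a) - 1)" by (simp add: power2_eq_square algebra_simps)
  qed
  finally show ?thesis by simp
qed

subsection \<open>Event-triggered gain scheduling\<close>

locale gain_scheduling =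
  fixes \<epsilon> c lam_bar \<phi> \<mu>1 :: real and q :: ereal and act :: actuation and lam :: "real \<Rightarrow> real \<Rightarrow> real"
  assumes eps: "\<epsilon> > 0" and q: "q \<noteq> -\<infinity>"
    and lam_cont: "\<And>t. 0 \<le> t \<Longrightarrow> continuous_on {0..1} (lam t)"
    and lam_bar: "lam_bar > 0" and lam_le: "\<And>t x. 0 \<le> t \<Longrightarrow> x \<in> {0..1} \<Longrightarrow> \<bar>lam t x\<bar> \<le> lam_bar"
    and phi: "\<phi> > 0"
    and lipschitz: "\<And>t s x. 0 \<le> t \<Longrightarrow> 0 \<le> s \<Longrightarrow> x \<in> {0..1} \<Longrightarrow> \<bar>lam t x - lam s x\<bar> \<le> \<phi> * \<bar>t - s\<bar>"
    and c_min: "c_min \<epsilon> q act \<le> c" and \<mu>1: "is_smallest_eigenvalue q act \<mu>1"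
begin

definition a where "a = (lam_bar + c) / \<epsilon>"
definition fwd where "fwd = transform_gain a (q_bar q)"
definition bwd where "bwd = inverse_gain a (q_bar q)"
definition P where "P = fwd * bwd"
definition \<mu> where "\<mu> = c + \<epsilon> * \<mu>1"

lemma c_ge: "\<epsilon> * (q_bar q)\<^sup>2 \<le> c"
  using c_min eps by (cases act) (auto simp: c_min_def)

lemma c_nonneg: "0 \<le> c"
  using c_ge eps order_trans[OF mult_nonneg_nonneg[of \<epsilon> "(q_bar q)\<^sup>2"]] by simp

lemma a_pos: "0 < a"
  using c_nonneg lam_bar eps by (simp add: a_def)

lemma q_bar_le: "(q_bar q)\<^sup>2 \<le> a"
proof -
  have "\<epsilon> * (q_bar q)\<^sup>2 \<le> lam_bar + c" using c_ge lam_bar by simp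
  then show ?thesis using eps by (simp add: a_def field_simps)
qed

lemma gains: "1 < fwd" "1 < bwd" "1 < P"
proof -
  show 1: "1 < fwd" "1 < bwd"
    using a_pos by (auto simp: fwd_def bwd_def transform_gain_def inverse_gain_def)
  show "1 < P" unfolding P_def using 1 by (rule less_1_mult)
qed

lemma P_le: "P \<le> gain_const \<epsilon> lam_bar c"
proof -
  have "a / 4 = (lam_bar + c) / (4 * \<epsilon>)" "4 * a = 4 * (lam_bar + c) / \<epsilon>" by (simp_all add: a_def mult.commute)
  then show ?thesis
    using gain_product_le[OF a_pos q_bar_le] unfolding P_def fwd_def bwd_def gain_const_def by (simp only:)
qed

lemma \<mu>_nonneg: "0 \<le> \<mu>"
  unfolding \<mu>_def using \<mu>1 by (intro eigenvalue_lower_bound[OF _ q eps c_min]) (simp add: is_smallest_eigenvalue_def)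

lemma smooth_kernel_bound:
  assumes t0: "0 \<le> t0" and K: "smooth_kernel \<epsilon> q c (lam t0) K Kx Ky Kxx Kxy Kyy" and xy: "(x, y) \<in> triangle"
  shows "\<bar>K x y\<bar> \<le> kernel_majorant a (q_bar q) x y"
proof -
  interpret smooth_kernel \<epsilon> q c "lam t0" K Kx Ky Kxx Kxy Kyy by (rule K)
  have coef: "\<bar>lam t0 y + c\<bar> / \<epsilon> \<le> a" if "y \<in> {0..1}" for y
    unfolding a_def using lam_le[OF t0 that] c_nonneg eps by (intro divide_right_mono) auto
  show ?thesis
  proof (rule kernel_bound[OF partials a_pos q_bar_nonneg[OF q] _ _ K_zero _ xy])
    fix x y assume xy: "(x, y) \<in> triangle"
    have "\<bar>Kxx x y - Kyy x y\<bar> = \<bar>lam t0 y + c\<bar> / \<epsilon> * \<bar>K x y\<bar>"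
      unfolding pde[OF xy] using eps by (simp add: abs_mult)
    also have "\<dots> \<le> a * \<bar>K x y\<bar>" using coef[of y] xy by (intro mult_right_mono) (auto simp: triangle_iff)
    finally show "\<bar>Kxx x y - Kyy x y\<bar> \<le> a * \<bar>K x y\<bar>" .
  next
    fix x :: real assume x: "x \<in> {0..1}"
    have "2 * \<bar>Kx x x + Ky x x\<bar> = \<bar>lam t0 x + c\<bar> / \<epsilon>"
    proof -
      have "2 * (Kx x x + Ky x x) = - (lam t0 x + c) / \<epsilon>" using Kx_plus_Ky[OF x] eps by (simp add: field_simps)
      then have "\<bar>2 * (Kx x x + Ky x x)\<bar> = \<bar>- (lam t0 x + c) / \<epsilon>\<bar>" by (rule arg_cong)
      then show ?thesis using eps by (simp only: abs_mult abs_divide abs_minus_cancel abs_numeral abs_of_pos)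
    qed
    then show "\<bar>Kx x x + Ky x x\<bar> \<le> a / 2" using coef[OF x] by simp
  next
    show "(\<forall>x\<in>{0..1}. K x 0 = 0) \<or> (\<exists>\<rho>\<ge>- q_bar q. \<forall>x\<in>{0..1}. Ky x 0 = \<rho> * K x 0)"
    proof (cases "q = \<infinity>")
      case True
      then show ?thesis using left by (simp add: left_bc_def)
    next
      case False
      then have "\<forall>x\<in>{0..1}. Ky x 0 = real_of_ereal q * K x 0" using left by (simp add: left_bc_def)
      then show ?thesis using q_bar_ge[OF q] by (intro disjI2 exI[of _ "real_of_ereal q"]) auto
    qed
  qed
qed

section \<open>Estimates on one interval between events\<close>

lemma transform_bounds:
  assumes t0: "0 \<le> t0" and K: "smooth_kernel \<epsilon> q c (lam t0) K Kx Ky Kxx Kxy Kyy"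
  shows "h \<in> L2 \<Longrightarrow> L2_norm (backstepping_transform K h) \<le> fwd * L2_norm h"
    and "continuous_on {0..1} h \<Longrightarrow> L2_norm h \<le> bwd * L2_norm (backstepping_transform K h)"
proof -
  interpret smooth_kernel \<epsilon> q c "lam t0" K Kx Ky Kxx Kxy Kyy by (rule K)
  note bound = smooth_kernel_bound[OF t0 K]
  note ak = less_imp_le[OF a_pos] q_bar_nonneg[OF q]
  show "h \<in> L2 \<Longrightarrow> L2_norm (backstepping_transform K h) \<le> fwd * L2_norm h"
    unfolding fwd_def transform_gain_def by (rule backstepping_transform_norm[OF K_continuous _ ak bound])
  show "continuous_on {0..1} h \<Longrightarrow> L2_norm h \<le> bwd * L2_norm (backstepping_transform K h)"
    unfolding bwd_def inverse_gain_def by (rule backstepping_transform_inverse_norm[OF K_continuous _ ak bound])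
qed

text \<open>Transforming the perturbation costs \<open>fwd\<close>, and returning from the
  transformed state to \<open>h\<close> costs \<open>bwd\<close>; hence the product
  \<open>P\<close>.\<close>

lemma perturbation_bound:
  assumes t0: "0 \<le> t0" and K: "smooth_kernel \<epsilon> q c (lam t0) K Kx Ky Kxx Kxy Kyy"
    and t: "t0 \<le> t" and h: "continuous_on {0..1} h"
  shows "L2_inner (backstepping_transform K h) (backstepping_transform K (\<lambda>x. (lam t x - lam t0 x) * h x))
    \<le> P * \<phi> * (t - t0) * (L2_norm (backstepping_transform K h))\<^sup>2"
proof -
  interpret smooth_kernel \<epsilon> q c "lam t0" K Kx Ky Kxx Kxy Kyy by (rule K)
  let ?T = "backstepping_transform K" and ?f = "\<lambda>x. (lam t x - lam t0 x) * h x"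
  have hL: "h \<in> L2" by (rule continuous_imp_L2[OF h])
  have fL: "?f \<in> L2"
    using t0 t by (intro continuous_imp_L2 continuous_intros lam_cont h) auto
  have TL: "?T h \<in> L2" "?T ?f \<in> L2" by (auto intro: backstepping_transform_L2[OF K_continuous] hL fL)
  have "L2_norm ?f \<le> L2_norm (\<lambda>x. \<phi> * (t - t0) * h x)"
  proof (rule L2_norm_mono(2)[OF L2_measurable[OF fL] L2_cmult[OF hL]])
    show "\<bar>(lam t x - lam t0 x) * h x\<bar> \<le> \<bar>\<phi> * (t - t0) * h x\<bar>" if "x \<in> {0..1}" for x
      unfolding abs_mult using lipschitz[of t t0 x] that t t0 phi by (intro mult_right_mono) (auto simp: abs_mult)
  qed
  also have "\<dots> = \<phi> * (t - t0) * L2_norm h" unfolding L2_norm_cmult using t phi by simp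
  also have "\<dots> \<le> \<phi> * (t - t0) * (bwd * L2_norm (?T h))"
    using transform_bounds(2)[OF t0 K h] t phi by (intro mult_left_mono) auto
  finally have f: "L2_norm ?f \<le> \<phi> * (t - t0) * (bwd * L2_norm (?T h))" .
  have "L2_inner (?T h) (?T ?f) \<le> L2_norm (?T h) * L2_norm (?T ?f)" by (rule L2_inner_le[OF TL])
  also have "\<dots> \<le> L2_norm (?T h) * (fwd * L2_norm ?f)"
    by (intro mult_left_mono transform_bounds(1)[OF t0 K fL]) simp
  also have "\<dots> \<le> L2_norm (?T h) * (fwd * (\<phi> * (t - t0) * (bwd * L2_norm (?T h))))"
    using f gains(1) by (intro mult_left_mono) auto
  finally show ?thesis by (simp add: P_def power2_eq_square mult_ac)
qed

text \<open>The trigger demands more than \<mu> R times the squared norm, while the perturbation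
  bound grows only linearly from 0. Strictness of the trigger excludes a vanishing transformed
  state.\<close>

lemma dwell_time:
  assumes t0: "0 \<le> t0" and K: "smooth_kernel \<epsilon> q c (lam t0) K Kx Ky Kxx Kxy Kyy"
    and sol: "plant_solution \<epsilon> q act lam t0 J U v" and t: "t \<in> trigger_set lam \<mu> R t0 K v"
  shows "t0 + \<mu> * R / (\<phi> * P) \<le> t"
proof -
  let ?w = "backstepping_transform K (v t)"
  have t': "t0 < t" and tr: "\<mu> * R * (L2_norm ?w)\<^sup>2
      < L2_inner ?w (backstepping_transform K (\<lambda>x. (lam t x - lam t0 x) * v t x))"
    using t by (auto simp: trigger_set_def)
  have "v t \<in> H2" using sol t' by (auto simp: plant_solution_def)
  then have "continuous_on {0..1} (v t)" using H2_derivs_continuous(1) by (auto simp: H2_def)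
  from perturbation_bound[OF t0 K less_imp_le[OF t'] this] tr
  have "\<mu> * R * (L2_norm ?w)\<^sup>2 < P * \<phi> * (t - t0) * (L2_norm ?w)\<^sup>2" by linarith
  then have "\<mu> * R < P * \<phi> * (t - t0)" by (rule mult_right_less_imp_less) simp
  moreover have "0 < \<phi> * P" using phi gains by simp
  ultimately have "\<mu> * R / (\<phi> * P) < t - t0" by (simp add: pos_divide_less_eq mult_ac)
  then show ?thesis by simp
qed

text \<open>The rate \<open>\<kappa>\<close> is left open for two uses: \<mu> R for the decay
  between events, and a crude bound growing with time for uniqueness. Gronwall's inequality starts
  at s > t0; as s tends to t0 the forward bound leaves only the limit \<open>N\<close> of the
  untransformed norms.\<close>

lemma energy_comparison:
  assumes t0: "0 \<le> t0" and K: "smooth_kernel \<epsilon> q c (lam t0) K Kx Ky Kxx Kxy Kyy"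
    and z: "\<And>s. t0 < s \<Longrightarrow> s \<le> t \<Longrightarrow> closed_loop_at \<epsilon> q act lam K Kx z s"
    and f: "\<And>s. t0 < s \<Longrightarrow> s \<le> t \<Longrightarrow>
      L2_inner (backstepping_transform K (z s)) (backstepping_transform K (\<lambda>x. (lam s x - lam t0 x) * z s x))
        \<le> \<kappa> * (L2_norm (backstepping_transform K (z s)))\<^sup>2"
    and lim: "((\<lambda>s. L2_norm (z s)) \<longlongrightarrow> N) (at_right t0)" and t: "t0 < t"
  shows "L2_norm (backstepping_transform K (z t)) \<le> fwd * exp ((\<kappa> - \<mu>) * (t - t0)) * N"
proof -
  interpret smooth_kernel \<epsilon> q c "lam t0" K Kx Ky Kxx Kxy Kyy by (rule K)
  define W where "W = (\<lambda>s. (L2_norm (backstepping_transform K (z s)))\<^sup>2)"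
  have "\<exists>D. (W has_real_derivative D) (at s) \<and> D \<le> 2 * (\<kappa> - \<mu>) * W s" if s: "t0 < s" "s \<le> t" for s
  proof -
    have "continuous_on {0..1} (lam s)" using s t0 by (intro lam_cont) auto
    then obtain D where D: "(W has_real_derivative D) (at s)"
      "D \<le> - 2 * (c + \<epsilon> * \<mu>1) * (L2_norm (backstepping_transform K (z s)))\<^sup>2
        + 2 * L2_inner (backstepping_transform K (z s)) (backstepping_transform K (\<lambda>x. (lam s x - lam t0 x) * z s x))"
      using energy_derivative[OF z[OF s] _ \<mu>1 q] unfolding W_def by blast
    then have "D \<le> - 2 * \<mu> * W s + 2 * (\<kappa> * W s)" using f[OF s] unfolding \<mu>_def W_def by linarith
    then have "D \<le> 2 * (\<kappa> - \<mu>) * W s" by (simp add: algebra_simps)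
    with D(1) show ?thesis by blast
  qed
  then obtain D where D: "\<And>s. t0 < s \<Longrightarrow> s \<le> t \<Longrightarrow> (W has_real_derivative D s) (at s)"
    "\<And>s. t0 < s \<Longrightarrow> s \<le> t \<Longrightarrow> D s \<le> 2 * (\<kappa> - \<mu>) * W s"
    by metis
  have le: "L2_norm (backstepping_transform K (z t)) \<le> fwd * exp ((\<kappa> - \<mu>) * (t - s)) * L2_norm (z s)"
    if s: "t0 < s" "s < t" for s
  proof -
    have "W t \<le> exp (2 * (\<kappa> - \<mu>) * (t - s)) * W s"
      by (rule exponential_comparison[where D = D]) (use s D in auto)
    also have "\<dots> = (exp ((\<kappa> - \<mu>) * (t - s)) * L2_norm (backstepping_transform K (z s)))\<^sup>2"
      unfolding W_def power_mult_distrib exp_double[symmetric] by (simp add: mult_ac)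
    finally have 1: "L2_norm (backstepping_transform K (z t)) \<le> exp ((\<kappa> - \<mu>) * (t - s)) * L2_norm (backstepping_transform K (z s))"
      unfolding W_def by (rule power2_le_imp_le) simp
    have "z s \<in> L2"
      using z[of s] s H2_derivs_continuous(1) continuous_imp_L2 unfolding closed_loop_at_def by fastforce
    then have "exp ((\<kappa> - \<mu>) * (t - s)) * L2_norm (backstepping_transform K (z s)) \<le> exp ((\<kappa> - \<mu>) * (t - s)) * (fwd * L2_norm (z s))"
      by (intro mult_left_mono transform_bounds(1)[OF t0 K]) auto
    also have "\<dots> = fwd * exp ((\<kappa> - \<mu>) * (t - s)) * L2_norm (z s)" by simp
    finally show ?thesis using 1 by linarith
  qed
  have "((\<lambda>s. fwd * exp ((\<kappa> - \<mu>) * (t - s)) * L2_norm (z s)) \<longlongrightarrow> fwd * exp ((\<kappa> - \<mu>) * (t - t0)) * N) (at_right t0)"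
    by (intro tendsto_intros lim)
  then show ?thesis
  proof (rule tendsto_lowerbound)
    show "\<forall>\<^sub>F s in at_right t0. L2_norm (backstepping_transform K (z t)) \<le> fwd * exp ((\<kappa> - \<mu>) * (t - s)) * L2_norm (z s)"
      unfolding eventually_at_right_field using le t by blast
  qed simp
qed

lemma closed_loop_at_continuous:
  assumes "closed_loop_at \<epsilon> q act lam K Kx z t"
  shows "continuous_on {0..1} (z t)"
  using assms H2_derivs_continuous(1) unfolding closed_loop_at_def by blast

text \<open>The difference solves the same linear closed loop with initial limit 0. No trigger bound
  holds along it, so \<open>perturbation_bound\<close> provides a rate, finite on [t0, t], and the
  energy stays 0.\<close>

lemma closed_loop_unique:
  assumes t0: "0 \<le> t0" and K: "smooth_kernel \<epsilon> q c (lam t0) K Kx Ky Kxx Kxy Kyy"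
    and u: "\<And>s. t0 < s \<Longrightarrow> s \<le> t \<Longrightarrow> closed_loop_at \<epsilon> q act lam K Kx u s"
    and v: "\<And>s. t0 < s \<Longrightarrow> s \<le> t \<Longrightarrow> closed_loop_at \<epsilon> q act lam K Kx v s"
    and lim: "((\<lambda>s. L2_norm (\<lambda>x. u s x - v s x)) \<longlongrightarrow> 0) (at_right t0)" and t: "t0 < t"
  shows "L2_norm (u t) = L2_norm (v t)"
proof -
  interpret smooth_kernel \<epsilon> q c "lam t0" K Kx Ky Kxx Kxy Kyy by (rule K)
  let ?d = "\<lambda>s x. u s x - v s x"
  have d: "closed_loop_at \<epsilon> q act lam K Kx ?d s" if "t0 < s" "s \<le> t" for s
    using that by (intro closed_loop_at_diff u v)
  have "L2_norm (backstepping_transform K (?d t)) \<le> fwd * exp ((P * \<phi> * (t - t0) - \<mu>) * (t - t0)) * 0"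
  proof (rule energy_comparison[OF t0 K d _ lim t])
    fix s assume s: "t0 < s" "s \<le> t"
    have "L2_inner (backstepping_transform K (?d s)) (backstepping_transform K (\<lambda>x. (lam s x - lam t0 x) * ?d s x))
        \<le> P * \<phi> * (s - t0) * (L2_norm (backstepping_transform K (?d s)))\<^sup>2"
      using s by (intro perturbation_bound[OF t0 K] closed_loop_at_continuous[OF d]) auto
    also have "\<dots> \<le> P * \<phi> * (t - t0) * (L2_norm (backstepping_transform K (?d s)))\<^sup>2"
      using s gains(3) phi by (intro mult_right_mono mult_left_mono) auto
    finally show "L2_inner (backstepping_transform K (?d s)) (backstepping_transform K (\<lambda>x. (lam s x - lam t0 x) * ?d s x))
        \<le> P * \<phi> * (t - t0) * (L2_norm (backstepping_transform K (?d s)))\<^sup>2" .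
  qed
  then have z: "L2_norm (backstepping_transform K (?d t)) = 0" using L2_norm_nonneg[of "backstepping_transform K (?d t)"] by simp
  have "L2_norm (?d t) \<le> bwd * L2_norm (backstepping_transform K (?d t))"
    using t by (intro transform_bounds(2)[OF t0 K] closed_loop_at_continuous[OF d]) auto
  then have "L2_norm (?d t) = 0" using z L2_norm_nonneg[of "?d t"] by simp
  moreover have "u t \<in> L2" "v t \<in> L2"
    using t by (auto intro!: continuous_imp_L2 closed_loop_at_continuous u v)
  ultimately show ?thesis using abs_L2_norm_diff_le[of "u t" "v t"] by simp
qed

lemma L2_norm_tendsto:
  assumes "L2_continuous_on {t0..} z" "t0 \<le> t"
  shows "((\<lambda>s. L2_norm (z s)) \<longlongrightarrow> L2_norm (z t)) (at t within {t0..})"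
proof -
  have z: "z s \<in> L2" if "t0 \<le> s" for s using assms that by (auto simp: L2_continuous_on_def)
  have lim: "((\<lambda>s. L2_norm (\<lambda>x. z s x - z t x)) \<longlongrightarrow> 0) (at t within {t0..})"
    using assms by (auto simp: L2_continuous_on_def)
  show ?thesis
  proof (rule Lim_null[THEN iffD2], rule tendsto_0_le[OF lim])
    show "\<forall>\<^sub>F s in at t within {t0..}. norm (L2_norm (z s) - L2_norm (z t)) \<le> norm (L2_norm (\<lambda>x. z s x - z t x)) * 1"
      unfolding eventually_at_filter
      by (rule always_eventually) (use abs_L2_norm_diff_le[OF z z] assms(2) in auto)
  qed
qed

text \<open>The trigger bound is known along \<open>v\<close>, whereas decay is wanted for
  \<open>u\<close>. Uniqueness identifies their norms before the next event, so the energy estimate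
  is run on \<open>v\<close> with rate \<mu> R - \<mu>.\<close>

lemma decay_until_next_event:
  assumes t0: "0 \<le> t0" and K: "backstepping_kernel \<epsilon> q c (lam t0) K Kx"
    and v: "plant_solution \<epsilon> q act lam t0 {t0<..} (\<lambda>t. control_law act K Kx (v t)) v"
    and u: "plant_solution \<epsilon> q act lam 0 J U u" and eq: "L2_eq (v t0) (u t0)"
    and J: "\<And>s. t0 < s \<Longrightarrow> s < T \<Longrightarrow> s \<in> J \<and> U s = control_law act K Kx (u s) \<and> s \<notin> trigger_set lam \<mu> R t0 K v"
    and t: "t0 < t" "t < T"
  shows "L2_norm (u t) \<le> P * exp (- (\<mu> * (1 - R)) * (t - t0)) * L2_norm (u t0)"
proof -
  obtain Ky Kxx Kxy Kyy where K: "smooth_kernel \<epsilon> q c (lam t0) K Kx Ky Kxx Kxy Kyy"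
    by (rule backstepping_kernelE[OF K eps lam_cont[OF t0]])
  have uc: "L2_continuous_on {0..} u" and vc: "L2_continuous_on {t0..} v"
    using u v by (auto simp: plant_solution_def)
  have u_cl: "closed_loop_at \<epsilon> q act lam K Kx u s" if "t0 < s" "s < T" for s
    by (rule plant_solution_closed_loop_at[OF u, of "{t0<..<T}"]) (use J that in auto)
  have v_cl: "closed_loop_at \<epsilon> q act lam K Kx v s" if "t0 < s" for s
    by (rule plant_solution_closed_loop_at[OF v, of "{t0<..}"]) (use that in auto)
  have uL: "u s \<in> L2" if "t0 \<le> s" for s using uc that t0 by (auto simp: L2_continuous_on_def)
  have vL: "v s \<in> L2" if "t0 \<le> s" for s using vc that by (auto simp: L2_continuous_on_def)
  have right: "at_right t0 \<le> at t0 within {t0..}" "at_right t0 \<le> at t0 within {0..}"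
    using t0 by (auto intro!: at_le)
  have "((\<lambda>s. L2_norm (\<lambda>x. u s x - u t0 x)) \<longlongrightarrow> 0) (at t0 within {0..})"
    using uc t0 by (auto simp: L2_continuous_on_def)
  then have u0: "((\<lambda>s. L2_norm (\<lambda>x. u s x - u t0 x)) \<longlongrightarrow> 0) (at_right t0)"
    by (rule tendsto_mono[OF right(2)])
  have "((\<lambda>s. L2_norm (\<lambda>x. v s x - v t0 x)) \<longlongrightarrow> 0) (at t0 within {t0..})"
    using vc by (auto simp: L2_continuous_on_def)
  then have v0: "((\<lambda>s. L2_norm (\<lambda>x. v s x - v t0 x)) \<longlongrightarrow> 0) (at_right t0)"
    by (rule tendsto_mono[OF right(1)])
  have lim: "((\<lambda>s. L2_norm (\<lambda>x. u s x - v s x)) \<longlongrightarrow> 0) (at_right t0)"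
  proof (rule tendsto_0_le[OF tendsto_add_zero[OF u0 v0]])
    have "L2_norm (\<lambda>x. u s x - v s x) \<le> L2_norm (\<lambda>x. u s x - u t0 x) + L2_norm (\<lambda>x. v s x - v t0 x)" if s: "t0 < s" for s
    proof -
      have L: "(\<lambda>x. u s x - u t0 x) \<in> L2" "(\<lambda>x. v s x - v t0 x) \<in> L2" "(\<lambda>x. u s x - v s x) \<in> L2"
        using s by (auto intro!: L2_diff uL vL)
      note M = L2_cmult[OF L(2), of "-1"]
      \<comment> \<open>The profiles at t0 agree only almost everywhere, so this is an equality of
        norms and not of functions.\<close>
      have "L2_norm (\<lambda>x. u s x - v s x) = L2_norm (\<lambda>x. (u s x - u t0 x) + -1 * (v s x - v t0 x))"
      proof (rule L2_norm_cong_AE[OF _ L(3) L2_add[OF L(1) M]])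
        show "L2_eq (\<lambda>x. u s x - v s x) (\<lambda>x. (u s x - u t0 x) + -1 * (v s x - v t0 x))"
          using eq unfolding L2_eq_def by eventually_elim simp
      qed
      also have "\<dots> \<le> L2_norm (\<lambda>x. u s x - u t0 x) + L2_norm (\<lambda>x. -1 * (v s x - v t0 x))"
        by (rule L2_norm_triangle[OF L(1) M])
      finally show ?thesis unfolding L2_norm_cmult by simp
    qed
    then show "\<forall>\<^sub>F s in at_right t0. norm (L2_norm (\<lambda>x. u s x - v s x))
        \<le> norm (L2_norm (\<lambda>x. u s x - u t0 x) + L2_norm (\<lambda>x. v s x - v t0 x)) * 1"
      unfolding eventually_at_filter by (intro always_eventually) simp
  qed
  have "L2_norm (u t) = L2_norm (v t)"
    by (rule closed_loop_unique[OF t0 K _ _ lim t(1)]) (use t u_cl v_cl in auto)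
  also have "\<dots> \<le> bwd * L2_norm (backstepping_transform K (v t))"
    using t by (intro transform_bounds(2)[OF t0 K] closed_loop_at_continuous[OF v_cl]) auto
  also have "\<dots> \<le> bwd * (fwd * exp ((\<mu> * R - \<mu>) * (t - t0)) * L2_norm (v t0))"
  proof (intro mult_left_mono energy_comparison[OF t0 K])
    show "((\<lambda>s. L2_norm (v s)) \<longlongrightarrow> L2_norm (v t0)) (at_right t0)"
      by (rule tendsto_mono[OF right(1) L2_norm_tendsto[OF vc]]) simp
    fix s assume s: "t0 < s" "s \<le> t"
    then have "s \<notin> trigger_set lam \<mu> R t0 K v" using J[of s] t by auto
    then show "L2_inner (backstepping_transform K (v s)) (backstepping_transform K (\<lambda>x. (lam s x - lam t0 x) * v s x))
        \<le> \<mu> * R * (L2_norm (backstepping_transform K (v s)))\<^sup>2"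
      using s by (simp add: trigger_set_def not_less)
  qed (use v_cl t gains(2) in auto)
  also have "L2_norm (v t0) = L2_norm (u t0)"
    by (rule L2_norm_cong_AE[OF eq]) (auto intro: uL vL)
  finally show ?thesis by (simp add: P_def algebra_simps)
qed

section \<open>Concatenation over all events\<close>

lemma exponential_decay:
  assumes R: "0 < R" "R < 1" and mu: "0 < \<mu>"
    and gap: "\<phi> * (P * ln P) < \<mu>\<^sup>2 * R * (1 - R)"
  shows "\<exists>\<sigma>>0. \<forall>u0 u. event_triggered_solution \<epsilon> q act lam c \<mu> R u0 u \<longrightarrow>
    (\<forall>t\<ge>0. L2_norm (u t) \<le> P * exp (- \<sigma> * t) * L2_norm (u 0))"
proof -
  define T where "T = \<mu> * R / (\<phi> * P)"
  define r where "r = \<mu> * (1 - R)"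
  \<comment> \<open>A factor P at most once every T time units costs at most the rate ln P / T; the
    gap condition says exactly that this is less than r.\<close>
  define \<sigma> where "\<sigma> = r - ln P / T"
  have T: "0 < T" using mu R phi gains by (simp add: T_def)
  have lnP: "0 < ln P" using gains by simp
  have \<sigma>: "0 < \<sigma>" "\<sigma> \<le> r"
  proof -
    have "ln P < T * r" using gap phi gains by (simp add: T_def r_def field_simps power2_eq_square)
    then show "0 < \<sigma>" using T by (simp add: \<sigma>_def field_simps)
    show "\<sigma> \<le> r" using T lnP by (simp add: \<sigma>_def)
  qed
  have "L2_norm (u t) \<le> P * exp (- \<sigma> * t) * L2_norm (u 0)"
    if ets: "event_triggered_solution \<epsilon> q act lam c \<mu> R u0 u" and t: "0 \<le> t" for u0 u t
  proof -
    obtain ts :: "nat \<Rightarrow> ereal" and K Kx v U where ts0: "ts 0 = 0"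
      and tsinf: "\<And>j. ts j = \<infinity> \<Longrightarrow> ts (Suc j) = \<infinity>"
      and step: "\<And>j tj. ts j = ereal tj \<Longrightarrow>
         backstepping_kernel \<epsilon> q c (lam tj) (K j) (Kx j) \<and>
         plant_solution \<epsilon> q act lam tj {tj<..} (\<lambda>t. control_law act (K j) (Kx j) (v j t)) (v j) \<and>
         L2_eq (v j tj) (u tj) \<and>
         ts (Suc j) = Inf (ereal ` trigger_set lam \<mu> R tj (K j) (v j))"
      and U: "\<And>j t. ts j < ereal t \<Longrightarrow> ereal t < ts (Suc j) \<Longrightarrow> U t = control_law act (K j) (Kx j) (u t)"
      and sol: "plant_solution \<epsilon> q act lam 0 {t. t \<ge> 0 \<and> ereal t \<notin> range ts} U u"
      using ets unfolding event_triggered_solution_def by blast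
    have uc: "L2_continuous_on {0..} u" using sol by (simp add: plant_solution_def)
    have dwell: "ereal (tj + T) \<le> ts (Suc j)" if j: "ts j = ereal tj" and tj: "0 \<le> tj" for j tj
    proof -
      obtain Ky Kxx Kxy Kyy where K: "smooth_kernel \<epsilon> q c (lam tj) (K j) (Kx j) Ky Kxx Kxy Kyy"
        using step[OF j] by (blast intro: backstepping_kernelE[OF _ eps lam_cont[OF tj]])
      have "tj + T \<le> s" if "s \<in> trigger_set lam \<mu> R tj (K j) (v j)" for s
        unfolding T_def using step[OF j] that by (blast intro: dwell_time[OF tj K])
      then have "ereal (tj + T) \<le> Inf (ereal ` trigger_set lam \<mu> R tj (K j) (v j))"
        by (intro Inf_greatest) auto
      then show ?thesis using step[OF j] by simp
    qed
    \<comment> \<open>This excludes a finite accumulation point of the event times.\<close>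
    have ge: "ereal (real j * T) \<le> ts j" for j
    proof (induction j)
      case (Suc j)
      show ?case
      proof (cases "ts j")
        case (real tj)
        then have tj: "real j * T \<le> tj" using Suc by simp
        then have "0 \<le> tj" using T order_trans[OF mult_nonneg_nonneg[of "real j" T]] by simp
        from dwell[OF real this] show ?thesis
          by (rule order_trans[rotated]) (use tj in \<open>simp add: algebra_simps\<close>)
      qed (use Suc tsinf in auto)
    qed (use ts0 in \<open>simp add: zero_ereal_def\<close>)
    have ts_nonneg: "0 \<le> tj" if "ts j = ereal tj" for j tj
      using ge[of j] that T order_trans[OF mult_nonneg_nonneg[of "real j" T]] by simp
    have mono: "ts i \<le> ts j" if "i \<le> j" for i j
    proof (rule lift_Suc_mono_le[OF _ that])
      show "ts n \<le> ts (Suc n)" for n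
      proof (cases "ts n")
        case (real tn)
        then show ?thesis using dwell[OF real ts_nonneg[OF real]] T
          by (metis add_increasing2 ereal_less_eq(3) order_trans less_imp_le order_refl)
      qed (use tsinf in auto)
    qed
    have decay: "L2_norm (u s) \<le> P * exp (- r * (s - tj)) * L2_norm (u tj)"
      if j: "ts j = ereal tj" and s: "tj \<le> s" "ereal s \<le> ts (Suc j)" for j tj s
    proof -
      have tj: "0 \<le> tj" by (rule ts_nonneg[OF j])
      have open_decay: "L2_norm (u s) \<le> P * exp (- r * (s - tj)) * L2_norm (u tj)"
        if s: "tj < s" "ereal s < ts (Suc j)" for s
      proof -
        \<comment> \<open>The next event time may be infinite, so a real endpoint beyond
          \<open>s\<close> is inserted.\<close>
        obtain T' where T': "s < T'" "ereal T' \<le> ts (Suc j)"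
          using s(2) by (metis ereal_dense2 less_ereal.simps(1) less_imp_le)
        have "s' \<in> {t. t \<ge> 0 \<and> ereal t \<notin> range ts} \<and> U s' = control_law act (K j) (Kx j) (u s') \<and>
            s' \<notin> trigger_set lam \<mu> R tj (K j) (v j)" if s': "tj < s'" "s' < T'" for s'
        proof -
          have lt: "ts j < ereal s'" "ereal s' < ts (Suc j)"
            using j s' less_le_trans[OF _ T'(2), of "ereal s'"] by auto
          have "ereal s' \<noteq> ts i" for i
          proof (cases "i \<le> j")
            case True
            then show ?thesis using mono[OF True] lt(1) by auto
          next
            case False
            then have "Suc j \<le> i" by simp
            then show ?thesis using mono[of "Suc j" i] lt(2) by auto
          qed
          moreover have "s' \<notin> trigger_set lam \<mu> R tj (K j) (v j)"
          proof
            assume "s' \<in> trigger_set lam \<mu> R tj (K j) (v j)"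
            then have "ts (Suc j) \<le> ereal s'" using step[OF j] by (auto intro: Inf_lower)
            with lt(2) show False by simp
          qed
          ultimately show ?thesis using U[OF lt] tj s' by auto
        qed
        then show ?thesis
          unfolding r_def using step[OF j] s(1) T'(1)
          by (intro decay_until_next_event[OF tj _ _ sol, where T = T' and K = "K j" and Kx = "Kx j" and v = "v j"]) auto
      qed
      consider "s = tj" | "tj < s" "ereal s < ts (Suc j)" | "tj < s" "ereal s = ts (Suc j)"
        using s by force
      then show ?thesis
      proof cases
        case 1
        then show ?thesis using gains(3) mult_right_mono[of 1 P "L2_norm (u tj)"] by simp
      next
        case 2
        then show ?thesis by (rule open_decay)
      next
        case 3
        \<comment> \<open>At the next event itself the equations may fail; continuity in L2 extends
          the bound from the left.\<close>
        have "((\<lambda>s. L2_norm (u s)) \<longlongrightarrow> L2_norm (u s)) (at s within {0..})"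
          using 3 tj by (intro L2_norm_tendsto[OF uc]) auto
        moreover have "at s within {0..} = at s"
          using 3 tj by (intro at_within_interior) (simp add: interior_real_atLeast)
        ultimately have lim: "((\<lambda>s. L2_norm (u s)) \<longlongrightarrow> L2_norm (u s)) (at_left s)"
          by (auto intro: tendsto_mono[OF at_le])
        have lim': "((\<lambda>s. P * exp (- r * (s - tj)) * L2_norm (u tj)) \<longlongrightarrow> P * exp (- r * (s - tj)) * L2_norm (u tj)) (at_left s)"
          by (intro tendsto_intros)
        show ?thesis
        proof (rule tendsto_le[OF _ lim' lim])
          show "\<forall>\<^sub>F s in at_left s. L2_norm (u s) \<le> P * exp (- r * (s - tj)) * L2_norm (u tj)"
            unfolding eventually_at_left_field
          proof (intro exI[of _ tj] conjI allI impI)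
            fix y assume "tj < y" "y < s"
            then show "L2_norm (u y) \<le> P * exp (- r * (y - tj)) * L2_norm (u tj)"
              by (intro open_decay) (auto simp: 3(2)[symmetric])
          qed (rule 3(1))
        qed simp
      qed
    qed
    \<comment> \<open>No factor P appears at event times: each completed interval lasts at least T,
      which suffices to absorb its own factor. The induction would otherwise accumulate powers of
      P.\<close>
    have events: "L2_norm (u tj) \<le> exp (- \<sigma> * tj) * L2_norm (u 0)" if "ts j = ereal tj" for j tj
      using that
    proof (induction j arbitrary: tj)
      case 0
      then show ?case using ts0 by (simp add: zero_ereal_def)
    next
      case (Suc j)
      obtain t' where j: "ts j = ereal t'"
      proof (cases "ts j")
        case MInf
        then show ?thesis using ge[of j] by simp
      qed (use Suc.prems tsinf that in auto)
      have tj: "t' + T \<le> tj" using dwell[OF j ts_nonneg[OF j]] Suc.prems by simp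
      then have "T \<le> tj - t'" by simp
      then have "ln P * T \<le> ln P * (tj - t')" using lnP by (intro mult_left_mono) auto
      then have "ln P \<le> ln P / T * (tj - t')" using T by (simp add: field_simps)
      then have "ln P - r * (tj - t') \<le> - \<sigma> * (tj - t')" by (simp add: \<sigma>_def algebra_simps)
      then have "exp (ln P - r * (tj - t')) \<le> exp (- \<sigma> * (tj - t'))" by simp
      then have gain: "P * exp (- r * (tj - t')) \<le> exp (- \<sigma> * (tj - t'))"
      proof -
        have "exp (ln P - r * (tj - t')) = P * exp (- r * (tj - t'))"
          using gains(3) by (simp add: exp_diff exp_minus divide_inverse)
        then show ?thesis using \<open>exp (ln P - _) \<le> _\<close> by simp
      qed
      have "L2_norm (u tj) \<le> P * exp (- r * (tj - t')) * L2_norm (u t')"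
        by (rule decay[OF j]) (use tj T Suc.prems in auto)
      also have "\<dots> \<le> exp (- \<sigma> * (tj - t')) * L2_norm (u t')" using gain by (intro mult_right_mono) auto
      also have "\<dots> \<le> exp (- \<sigma> * (tj - t')) * (exp (- \<sigma> * t') * L2_norm (u 0))"
        by (intro mult_left_mono Suc.IH[OF j]) simp
      also have "\<dots> = exp (- \<sigma> * tj) * L2_norm (u 0)"
      proof -
        have "exp (- \<sigma> * (tj - t')) * exp (- \<sigma> * t') = exp (- \<sigma> * tj)"
          unfolding exp_add[symmetric] by (simp add: algebra_simps)
        then show ?thesis by (simp only: mult.assoc[symmetric])
      qed
      finally show ?case .
    qed
    \<comment> \<open>By \<open>ge\<close> the n-th event lies after \<open>t\<close>, so
      \<open>t\<close> belongs to one of the intervals between consecutive events.\<close>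
    obtain n where n: "t < real n * T" using T reals_Archimedean3 by blast
    have "\<exists>j. ts j \<le> ereal t \<and> ereal t < ts (Suc j)"
    proof (rule ccontr)
      assume H: "\<nexists>j. ts j \<le> ereal t \<and> ereal t < ts (Suc j)"
      have "ts j \<le> ereal t" for j
      proof (induction j)
        case 0
        then show ?case using ts0 t by simp
      next
        case (Suc j)
        then show ?case using H not_less by blast
      qed
      from order_trans[OF ge[of n] this[of n]] n show False by simp
    qed
    then obtain j where j: "ts j \<le> ereal t" "ereal t < ts (Suc j)" by blast
    obtain tj where tj: "ts j = ereal tj"
      using j(1) ge[of j] by (cases "ts j") auto
    have "L2_norm (u t) \<le> P * exp (- r * (t - tj)) * L2_norm (u tj)"
      by (rule decay[OF tj]) (use j tj in auto)
    also have "\<dots> \<le> P * exp (- \<sigma> * (t - tj)) * (exp (- \<sigma> * tj) * L2_norm (u 0))"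
    proof (intro mult_mono mult_left_mono events[OF tj])
      have "\<sigma> * (t - tj) \<le> r * (t - tj)" using \<sigma>(2) j(1) tj by (intro mult_right_mono) auto
      then show "exp (- r * (t - tj)) \<le> exp (- \<sigma> * (t - tj))" by simp
    qed (use gains(3) in auto)
    also have "\<dots> = P * exp (- \<sigma> * t) * L2_norm (u 0)"
    proof -
      have "exp (- \<sigma> * (t - tj)) * exp (- \<sigma> * tj) = exp (- \<sigma> * t)"
        unfolding exp_add[symmetric] by (simp add: algebra_simps)
      moreover have "P * exp (- \<sigma> * (t - tj)) * (exp (- \<sigma> * tj) * L2_norm (u 0))
          = P * (exp (- \<sigma> * (t - tj)) * exp (- \<sigma> * tj)) * L2_norm (u 0)" by (simp only: mult.assoc)
      ultimately show ?thesis by (simp only:)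
    qed
    finally show ?thesis .
  qed
  with \<sigma>(1) show ?thesis by blast
qed

end

theorem theorem3p5:
  fixes \<epsilon> c lam_bar \<phi> R \<mu>1 \<mu> G :: real
    and q :: ereal
    and act :: actuation
    and lam :: "real \<Rightarrow> real \<Rightarrow> real"
  assumes "\<epsilon> > 0"
    and "q \<noteq> -\<infinity>"
    and "continuous_on ({0..} \<times> {0..1}) (\<lambda>(t, x). lam t x)"
    and "\<forall>t\<ge>0. C1_unit (lam t)"
    and "lam_bar > 0"
    and "\<forall>t\<ge>0. \<forall>x\<in>{0..1}. \<bar>lam t x\<bar> \<le> lam_bar"
    and "\<phi> > 0"
    and "\<forall>x\<in>{0..1}. \<forall>t\<ge>0. \<forall>s\<ge>0. \<bar>lam t x - lam s x\<bar> \<le> \<phi> * \<bar>t - s\<bar>"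
    and "c \<ge> c_min \<epsilon> q act"
    and "is_smallest_eigenvalue q act \<mu>1"
    and "\<mu> = c + \<epsilon> * \<mu>1"
    and "G = gain_const \<epsilon> lam_bar c"
    and "0 < R" and "R < 1"
    and "\<phi> < \<mu>\<^sup>2 * R * (1 - R) / (G\<^sup>2 * ln G)"
  shows "\<exists>\<sigma>>0. \<forall>u0\<in>L2. \<forall>u. event_triggered_solution \<epsilon> q act lam c \<mu> R u0 u \<longrightarrow>
           (\<forall>t\<ge>0. L2_norm (u t) \<le> G * exp (- \<sigma> * t) * L2_norm (u 0))"
proof -
  interpret S: gain_scheduling \<epsilon> c lam_bar \<phi> \<mu>1 q act lam
  proof
    show "continuous_on {0..1} (lam t)" if "0 \<le> t" for t
      using assms(4) that unfolding C1_unit_def by (blast intro: DERIV_continuous_on)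
  qed (use assms(1,2,5-10) in auto)
  have mu: "S.\<mu> = \<mu>" by (simp add: S.\<mu>_def assms(11))
  have PG: "1 < S.P" "S.P \<le> G" using S.gains S.P_le by (simp_all add: assms(12))
  have lnPG: "0 < ln S.P" "ln S.P \<le> ln G" using PG by simp_all
  have G: "0 < G\<^sup>2 * ln G" using PG lnPG by simp
  have "\<phi> * (G\<^sup>2 * ln G) < \<mu>\<^sup>2 * R * (1 - R)"
    using assms(15) G by (simp add: pos_less_divide_eq)
  \<comment> \<open>The passage from P to G^2 gives slack: G > 1 and P \<le> G.\<close>
  moreover have "S.P * ln S.P \<le> G\<^sup>2 * ln G"
  proof (intro mult_mono)
    have "G * 1 \<le> G * G" using PG by (intro mult_left_mono) auto
    then show "S.P \<le> G\<^sup>2" using PG unfolding power2_eq_square by linarith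
  qed (use PG lnPG in auto)
  then have "\<phi> * (S.P * ln S.P) \<le> \<phi> * (G\<^sup>2 * ln G)" using assms(7) by (intro mult_left_mono) auto
  ultimately have gap: "\<phi> * (S.P * ln S.P) < \<mu>\<^sup>2 * R * (1 - R)" by simp
  \<comment> \<open>The lower bound on \<open>c\<close> yields only \<mu> \<ge> 0. Strict positivity
    comes from the smallness condition, whose right-hand side would vanish for \<mu> = 0.\<close>
  have "0 \<le> \<phi> * (S.P * ln S.P)" using assms(7) PG lnPG by simp
  then have "\<mu> \<noteq> 0" using gap by auto
  then have "0 < S.\<mu>" using S.\<mu>_nonneg mu by simp
  from S.exponential_decay[OF assms(13,14) this] gap obtain \<sigma> where \<sigma>: "\<sigma> > 0"
    "\<And>u0 u t. event_triggered_solution \<epsilon> q act lam c \<mu> R u0 u \<Longrightarrow> 0 \<le> t \<Longrightarrow>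
      L2_norm (u t) \<le> S.P * exp (- \<sigma> * t) * L2_norm (u 0)"
    unfolding mu by blast
  have "L2_norm (u t) \<le> G * exp (- \<sigma> * t) * L2_norm (u 0)"
    if "event_triggered_solution \<epsilon> q act lam c \<mu> R u0 u" "0 \<le> t" for u0 u t
    using \<sigma>(2)[OF that] by (rule order_trans) (intro mult_right_mono PG(2), simp_all)
  with \<sigma>(1) show ?thesis by blast
qed

end
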